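(* Let $(a_n)_{n\ge1}$ and $b$ be points in the open unit disc. Then $$\|T^{(a_n)}\|_{L^2(\mathbb T)\to L^2(\mathbb T)}=\|T^{(m_{-b}(a_n))}\|_{L^2(\mathbb T)\to L^2(\mathbb T)}.$$ Furthermore, if $1<q<p<\infty$, then $$\|T^{(m_{-b}(a_n))}\|_{L^p(\mathbb T)\to L^p(\mathbb T)}\le\delta(q,p)\,\|T^{(a_n)}\|_{L^q(\mathbb T)\to L^q(\mathbb T)},$$ where $\delta(q,p)>0$ is a constant depending only on $q$ and $p$ (these constants blow up as $q$ and $p$ get closer).
   Context: For $b$ in the open unit disc, $m_b(z)=\frac{z-b}{1-\overline bz}$ is the Möbius transform taking $b$ to $0$; thus $m_{-b}(z)=\frac{z+b}{1+\overline bz}$, and $(m_{-b}(a_n))$ is the sequence of images of the points $a_n$. For a sequence $(a_n)$ in the open unit disc and $N\ge1$, $$S_N^{(a_n)}f(e^{ix})=\int_{-\pi}^{\pi}f(e^{iy})\prod_{j=1}^N\big(m_{a_j}(e^{iy})\big)^{-1}\frac{dy}{e^{i(x-y)}-1}$$ (a principal value singular integral; here $m_{a_j}(e^{iy})^{-1}=1/m_{a_j}(e^{iy})$), and $T^{(a_n)}f=\sup_N|S_N^{(a_n)}f|$. The norm $\|T\|_{L^p(\mathbb T)\to L^p(\mathbb T)}\in[0,\infty]$ is the smallest $A$ with $\|Tf\|_{L^p(\mathbb T)}\le A\|f\|_{L^p(\mathbb T)}$ for all $f\in L^p(\mathbb T)$, where $\mathbb T$ is the unit circle. *)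

theory Defs
  imports "HOL-Complex_Analysis.Complex_Analysis"
begin

definition mobius :: "complex \<Rightarrow> complex \<Rightarrow> complex" where
  "mobius b z = (z - b) / (1 - cnj b * z)"

lemma mobius_eq_Moebius_function: "mobius b = Moebius_function 0 b"
  by (auto simp: mobius_def Moebius_function_def)

text \<open>Arc length on the unit circle, of total mass \<^term>\<open>2 * pi\<close>. The space of this measure is
  the circle itself, so the values of a function off the circle never matter. Rescaling the
  measure does not affect the operator norms below.\<close>

definition circle :: "complex measure" where
  "circle = distr (restrict_space lborel {-pi..pi}) (restrict_space borel (sphere 0 1)) cis"

lemma measurable_cis_circle:
  "cis \<in> restrict_space lborel {-pi..pi} \<rightarrow>\<^sub>M restrict_space borel (sphere 0 1)"
proof (rule measurable_restrict_space2)
  have "cis \<in> borel_measurable borel"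
    by (intro borel_measurable_continuous_onI continuous_intros)
  then show "cis \<in> borel_measurable (restrict_space lborel {-pi..pi})"
    by (auto intro: measurable_restrict_space1)
qed auto

lemma nn_integral_circle:
  assumes "g \<in> borel_measurable (restrict_space borel (sphere 0 1))"
  shows "(\<integral>\<^sup>+z. g z \<partial>circle) = (\<integral>\<^sup>+y\<in>{-pi..pi}. g (cis y) \<partial>lborel)"
  unfolding circle_def
  by (subst nn_integral_distr[OF measurable_cis_circle])
     (use assms in \<open>auto simp: nn_integral_restrict_space\<close>)

text \<open>Used for exponents \<^term>\<open>r > 0\<close> only.\<close>

definition ennpowr :: "ennreal \<Rightarrow> real \<Rightarrow> ennreal" where
  "ennpowr u r = (if u = \<infinity> then \<infinity> else ennreal (enn2real u powr r))"

definition Lp_norm :: "real \<Rightarrow> (complex \<Rightarrow> ennreal) \<Rightarrow> ennreal" where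
  "Lp_norm p g = ennpowr (\<integral>\<^sup>+z. ennpowr (g z) p \<partial>circle) (1 / p)"

definition Lp_space :: "real \<Rightarrow> (complex \<Rightarrow> complex) set" where
  "Lp_space p = {f \<in> borel_measurable circle. Lp_norm p (\<lambda>z. ennreal (norm (f z))) < \<infinity>}"

definition op_norm :: "real \<Rightarrow> ((complex \<Rightarrow> complex) \<Rightarrow> complex \<Rightarrow> ennreal) \<Rightarrow> ennreal" where
  "op_norm p T = Inf {A. \<forall>f\<in>Lp_space p. Lp_norm p (T f) \<le> A * Lp_norm p (\<lambda>z. ennreal (norm (f z)))}"

text \<open>The infimum is itself an admissible constant. The hypothesis is needed only because
  \<open>\<infinity> * 0 = 0\<close>; it holds for the maximal operators below.\<close>

lemma Lp_norm_le_op_norm: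
  assumes "f \<in> Lp_space p"
    and "Lp_norm p (\<lambda>z. ennreal (norm (f z))) = 0 \<Longrightarrow> Lp_norm p (T f) = 0"
  shows "Lp_norm p (T f) \<le> op_norm p T * Lp_norm p (\<lambda>z. ennreal (norm (f z)))"
proof (cases "Lp_norm p (\<lambda>z. ennreal (norm (f z))) = 0")
  case False
  define n where "n = Lp_norm p (\<lambda>z. ennreal (norm (f z)))"
  have n: "n \<noteq> 0" "n \<noteq> \<infinity>"
    using False assms(1) by (auto simp: n_def Lp_space_def)
  have "Lp_norm p (T f) / n \<le> op_norm p T"
    unfolding op_norm_def
  proof (rule Inf_greatest)
    fix A
    assume "A \<in> {A. \<forall>f\<in>Lp_space p. Lp_norm p (T f) \<le> A * Lp_norm p (\<lambda>z. ennreal (norm (f z)))}"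
    then have "Lp_norm p (T f) \<le> n * A"
      using assms(1) by (auto simp: n_def mult.commute)
    then show "Lp_norm p (T f) / n \<le> A"
      using n by (intro divide_le_posI_ennreal) (auto simp: zero_less_iff_neq_zero)
  qed
  then have "Lp_norm p (T f) / n * n \<le> op_norm p T * n"
    by (rule mult_right_mono) simp
  moreover have "Lp_norm p (T f) / n * n = Lp_norm p (T f)"
    using n by (simp add: ennreal_divide_times less_top)
  ultimately show ?thesis
    by (simp add: n_def)
qed (use assms(2) in simp)

text \<open>The principal value at \<open>z = e\<^sup>i\<^sup>x\<close> of the integral of \<open>h (e\<^sup>i\<^sup>y)\<close> over \<open>-\<pi> \<le> y \<le> \<pi>\<close>. The excluded
  neighbourhoods of the singularity are arcs symmetric about \<open>z\<close>; measuring them by chord or by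
  arc length gives the same limit. The value where the limit does not exist is a convention: for
  the singular integrals below, with \<open>f\<close> integrable, the limit exists for almost every \<open>z\<close>.\<close>

definition pv_integral :: "(complex \<Rightarrow> complex) \<Rightarrow> complex \<Rightarrow> complex" where
  "pv_integral h z =
     (let I = (\<lambda>\<epsilon>::real. LBINT y:{y\<in>{-pi..pi}. dist (cis y) z > \<epsilon>}. h (cis y))
      in if \<exists>l. (I \<longlongrightarrow> l) (at_right 0) then Lim (at_right 0) I else 0)"

text \<open>With \<open>z = e\<^sup>i\<^sup>x\<close> and \<open>w = e\<^sup>i\<^sup>y\<close>, the kernel \<open>1 / (e\<^sup>i\<^sup>(\<^sup>x\<^sup>-\<^sup>y\<^sup>) - 1)\<close> is \<^term>\<open>1 / (z / w - 1)\<close>.\<close>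

definition MT_partial :: "(nat \<Rightarrow> complex) \<Rightarrow> nat \<Rightarrow> (complex \<Rightarrow> complex) \<Rightarrow> complex \<Rightarrow> complex" where
  "MT_partial a N f z =
     pv_integral (\<lambda>w. f w * (\<Prod>j=1..N. inverse (mobius (a j) w)) * (1 / (z / w - 1))) z"

definition MT_max :: "(nat \<Rightarrow> complex) \<Rightarrow> (complex \<Rightarrow> complex) \<Rightarrow> complex \<Rightarrow> ennreal" where
  "MT_max a f z = (SUP N\<in>{1..}. ennreal (norm (MT_partial a N f z)))"

end

theory Submission
  imports Defs
begin

text \<open>Let \<open>\<psi>\<close> be the Moebius transformation taking \<open>0\<close> to \<open>b\<close>. It carries the kernel \<open>dw / (z - w)\<close> to itself
  up to the factor \<open>\<psi>'(u)\<^sup>1\<^sup>/\<^sup>2 \<psi>'(z)\<^sup>-\<^sup>1\<^sup>/\<^sup>2\<close>, and the Blaschke products with zeros \<open>\<psi>(a\<^sub>n)\<close> to those with zeros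
  \<open>a\<^sub>n\<close> up to unimodular constants. Hence \<open>f \<mapsto> (f \<circ> \<psi>) \<psi>'\<^sup>1\<^sup>/\<^sup>2\<close> intertwines the two maximal operators. It is an
  isometry of \<open>L\<^sup>2\<close>, which gives the equality of norms. Arcs about \<open>z\<close> are distorted only by annuli of
  width \<open>O(\<epsilon>\<^sup>2)\<close>, so that the principal values correspond to each other at almost every point, whether
  or not they exist.

  In \<open>L\<^sup>p\<close> the same substitution turns the claim into a bound for the operator of \<open>(a\<^sub>n)\<close> with weight
  \<open>\<bar>\<psi>'\<bar>\<^sup>1\<^sup>-\<^sup>p\<^sup>/\<^sup>2\<close>, essentially a power \<open>p - 2\<close> of the distance to a point. This weight is nearly constant on
  dyadic shells about that point, and distant shells interact only through a kernel without
  singularity, which Schur's test controls. So the unweighted \<open>L\<^sup>p\<close> bound suffices. It follows from the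
  \<open>L\<^sup>q\<close> bound by a good-\<open>\<lambda>\<close> inequality between a truncated maximal operator and the
  Hardy--Littlewood maximal function of \<open>\<bar>f\<bar>\<^sup>q\<close>; the constant blows up as \<open>q\<close> and \<open>p\<close> get closer because
  that function is bounded in \<open>L\<^sup>p\<^sup>/\<^sup>q\<close> only for \<open>q < p\<close>.\<close>

section \<open>Powers of extended nonnegative reals\<close>

text \<open>The principal value is 0 by convention where the limit fails, so for general f the
  operator \<open>TM\<close> is not known to be sublinear or measurable. In the L^p part the L^q
  hypothesis is therefore used only for functions that are locally constant almost everywhere
  (\<open>nice\<close>), and the rest is done with \<open>tsharp\<close>, built from absolutely
  convergent integrals. Three facts link the two: a pointwise bound of \<open>TM\<close> by
  \<open>tsharp\<close> and the maximal function; a Cotlar-type inequality bounding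
  \<open>tsharp\<close> by averages of \<open>TM\<close> over a cell; and lower semicontinuity of
  \<open>tsharp\<close>, which carries the weak type bound from cell averages to all of L^q.

  Several estimates produce terms free of the norm, namely those from the maximal function and from
  Schur's test. They are absorbed because the norm is at least 1, which a test function shows. The
  constants must not depend on b: the weight is only compared with its dyadic values, and the number
  of shells, which grows as the modulus of b tends to 1, never enters.\<close>

lemma ennpowr_ennreal: "0 \<le> x \<Longrightarrow> ennpowr (ennreal x) r = ennreal (x powr r)"
  by (simp add: ennpowr_def)

lemma ennpowr_0 [simp]: "ennpowr 0 r = 0"
  by (simp add: ennpowr_def)

lemma ennpowr_top [simp]: "ennpowr top r = top"
  by (simp add: ennpowr_def)

lemma ennpowr_eq_top_iff [simp]: "ennpowr u r = top \<longleftrightarrow> u = top"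
  by (simp add: ennpowr_def)

lemma ennpowr_less_top_iff [simp]: "ennpowr u r < top \<longleftrightarrow> u < top"
  using ennpowr_eq_top_iff[of u r] by (metis top.not_eq_extremum)

lemma ennpowr_eq_0_iff [simp]: "ennpowr u r = 0 \<longleftrightarrow> u = 0"
  by (cases u) (auto simp: ennpowr_ennreal)

lemma ennpowr_one [simp]: "ennpowr u 1 = u"
  by (cases u) (auto simp: ennpowr_ennreal)

lemma ennpowr_mono: "0 \<le> r \<Longrightarrow> u \<le> v \<Longrightarrow> ennpowr u r \<le> ennpowr v r"
  by (cases u; cases v) (auto simp: ennpowr_ennreal top_unique intro!: ennreal_leI powr_mono2)

lemma ennpowr_ennpowr: "ennpowr (ennpowr u r) t = ennpowr u (r * t)"
  by (cases u) (auto simp: ennpowr_ennreal powr_powr)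

lemma ennpowr_mult: "ennpowr (u * v) r = ennpowr u r * ennpowr v r"
proof (cases u)
  case (real x)
  show ?thesis
  proof (cases v)
    case (real y)
    with \<open>u = ennreal x\<close> \<open>0 \<le> x\<close> show ?thesis
      by (auto simp: ennpowr_ennreal powr_mult simp flip: ennreal_mult)
  next
    case top
    with \<open>u = ennreal x\<close> \<open>0 \<le> x\<close> show ?thesis
      by (cases "x = 0") (auto simp: ennpowr_ennreal ennreal_mult_top)
  qed
next
  case top
  then show ?thesis
    by (cases "v = 0") (auto simp: ennreal_top_mult)
qed

lemma ennpowr_le_iff: "0 < r \<Longrightarrow> ennpowr u r \<le> ennpowr v r \<longleftrightarrow> u \<le> v"
  using ennpowr_mono[of r u v] ennpowr_mono[of "1 / r" "ennpowr u r" "ennpowr v r"]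
  by (auto simp: ennpowr_ennpowr)

lemma ennpowr_add_le:
  assumes "0 \<le> r"
  shows "ennpowr (u + v) r \<le> ennreal (2 powr r) * (ennpowr u r + ennpowr v r)"
proof -
  have "ennpowr (u + v) r \<le> ennpowr (2 * max u v) r"
    using assms by (intro ennpowr_mono) (auto simp: mult_2 intro!: add_mono)
  also have "\<dots> = ennreal (2 powr r) * ennpowr (max u v) r"
    using ennpowr_ennreal[of 2 r] by (simp add: ennpowr_mult)
  also have "ennpowr (max u v) r \<le> ennpowr u r + ennpowr v r"
    by (cases "u \<le> v") (auto simp: max_def)
  finally show ?thesis
    by (simp add: mult_left_mono)
qed

lemma borel_measurable_ennpowr [measurable]:
  assumes [measurable]: "f \<in> borel_measurable M"
  shows "(\<lambda>x. ennpowr (f x) r) \<in> borel_measurable M"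
  unfolding ennpowr_def by measurable

text \<open>Where \<open>u > t\<close>, the second summand alone dominates; this replaces Hoelder's inequality at the cost
  of a factor 2.\<close>

lemma le_add_ennpowr:
  assumes "1 \<le> p" "0 < t"
  shows "u \<le> ennreal t + ennreal (t powr (1 - p)) * ennpowr u p"
proof (cases u)
  case (real x)
  have "x \<le> t + t powr (1 - p) * x powr p"
  proof (cases "x \<le> t")
    case False
    then have "x = x powr (1 - p) * x powr p"
      using assms by (simp flip: powr_add)
    also have "\<dots> \<le> t powr (1 - p) * x powr p"
      using False assms by (intro mult_right_mono powr_mono2') auto
    finally show ?thesis
      using assms by simp
  qed (use assms in \<open>auto intro: add_increasing2\<close>)
  then show ?thesis
    using real assms by (simp add: ennpowr_ennreal flip: ennreal_mult ennreal_plus)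
qed (use assms in \<open>auto simp: ennreal_mult_top\<close>)

text \<open>Hoelder's inequality for the measure with density \<open>k\<close>, up to the factor
  \<open>2 powr p\<close>: the bound \<open>le_add_ennpowr\<close> is integrated against
  \<open>k\<close>, and the level \<open>t\<close> is then optimised.\<close>

lemma nn_integral_ennpowr_le:
  assumes [measurable]: "h \<in> borel_measurable M" "k \<in> borel_measurable M" and p: "1 \<le> p"
    and m: "(\<integral>\<^sup>+x. k x \<partial>M) \<le> ennreal m" "0 \<le> m"
  shows "ennpowr (\<integral>\<^sup>+x. h x * k x \<partial>M) p
    \<le> ennreal (2 powr p * m powr (p - 1)) * (\<integral>\<^sup>+x. ennpowr (h x) p * k x \<partial>M)"
proof -
  define I where "I = (\<integral>\<^sup>+x. ennpowr (h x) p * k x \<partial>M)"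
  have *: "(\<integral>\<^sup>+x. h x * k x \<partial>M) \<le> ennreal (t * m) + ennreal (t powr (1 - p)) * I" if t: "0 < t" for t
  proof -
    have "(\<integral>\<^sup>+x. h x * k x \<partial>M) \<le> (\<integral>\<^sup>+x. ennreal t * k x + ennreal (t powr (1 - p)) * (ennpowr (h x) p * k x) \<partial>M)"
      using le_add_ennpowr[OF p t] by (intro nn_integral_mono) (metis distrib_right mult.assoc mult_right_mono zero_le)
    also have "\<dots> = ennreal t * (\<integral>\<^sup>+x. k x \<partial>M) + ennreal (t powr (1 - p)) * I"
      by (simp add: nn_integral_add nn_integral_cmult I_def)
    also have "\<dots> \<le> ennreal t * ennreal m + ennreal (t powr (1 - p)) * I"
      using m by (intro add_right_mono mult_left_mono) auto
    finally show ?thesis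
      using t m by (simp add: ennreal_mult)
  qed
  have null: "(\<integral>\<^sup>+x. h x * k x \<partial>M) = 0" if "I = 0"
  proof -
    have "AE x in M. ennpowr (h x) p * k x = 0"
      using that by (subst nn_integral_0_iff_AE[symmetric]) (auto simp: I_def)
    then have "AE x in M. h x * k x = 0" by eventually_elim auto
    then show ?thesis by (subst nn_integral_0_iff_AE) auto
  qed
  have null2: "(\<integral>\<^sup>+x. h x * k x \<partial>M) = 0" if "m = 0"
  proof -
    have "(\<integral>\<^sup>+x. k x \<partial>M) = 0" using m that by simp
    then have "AE x in M. k x = 0" by (subst (asm) nn_integral_0_iff_AE) auto
    then have "AE x in M. h x * k x = 0" by eventually_elim auto
    then show ?thesis by (subst nn_integral_0_iff_AE) auto
  qed
  \<comment> \<open>The case \<open>m = 0\<close> is separate because the right-hand side is then 0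
    even if \<open>I\<close> is infinite.\<close>
  consider "I = 0 \<or> m = 0" | "I = \<infinity>" "m > 0" | i where "I = ennreal i" "i > 0" "m > 0"
    using m by (cases I) (auto simp: less_eq_real_def)
  then show ?thesis
  proof cases
    case 1
    then show ?thesis using null null2 by auto
  next
    case 2
    then show ?thesis by (simp add: I_def[symmetric] ennreal_mult_top)
  next
    case (3 i)
    \<comment> \<open>This level balances the two terms: both become \<open>t * m\<close>.\<close>
    define t where "t = (i / m) powr (1 / p)"
    have t: "t > 0" using 3 by (simp add: t_def)
    have tp: "t powr p = i / m" using 3 p by (simp add: t_def powr_powr)
    have "t powr (1 - p) * i = t * m"
      using t tp 3 by (simp add: powr_diff field_simps)
    with *[OF t] t 3 have "(\<integral>\<^sup>+x. h x * k x \<partial>M) \<le> ennreal (2 * t * m)"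
      by (simp flip: ennreal_mult ennreal_plus add: mult_ac)
    then have "ennpowr (\<integral>\<^sup>+x. h x * k x \<partial>M) p \<le> ennpowr (ennreal (2 * t * m)) p"
      using p by (intro ennpowr_mono) auto
    also have "\<dots> = ennreal ((2 * t * m) powr p)"
      using t 3 by (simp add: ennpowr_ennreal)
    also have "(2 * t * m) powr p = 2 powr p * m powr (p - 1) * i"
      using t 3 tp by (simp add: powr_mult powr_diff)
    finally show ?thesis
      using 3 by (simp add: I_def[symmetric] ennreal_mult)
  qed
qed

lemma ennreal_mult3:
  "0 \<le> x \<Longrightarrow> 0 \<le> y \<Longrightarrow> 0 \<le> z \<Longrightarrow> ennreal (x * (y * z)) = ennreal x * (ennreal y * ennreal z)"
  by (simp add: ennreal_mult)

section \<open>The circle\<close>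

lemma space_circle: "space circle = sphere 0 1"
  by (simp add: circle_def space_restrict_space)

lemma sets_circle [measurable_cong]: "sets circle = sets (restrict_space borel (sphere 0 1))"
  by (simp add: circle_def)

lemma ident_measurable_circle [measurable]: "(\<lambda>z. z) \<in> borel_measurable circle"
  by (subst measurable_cong_sets[OF sets_circle refl]) (auto intro: measurable_restrict_space1)

lemma borel_measurable_circleI: "f \<in> borel \<rightarrow>\<^sub>M N \<Longrightarrow> f \<in> circle \<rightarrow>\<^sub>M N"
  by (subst measurable_cong_sets[OF sets_circle refl]) (auto intro: measurable_restrict_space1)

lemma measurable_cis [measurable]: "cis \<in> borel_measurable borel"
  by (intro borel_measurable_continuous_onI continuous_intros)

lemma measurable_to_circle:
  assumes "f \<in> borel_measurable M" "\<And>x. x \<in> space M \<Longrightarrow> norm (f x) = 1"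
  shows "f \<in> M \<rightarrow>\<^sub>M circle"
  by (subst measurable_cong_sets[OF refl sets_circle], rule measurable_restrict_space2) (use assms in auto)

lemma cis_measurable_circle [measurable]: "cis \<in> borel \<rightarrow>\<^sub>M circle"
  by (rule measurable_to_circle) auto

lemma nn_integral_circle':
  "g \<in> borel_measurable circle \<Longrightarrow> (\<integral>\<^sup>+z. g z \<partial>circle) = (\<integral>\<^sup>+y\<in>{-pi..pi}. g (cis y) \<partial>lborel)"
  by (rule nn_integral_circle) (simp add: measurable_cong_sets[OF sets_circle refl])

lemma emeasure_space_circle: "emeasure circle (space circle) = ennreal (2 * pi)"
proof -
  have "emeasure circle (space circle) = (\<integral>\<^sup>+z. 1 \<partial>circle)" by simp
  also have "\<dots> = ennreal (2 * pi)"
    by (subst nn_integral_circle') (auto)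
  finally show ?thesis .
qed

interpretation circle: finite_measure circle
  by standard (simp add: emeasure_space_circle)

lemma emeasure_circle_le: "emeasure circle A \<le> ennreal (2 * pi)"
  using emeasure_space[of circle A] by (simp add: emeasure_space_circle)

lemma nn_integral_periodic:
  fixes f :: "real \<Rightarrow> ennreal"
  assumes [measurable]: "f \<in> borel_measurable borel" and per: "\<And>x. f (x + 2 * pi) = f x"
    and d: "\<bar>d\<bar> \<le> 2 * pi"
  shows "(\<integral>\<^sup>+x\<in>{-pi + d..pi + d}. f x \<partial>lborel) = (\<integral>\<^sup>+x\<in>{-pi..pi}. f x \<partial>lborel)"
proof -
  have split: "(\<integral>\<^sup>+x\<in>{a..c}. f x \<partial>lborel) = (\<integral>\<^sup>+x\<in>{a..b}. f x \<partial>lborel) + (\<integral>\<^sup>+x\<in>{b..c}. f x \<partial>lborel)"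
    if "a \<le> b" "b \<le> c" for a b c
  proof -
    have "(\<integral>\<^sup>+x\<in>{a..c}. f x \<partial>lborel) = (\<integral>\<^sup>+x. f x * indicator {a..b} x + f x * indicator {b..c} x \<partial>lborel)"
    proof (rule nn_integral_cong_AE)
      have "AE x in lborel. x \<noteq> b" by (rule AE_lborel_singleton)
      then show "AE x in lborel. f x * indicator {a..c} x = f x * indicator {a..b} x + f x * indicator {b..c} x"
        by eventually_elim (use that in \<open>auto simp: indicator_def\<close>)
    qed
    then show ?thesis by (simp add: nn_integral_add)
  qed
  have shift: "(\<integral>\<^sup>+x\<in>{a + 2 * pi..c + 2 * pi}. f x \<partial>lborel) = (\<integral>\<^sup>+x\<in>{a..c}. f x \<partial>lborel)" for a c
    by (subst nn_integral_real_affine[where c = 1 and t = "2 * pi"])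
       (auto simp: per[of "_", simplified add.commute] indicator_def add.commute intro!: nn_integral_cong)
  show ?thesis
  proof (cases "d \<ge> 0")
    case True
    have "(\<integral>\<^sup>+x\<in>{-pi..pi}. f x \<partial>lborel) = (\<integral>\<^sup>+x\<in>{-pi..-pi + d}. f x \<partial>lborel) + (\<integral>\<^sup>+x\<in>{-pi + d..pi}. f x \<partial>lborel)"
      using d True by (intro split) auto
    moreover have "(\<integral>\<^sup>+x\<in>{-pi + d..pi + d}. f x \<partial>lborel) = (\<integral>\<^sup>+x\<in>{-pi + d..pi}. f x \<partial>lborel) + (\<integral>\<^sup>+x\<in>{pi..pi + d}. f x \<partial>lborel)"
      using d True by (intro split) auto
    ultimately show ?thesis
      using shift[of "-pi" "-pi + d"] by (simp add: add.commute algebra_simps)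
  next
    case False
    have "(\<integral>\<^sup>+x\<in>{-pi..pi}. f x \<partial>lborel) = (\<integral>\<^sup>+x\<in>{-pi..pi + d}. f x \<partial>lborel) + (\<integral>\<^sup>+x\<in>{pi + d..pi}. f x \<partial>lborel)"
      using d False by (intro split) auto
    moreover have "(\<integral>\<^sup>+x\<in>{-pi + d..pi + d}. f x \<partial>lborel) = (\<integral>\<^sup>+x\<in>{-pi + d..-pi}. f x \<partial>lborel) + (\<integral>\<^sup>+x\<in>{-pi..pi + d}. f x \<partial>lborel)"
      using d False by (intro split) auto
    ultimately show ?thesis
      using shift[of "-pi + d" "-pi"] by (simp add: add.commute algebra_simps)
  qed
qed

text \<open>Here \<open>\<theta>\<close> lifts the circle map \<open>\<phi>\<close> to angles with
  winding number one. Substitution on the line turns an integral over a full period of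
  \<open>\<theta>\<close> into the right-hand side, and periodicity moves that period back to
  \<open>{-pi..pi}\<close>; \<open>wind\<close> keeps the shift within the range of
  \<open>nn_integral_periodic\<close>.\<close>

lemma nn_integral_circle_lift:
  assumes [measurable]: "h \<in> borel_measurable circle"
    and deriv: "\<And>y. (\<theta> has_real_derivative \<theta>' y) (at y)"
    and cont: "continuous_on UNIV \<theta>'" and nonneg: "\<And>y. 0 \<le> \<theta>' y"
    and period: "\<theta> pi = \<theta> (-pi) + 2 * pi" and wind: "\<bar>\<theta> pi - pi\<bar> \<le> 2 * pi"
    and lift: "\<And>y. \<phi> (cis y) = cis (\<theta> y)" and jac: "\<And>y. J (cis y) = \<theta>' y"
    and [measurable]: "\<phi> \<in> circle \<rightarrow>\<^sub>M circle" "J \<in> borel_measurable circle"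
  shows "(\<integral>\<^sup>+z. h z \<partial>circle) = (\<integral>\<^sup>+z. h (\<phi> z) * ennreal (J z) \<partial>circle)"
proof -
  define d where "d = \<theta> pi - pi"
  have d: "\<theta> pi = pi + d" "\<theta> (-pi) = -pi + d" "\<bar>d\<bar> \<le> 2 * pi"
    using period wind by (auto simp: d_def)
  have per: "cis (x + 2 * pi) = cis x" for x
    by (metis cis_2pi cis_mult mult_1_right)
  have "(\<integral>\<^sup>+z. h z \<partial>circle) = (\<integral>\<^sup>+y\<in>{-pi..pi}. h (cis y) \<partial>lborel)"
    by (rule nn_integral_circle') simp
  also have "\<dots> = (\<integral>\<^sup>+y\<in>{-pi + d..pi + d}. h (cis y) \<partial>lborel)"
    by (rule nn_integral_periodic[symmetric]) (use per d in auto)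
  also have "\<dots> = (\<integral>\<^sup>+y\<in>{\<theta> (-pi)..\<theta> pi}. h (cis y) \<partial>lborel)"
    by (simp only: d)
  also have "\<dots> = (\<integral>\<^sup>+y\<in>{-pi..pi}. h (cis (\<theta> y)) * ennreal (\<theta>' y) \<partial>lborel)"
    using deriv nonneg continuous_on_subset[OF cont subset_UNIV]
    by (intro nn_integral_substitution_aux) auto
  also have "\<dots> = (\<integral>\<^sup>+y\<in>{-pi..pi}. h (\<phi> (cis y)) * ennreal (J (cis y)) \<partial>lborel)"
    by (simp add: lift jac)
  also have "\<dots> = (\<integral>\<^sup>+z. h (\<phi> z) * ennreal (J z) \<partial>circle)"
    by (rule nn_integral_circle'[symmetric]) measurable
  finally show ?thesis .
qed

lemma nn_integral_circle_rotate:
  assumes [measurable]: "h \<in> borel_measurable circle" and "norm c = 1"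
  shows "(\<integral>\<^sup>+z. h z \<partial>circle) = (\<integral>\<^sup>+z. h (c * z) \<partial>circle)"
proof -
  have c: "c = cis (Arg c)" using assms(2) 
    by (subst cis_Arg) (auto simp: sgn_eq)
  have [measurable]: "(\<lambda>z. c * z) \<in> circle \<rightarrow>\<^sub>M circle"
    using assms(2) by (intro measurable_to_circle) (auto simp: norm_mult space_circle)
  have "(\<integral>\<^sup>+z. h z \<partial>circle) = (\<integral>\<^sup>+z. h (c * z) * ennreal 1 \<partial>circle)"
    by (rule nn_integral_circle_lift[where \<theta> = "\<lambda>y. Arg c + y" and \<theta>' = "\<lambda>_. 1"])
       (use Arg_bounded[of c] in \<open>auto intro!: derivative_eq_intros simp: abs_le_iff cis_mult[symmetric] c[symmetric]\<close>)
  then show ?thesis by simp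
qed

lemma nn_integral_circle_cnj:
  assumes [measurable]: "h \<in> borel_measurable circle"
  shows "(\<integral>\<^sup>+z. h z \<partial>circle) = (\<integral>\<^sup>+z. h (cnj z) \<partial>circle)"
proof -
  have [measurable]: "cnj \<in> circle \<rightarrow>\<^sub>M circle"
    by (intro measurable_to_circle borel_measurable_circleI borel_measurable_continuous_onI continuous_intros)
       (auto simp: space_circle)
  have "(\<integral>\<^sup>+z. h z \<partial>circle) = (\<integral>\<^sup>+y\<in>{-pi..pi}. h (cis y) \<partial>lborel)"
    by (rule nn_integral_circle') simp
  also have "\<dots> = (\<integral>\<^sup>+y. h (cis (-y)) * indicator {-pi..pi} (-y) \<partial>lborel)"
    by (subst nn_integral_real_affine[where c = "-1" and t = 0]) auto
  also have "\<dots> = (\<integral>\<^sup>+y\<in>{-pi..pi}. h (cnj (cis y)) \<partial>lborel)"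
    by (auto intro!: nn_integral_cong simp: cis_cnj indicator_def)
  also have "\<dots> = (\<integral>\<^sup>+z. h (cnj z) \<partial>circle)"
    by (rule nn_integral_circle'[symmetric]) measurable
  finally show ?thesis .
qed

section \<open>The boundary action of a Moebius transformation\<close>

definition mscale :: "complex \<Rightarrow> complex \<Rightarrow> real" where
  "mscale b z = norm (1 + cnj b * z)"

lemma mobius_minus: "mobius (-b) z = (z + b) / (1 + cnj b * z)"
  by (simp add: mobius_def)

lemma mscale_ge: "norm z = 1 \<Longrightarrow> 1 - norm b \<le> mscale b z"
  using norm_triangle_ineq2[of 1 "- (cnj b * z)"] by (simp add: mscale_def norm_mult)

lemma mscale_pos: "norm b < 1 \<Longrightarrow> norm z = 1 \<Longrightarrow> 0 < mscale b z"
  using mscale_ge[of z b] by linarith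

lemma mscale_le: "norm b < 1 \<Longrightarrow> norm z = 1 \<Longrightarrow> mscale b z \<le> 2"
  using norm_triangle_ineq[of 1 "cnj b * z"] by (simp add: mscale_def norm_mult)

text \<open>This Lipschitz bound serves twice: it limits the distortion of small arcs, and it keeps
  points of non-adjacent shells of \<open>mscale\<close> apart.\<close>

lemma mscale_diff: "\<bar>mscale b z - mscale b w\<bar> \<le> norm b * norm (z - w)"
proof -
  have "\<bar>mscale b z - mscale b w\<bar> \<le> norm (cnj b * z - cnj b * w)"
    unfolding mscale_def by (metis add_diff_cancel_left norm_triangle_ineq3)
  then show ?thesis by (simp add: norm_mult flip: right_diff_distrib)
qed

lemma mscale_measurable [measurable]: "mscale b \<in> borel_measurable borel"
  unfolding mscale_def by measurable

lemma mscale_measurable_circle [measurable]: "mscale b \<in> borel_measurable circle"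
  by (rule borel_measurable_circleI) measurable

lemma cnj_eq_inverse_circle: "norm z = 1 \<Longrightarrow> cnj z = 1 / z"
  by (metis complex_norm_square divide_eq_eq mult.commute norm_eq_zero of_real_1 one_power2 zero_neq_one)

text \<open>Since \<open>cnj z = 1 / z\<close>, the numerator \<open>z + b\<close> is
  \<open>z\<close> times the conjugate of the denominator. So the quotient has modulus 1 and an
  explicit argument.\<close>

lemma mobius_minus_circle:
  assumes "norm z = 1"
  shows "mobius (-b) z = z * cnj (1 + cnj b * z) / (1 + cnj b * z)"
proof -
  have "z * cnj (1 + cnj b * z) = z + b"
    using assms cnj_eq_inverse_circle[OF assms] by (auto simp: algebra_simps)
  then show ?thesis by (simp add: mobius_minus)
qed

lemma norm_mobius_minus:
  assumes "norm b < 1" "norm z = 1"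
  shows "norm (mobius (-b) z) = 1"
  using mscale_pos[OF assms] assms by (auto simp: mobius_minus_circle norm_mult norm_divide mscale_def simp del: complex_cnj_add)

lemma mobius_borel_measurable: "mobius b \<in> borel_measurable borel"
  unfolding mobius_def by measurable

lemma mobius_measurable_circle [measurable]: "mobius b \<in> borel_measurable circle"
  by (rule borel_measurable_circleI[OF mobius_borel_measurable])

lemma mobius_minus_measurable: "norm b < 1 \<Longrightarrow> mobius (-b) \<in> circle \<rightarrow>\<^sub>M circle"
  by (rule measurable_to_circle) (auto simp: space_circle norm_mobius_minus)

text \<open>A two-point form of the derivative: the factor of \<open>u - z\<close> is the product of
  the holomorphic square roots of the derivative at \<open>u\<close> and at \<open>z\<close>. Both
  the covariance of the kernel and the comparison of arcs come from this identity.\<close>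

lemma mobius_circle_diff:
  assumes "norm b < 1" "norm u = 1" "norm z = 1"
  shows "mobius (-b) u - mobius (-b) z
    = (u - z) * (1 - (norm b)\<^sup>2) / ((1 + cnj b * u) * (1 + cnj b * z))"
proof -
  have "1 + cnj b * u \<noteq> 0" "1 + cnj b * z \<noteq> 0"
    using mscale_pos[OF assms(1)] assms by (force simp: mscale_def)+
  moreover have "complex_of_real ((norm b)\<^sup>2) = b * cnj b"
    by (metis complex_norm_square of_real_power)
  moreover have "(u + b) * (1 + cnj b * z) - (z + b) * (1 + cnj b * u) = (u - z) * (1 - b * cnj b)"
    by (simp add: algebra_simps)
  ultimately show ?thesis
    by (simp add: mobius_minus diff_frac_eq)
qed

text \<open>By \<open>mobius_minus_circle\<close> the image of \<open>cis y\<close> has argument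
  \<open>y\<close> plus twice the argument of \<open>cnj v\<close>, where
  \<open>v = 1 + cnj b * cis y\<close>. As \<open>v\<close> lies in the right half-plane, that
  argument is an arctangent, which gives a smooth lift.\<close>

lemma nn_integral_circle_mobius:
  assumes b: "norm b < 1" and h [measurable]: "h \<in> borel_measurable circle"
  shows "(\<integral>\<^sup>+z. h z \<partial>circle)
    = (\<integral>\<^sup>+z. h (mobius (-b) z) * ennreal ((1 - (norm b)\<^sup>2) / (mscale b z)\<^sup>2) \<partial>circle)"
proof (rule nn_integral_circle_lift)
  note mobius_minus_measurable[OF b, measurable]
  define R where "R y = 1 + Re b * cos y + Im b * sin y" for y
  define I where "I y = Im b * cos y - Re b * sin y" for y
  define \<theta> where "\<theta> y = y + 2 * arctan (I y / R y)" for y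
  have v: "cnj (1 + cnj b * cis y) = Complex (R y) (I y)" for y
    by (auto simp: complex_eq_iff R_def I_def)
  have ms: "(mscale b (cis y))\<^sup>2 = (R y)\<^sup>2 + (I y)\<^sup>2" for y
    using arg_cong[OF v[of y], of norm] unfolding complex_mod_cnj
    by (auto simp: mscale_def cmod_def)
  have mp: "mscale b (cis y) > 0" for y
    using mscale_pos[OF b] by simp
  \<comment> \<open>The left side is 1 minus the squared distance of the point
    \<open>Complex (R y) (I y)\<close> from 1, and that distance is \<open>norm b\<close>. The
    identity yields both the positivity of \<open>R\<close> and the numerator of the derivative of
    \<open>\<theta>\<close>.\<close>
  have bb: "2 * R y - ((R y)\<^sup>2 + (I y)\<^sup>2) = 1 - (norm b)\<^sup>2" for y
  proof -
    have "(1 + p * c + q * s - 1)\<^sup>2 + (q * c - p * s)\<^sup>2 = (p\<^sup>2 + q\<^sup>2) * (c\<^sup>2 + s\<^sup>2)" for p q c s :: real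
      by (simp add: power2_eq_square algebra_simps)
    then have "(R y - 1)\<^sup>2 + (I y)\<^sup>2 = ((Re b)\<^sup>2 + (Im b)\<^sup>2) * ((cos y)\<^sup>2 + (sin y)\<^sup>2)"
      unfolding R_def I_def .
    then show ?thesis
      by (simp add: cmod_power2 power2_diff)
  qed
  have b2: "(norm b)\<^sup>2 < 1"
    using b by (simp add: power_less_one_iff abs_square_less_1)
  have Rpos: "R y > 0" for y
  proof -
    have "0 \<le> (R y)\<^sup>2 + (I y)\<^sup>2" by simp
    then show ?thesis using bb[of y] b2 by linarith
  qed
  have R': "(R has_real_derivative I y) (at y)" for y
    unfolding R_def I_def by (auto intro!: derivative_eq_intros)
  have I': "(I has_real_derivative 1 - R y) (at y)" for y
    unfolding R_def I_def by (auto intro!: derivative_eq_intros)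
  show "(\<theta> has_real_derivative (1 - (norm b)\<^sup>2) / (mscale b (cis y))\<^sup>2) (at y)" for y
  proof -
    have "(\<theta> has_real_derivative
        1 + 2 * (inverse (1 + (I y / R y)\<^sup>2) * (((1 - R y) * R y - I y * I y) / (R y * R y)))) (at y)"
      unfolding \<theta>_def using Rpos[of y] by (auto intro!: derivative_eq_intros R' I')
    also have "inverse (1 + (I y / R y)\<^sup>2) = (R y * R y) / ((R y)\<^sup>2 + (I y)\<^sup>2)"
      using Rpos[of y] by (simp add: field_simps power2_eq_square)
    also have "1 + 2 * ((R y * R y) / ((R y)\<^sup>2 + (I y)\<^sup>2) * (((1 - R y) * R y - I y * I y) / (R y * R y)))
      = (2 * R y - ((R y)\<^sup>2 + (I y)\<^sup>2)) / ((R y)\<^sup>2 + (I y)\<^sup>2)"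
    proof -
      define S where "S = (R y)\<^sup>2 + (I y)\<^sup>2"
      have S: "S > 0" unfolding S_def using Rpos[of y] by (intro add_pos_nonneg) auto
      have gen: "1 + 2 * ((r * r) / s * (x / (r * r))) = (s + 2 * x) / s" if "r > 0" "s > 0" for r s x :: real
        using that by (simp add: add_divide_distrib)
      have "S + 2 * ((1 - R y) * R y - I y * I y) = 2 * R y - S"
        by (simp add: S_def power2_eq_square algebra_simps)
      then show ?thesis
        unfolding S_def[symmetric] gen[OF Rpos S] by simp
    qed
    finally show ?thesis by (simp add: bb ms)
  qed
  show "continuous_on UNIV (\<lambda>y. (1 - (norm b)\<^sup>2) / (mscale b (cis y))\<^sup>2)"
    using mp unfolding mscale_def by (intro continuous_intros) (metis less_irrefl power_eq_0_iff)
  show "0 \<le> (1 - (norm b)\<^sup>2) / (mscale b (cis y))\<^sup>2" for y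
    using b2 by simp
  show "\<theta> pi = \<theta> (-pi) + 2 * pi"
    by (simp add: \<theta>_def R_def I_def)
  show "\<bar>\<theta> pi - pi\<bar> \<le> 2 * pi"
    using arctan_bounded[of "I pi / R pi"] by (auto simp: \<theta>_def abs_le_iff)
  show "mobius (- b) (cis y) = cis (\<theta> y)" for y
  proof -
    define x where "x = I y / R y"
    have "cis (arctan x) = (1 + \<i> * x) / sqrt (1 + x\<^sup>2)"
      by (auto simp: complex_eq_iff cos_arctan sin_arctan)
    then have "cis (2 * arctan x) = ((1 + \<i> * x) / sqrt (1 + x\<^sup>2))\<^sup>2"
      by (metis cis_mult mult_2 power2_eq_square)
    also have "\<dots> = (1 + \<i> * x)\<^sup>2 / (1 + x\<^sup>2)"
      by (simp add: power_divide flip: of_real_power)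
    also have "complex_of_real (1 + x\<^sup>2) = (1 + \<i> * x) * (1 - \<i> * x)"
      by (simp add: algebra_simps power2_eq_square)
    also have "(1 + \<i> * x)\<^sup>2 / \<dots> = (1 + \<i> * x) / (1 - \<i> * x)"
      by (simp add: power2_eq_square complex_eq_iff)
    also have "\<dots> = Complex (R y) (I y) / Complex (R y) (- I y)"
    proof -
      have "Complex (R y) (I y) = R y * (1 + \<i> * x)" "Complex (R y) (- I y) = R y * (1 - \<i> * x)"
        using Rpos[of y] by (auto simp: x_def complex_eq_iff)
      then show ?thesis using Rpos[of y] by simp
    qed
    also have "Complex (R y) (- I y) = 1 + cnj b * cis y"
      using arg_cong[OF v[of y], of cnj] by (simp add: complex_eq_iff)
    finally have "cis (2 * arctan x) = cnj (1 + cnj b * cis y) / (1 + cnj b * cis y)"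
      by (simp only: v)
    moreover have "cis (\<theta> y) = cis y * cis (2 * arctan x)"
      by (simp add: \<theta>_def x_def cis_mult)
    ultimately show ?thesis by (simp add: mobius_minus_circle)
  qed
  show "(1 - (norm b)\<^sup>2) / (mscale b (cis y))\<^sup>2 = (1 - (norm b)\<^sup>2) / (mscale b (cis y))\<^sup>2" for y ..
qed (use mobius_minus_measurable[OF b] in measurable)

section \<open>Lengths of arcs and annuli\<close>

definition carc :: "complex \<Rightarrow> real \<Rightarrow> complex set" where
  "carc z r = {u \<in> sphere 0 1. dist u z \<le> r}"

lemma carc_eq: "carc z r = {u \<in> space circle. dist u z \<le> r}"
  by (simp add: carc_def space_circle)

lemma carc_sets [measurable]: "carc z r \<in> sets circle"
  unfolding carc_eq by measurable

text \<open>The bound is linear in the width, not in the radius, so an annulus of width O(epsilon^2)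
  is negligible against an arc of radius epsilon. A chord \<open>r\<close> subtends the angle
  \<open>2 * arcsin (r / 2)\<close>, whose derivative is at most 3/2 for \<open>r\<close> up to 1,
  and there is one arc on each side of \<open>z\<close>.\<close>

lemma emeasure_circle_annulus:
  assumes z: "norm z = 1" and r: "0 \<le> r1" "r1 \<le> r2" "r2 \<le> 1"
  shows "emeasure circle {u \<in> sphere 0 1. r1 \<le> dist u z \<and> dist u z \<le> r2} \<le> ennreal (3 * (r2 - r1))"
proof -
  define \<alpha> where "\<alpha> r = 2 * arcsin (r / 2)" for r
  define A where "A z = {u \<in> sphere 0 1. r1 \<le> dist u z \<and> dist u z \<le> r2}" for z :: complex
  have [measurable]: "A z \<in> sets circle" for z
  proof -
    have "A z = {u \<in> space circle. r1 \<le> dist u z \<and> dist u z \<le> r2}"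
      by (simp add: A_def space_circle)
    then show ?thesis by simp
  qed
  have dist1: "\<bar>y\<bar> = \<alpha> (dist (cis y) 1)" if "y \<in> {-pi..pi}" for y
  proof -
    have "(norm (cis y - 1))\<^sup>2 = (cos y - 1)\<^sup>2 + (sin y)\<^sup>2"
      by (simp add: cmod_power2)
    also have "\<dots> = (2 * \<bar>sin (y / 2)\<bar>)\<^sup>2"
      using cos_double_sin[of "y / 2"] sin_cos_squared_add[of y]
      by (simp add: power2_eq_square algebra_simps)
    finally have "norm (cis y - 1) = 2 * \<bar>sin (y / 2)\<bar>"
      by (subst (asm) power2_eq_iff_nonneg) auto
    moreover have "\<bar>sin (y / 2)\<bar> = sin (\<bar>y\<bar> / 2)"
    proof -
      have "sin (\<bar>y\<bar> / 2) \<ge> 0" using that by (intro sin_ge_zero) auto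
      then show ?thesis by (cases "y \<ge> 0") auto
    qed
    moreover have "arcsin (sin (\<bar>y\<bar> / 2)) = \<bar>y\<bar> / 2"
      using that by (intro arcsin_sin) auto
    ultimately show ?thesis by (simp add: \<alpha>_def dist_norm)
  qed
  have \<alpha>_mono: "\<alpha> r \<le> \<alpha> s" if "0 \<le> r" "r \<le> s" "s \<le> 2" for r s
    using that by (auto simp: \<alpha>_def intro!: arcsin_le_mono[THEN iffD2])
  have \<alpha>_diff: "\<alpha> r2 - \<alpha> r1 \<le> 3 / 2 * (r2 - r1)"
  proof (cases "r1 = r2")
    case False
    have "\<exists>x. r1 < x \<and> x < r2 \<and> \<alpha> r2 - \<alpha> r1 = (r2 - r1) * inverse (sqrt (1 - (x / 2)\<^sup>2))"
      unfolding \<alpha>_def using r False by (intro MVT2) (auto intro!: derivative_eq_intros)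
    then obtain x where x: "r1 < x" "x < r2" "\<alpha> r2 - \<alpha> r1 = (r2 - r1) * inverse (sqrt (1 - (x / 2)\<^sup>2))"
      by blast
    have "x\<^sup>2 \<le> 1" using x r by (simp add: power_le_one)
    then have "(2 / 3)\<^sup>2 \<le> 1 - (x / 2)\<^sup>2" by (simp add: power_divide)
    then have "2 / 3 \<le> sqrt (1 - (x / 2)\<^sup>2)" by (rule real_le_rsqrt)
    then have "inverse (sqrt (1 - (x / 2)\<^sup>2)) \<le> inverse (2 / 3)"
      by (intro le_imp_inverse_le) auto
    then have "(r2 - r1) * inverse (sqrt (1 - (x / 2)\<^sup>2)) \<le> (r2 - r1) * (3 / 2)"
      using r by (intro mult_left_mono) auto
    then show ?thesis using x by simp
  qed simp
  have "emeasure circle (A z) = (\<integral>\<^sup>+u. indicator (A z) u \<partial>circle)"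
    by simp
  also have "\<dots> = (\<integral>\<^sup>+u. indicator (A z) (z * u) \<partial>circle)"
    using z by (intro nn_integral_circle_rotate) auto
  also have "\<dots> = (\<integral>\<^sup>+u. indicator (A 1) u \<partial>circle)"
  proof (rule nn_integral_cong)
    fix u assume "u \<in> space circle"
    have "dist (z * u) z = dist u 1"
      using z unfolding dist_norm by (metis mult.right_neutral mult_1 norm_mult right_diff_distrib)
    then show "indicator (A z) (z * u) = (indicator (A 1) u :: ennreal)"
      using z by (auto simp: indicator_def A_def norm_mult)
  qed
  also have "\<dots> = (\<integral>\<^sup>+y\<in>{-pi..pi}. indicator (A 1) (cis y) \<partial>lborel)"
    by (rule nn_integral_circle') simp
  also have "\<dots> \<le> (\<integral>\<^sup>+y. indicator {\<alpha> r1..\<alpha> r2} y + indicator {-\<alpha> r2..-\<alpha> r1} y \<partial>lborel)"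
  proof (rule nn_integral_mono)
    fix y :: real
    have "\<alpha> r1 \<le> \<bar>y\<bar> \<and> \<bar>y\<bar> \<le> \<alpha> r2" if "y \<in> {-pi..pi}" "cis y \<in> A 1"
      using that r \<alpha>_mono[of r1 "dist (cis y) 1"] \<alpha>_mono[of "dist (cis y) 1" r2]
      unfolding dist1[OF that(1)] by (auto simp: A_def)
    then show "indicator (A 1) (cis y) * indicator {-pi..pi} y
      \<le> (indicator {\<alpha> r1..\<alpha> r2} y + indicator {-\<alpha> r2..-\<alpha> r1} y :: ennreal)"
      by (cases "y \<ge> 0") (auto simp: indicator_def)
  qed
  also have "\<dots> = ennreal (\<alpha> r2 - \<alpha> r1) + ennreal (\<alpha> r2 - \<alpha> r1)"
    using \<alpha>_mono[of r1 r2] r by (subst nn_integral_add) auto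
  also have "\<dots> \<le> ennreal (3 * (r2 - r1))"
    using \<alpha>_diff \<alpha>_mono[of r1 r2] r by (auto simp flip: ennreal_plus intro!: ennreal_leI)
  finally show ?thesis by (simp add: A_def)
qed

text \<open>The constant 7 exceeds \<open>2 * pi\<close>, so the bound survives for radii above 1,
  where the total length is used.\<close>

lemma emeasure_carc_le:
  assumes z: "norm z = 1" and r: "0 \<le> r"
  shows "emeasure circle (carc z r) \<le> ennreal (7 * r)"
proof (cases "r \<le> 1")
  case True
  have "emeasure circle (carc z r) \<le> ennreal (3 * (r - 0))"
    using emeasure_circle_annulus[OF z, of 0 r] r True by (simp add: carc_def)
  also have "\<dots> \<le> ennreal (7 * r)" using r by (intro ennreal_leI) auto
  finally show ?thesis .
next
  case False
  have "emeasure circle (carc z r) \<le> ennreal (2 * pi)" by (rule emeasure_circle_le)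
  also have "\<dots> \<le> ennreal (7 * r)" using False pi_less_4 pi_approx by (intro ennreal_leI) auto
  finally show ?thesis .
qed

lemma AE_circle_neq: "AE u in circle. u \<noteq> p"
proof (cases "norm p = 1")
  case True
  have "emeasure circle (carc p 0) = 0"
    using emeasure_carc_le[OF True, of 0] by simp
  moreover have "carc p 0 = {p}"
    using True by (auto simp: carc_def)
  ultimately show ?thesis
    by (intro AE_I[where N = "{p}"]) (auto, metis carc_sets)
qed (auto intro!: AE_I2 simp: space_circle)

text \<open>At most two points of the circle have a given chord to \<open>z\<close>, since the chord
  fixes the real part of \<open>u * cnj z\<close>.\<close>

lemma AE_circle_dist_neq:
  assumes z: "norm z = 1"
  shows "AE u in circle. dist u z \<noteq> r"
proof -
  define c where "c = 1 - r\<^sup>2 / 2"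
  define s where "s = sqrt (1 - c\<^sup>2)"
  have *: "u \<in> {z * Complex c s, z * Complex c (-s)}" if u: "norm u = 1" "dist u z = r" for u
  proof -
    define v where "v = u * cnj z"
    have v: "u = z * v"
      using z by (simp add: v_def mult.left_commute flip: complex_norm_square)
    have nv: "(Re v)\<^sup>2 + (Im v)\<^sup>2 = 1"
      using u z unfolding cmod_power2[symmetric] by (simp add: v_def norm_mult)
    have "dist u z = norm (v - 1)"
      using z unfolding dist_norm v by (metis mult.right_neutral mult_1 norm_mult right_diff_distrib)
    then have "r\<^sup>2 = (Re v - 1)\<^sup>2 + (Im v)\<^sup>2"
      using u by (simp add: cmod_power2)
    with nv have "Re v = c"
      by (simp add: c_def power2_eq_square algebra_simps)
    moreover from this nv have "(Im v)\<^sup>2 = 1 - c\<^sup>2" by simp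
    then have "Im v = s \<or> Im v = - s"
      unfolding s_def by (metis abs_if minus_minus real_sqrt_abs)
    ultimately show ?thesis
      using v by (auto simp: complex_eq_iff)
  qed
  show ?thesis
    using AE_circle_neq[of "z * Complex c s"] AE_circle_neq[of "z * Complex c (-s)"] AE_space
  proof eventually_elim
    case (elim u)
    then show ?case using *[of u] by (auto simp: space_circle)
  qed
qed

lemma pv_integral_circle:
  assumes [measurable]: "h \<in> borel_measurable circle"
  defines "I \<equiv> \<lambda>z \<epsilon>. LINT u|circle. indicator {u. dist u z > \<epsilon>} u *\<^sub>R h u"
  shows "pv_integral h z = (if \<exists>l. (I z \<longlongrightarrow> l) (at_right 0) then Lim (at_right 0) (I z) else 0)"
proof -
  have "I z \<epsilon> = (LBINT y:{y\<in>{-pi..pi}. dist (cis y) z > \<epsilon>}. h (cis y))" for \<epsilon>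
  proof -
    have "I z \<epsilon> = (LINT y|restrict_space lborel {-pi..pi}. indicator {u. dist u z > \<epsilon>} (cis y) *\<^sub>R h (cis y))"
      unfolding I_def by (subst circle_def, subst integral_distr[OF measurable_cis_circle])
        (auto simp flip: measurable_cong_sets[OF sets_circle refl])
    also have "\<dots> = (LINT y:{-pi..pi}|lborel. indicator {u. dist u z > \<epsilon>} (cis y) *\<^sub>R h (cis y))"
      by (subst integral_restrict_space) (auto simp: set_lebesgue_integral_def)
    finally show ?thesis
      by (auto simp: set_lebesgue_integral_def indicator_def intro!: Bochner_Integration.integral_cong)
  qed
  then have "I z = (\<lambda>\<epsilon>. LBINT y:{y\<in>{-pi..pi}. dist (cis y) z > \<epsilon>}. h (cis y))"
    by blast
  then show ?thesis
    unfolding pv_integral_def Let_def by simp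
qed

section \<open>The maximal function\<close>

text \<open>The centred Hardy--Littlewood maximal function. Dyadic radii make it a countable
  supremum, hence measurable, and dividing by the radius instead of the length of the arc changes it
  only by a bounded factor.\<close>

definition hlmax :: "(complex \<Rightarrow> ennreal) \<Rightarrow> complex \<Rightarrow> ennreal" where
  "hlmax F z = (SUP k::int. (\<integral>\<^sup>+u\<in>carc z (2 powi k). F u \<partial>circle) / ennreal (2 powi k))"

lemma indicator_carc: "u \<in> space circle \<Longrightarrow> indicator (carc z r) u = (if dist u z \<le> r then 1 else 0)"
  by (auto simp: carc_eq indicator_def)

lemma hlmax_measurable [measurable]:
  assumes [measurable]: "F \<in> borel_measurable circle"
  shows "hlmax F \<in> borel_measurable circle"
proof -
  have "(\<lambda>z. (\<integral>\<^sup>+u\<in>carc z r. F u \<partial>circle)) \<in> borel_measurable circle" for r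
  proof -
    have "(\<lambda>z. (\<integral>\<^sup>+u. F u * (if dist u z \<le> r then 1 else 0) \<partial>circle)) \<in> borel_measurable circle"
      by measurable
    then show ?thesis
      by (rule measurable_cong[THEN iffD1, rotated]) (auto intro!: nn_integral_cong simp: indicator_carc)
  qed
  note this[measurable]
  show ?thesis unfolding hlmax_def by measurable
qed

text \<open>Rounding the radius up to a power of 2 costs the factor 2.\<close>

lemma carc_integral_le_hlmax:
  assumes R: "R > 0"
  shows "(\<integral>\<^sup>+u\<in>carc z R. F u \<partial>circle) \<le> ennreal (2 * R) * hlmax F z"
proof -
  define k where "k = \<lceil>log 2 R\<rceil>"
  have p: "2 powi k = (2::real) powr real_of_int k"
    by (simp add: powr_real_of_int')
  have k1: "R \<le> 2 powi k"
    unfolding p using R log_le_iff[of 2 R "real_of_int k"] by (simp add: k_def)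
  have "2 powr real_of_int k \<le> 2 powr (log 2 R + 1)"
    unfolding k_def by (rule powr_mono) linarith+
  then have k2: "2 powi k \<le> 2 * R"
    using R by (simp add: p powr_add)
  have pos: "(2::real) powi k > 0" by simp
  have "(\<integral>\<^sup>+u\<in>carc z R. F u \<partial>circle) \<le> (\<integral>\<^sup>+u\<in>carc z (2 powi k). F u \<partial>circle)"
    using k1 by (intro nn_integral_mono mult_left_mono) (auto simp: indicator_def carc_def)
  also have "\<dots> = ennreal (2 powi k) * ((\<integral>\<^sup>+u\<in>carc z (2 powi k). F u \<partial>circle) / ennreal (2 powi k))"
    using pos by (simp add: ennreal_times_divide mult.commute[of "ennreal _"] mult_divide_eq_ennreal)
  also have "\<dots> \<le> ennreal (2 * R) * hlmax F z"
    unfolding hlmax_def using k2 by (intro mult_mono SUP_upper ennreal_leI) auto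
  finally show ?thesis .
qed

text \<open>Vitali's covering lemma: each point of the level set has an arc whose integral exceeds
  \<open>t\<close> times its radius, and a disjoint subfamily has fivefold enlargements that cover
  the set. The constant 35 is 7 times 5, the 7 coming from \<open>emeasure_carc_le\<close>.\<close>

lemma hlmax_weak_type:
  assumes [measurable]: "F \<in> borel_measurable circle" and t: "t > 0"
  shows "emeasure circle {z \<in> space circle. hlmax F z > ennreal t} \<le> ennreal (35 / t) * (\<integral>\<^sup>+u. F u \<partial>circle)"
proof (cases "(\<integral>\<^sup>+u. F u \<partial>circle)")
  case top
  then show ?thesis using t by (simp add: ennreal_mult_top)
next
  case (real I)
  define S where "S = {z \<in> space circle. hlmax F z > ennreal t}"
  have "\<exists>k::int. ennreal (t * 2 powi k) < (\<integral>\<^sup>+u\<in>carc z (2 powi k). F u \<partial>circle)" if "z \<in> S" for z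
  proof -
    from that obtain k :: int
      where k: "ennreal t < (\<integral>\<^sup>+u\<in>carc z (2 powi k). F u \<partial>circle) / ennreal (2 powi k)"
      by (auto simp: S_def hlmax_def less_SUP_iff)
    have "\<not> (\<integral>\<^sup>+u\<in>carc z (2 powi k). F u \<partial>circle) \<le> ennreal (2 powi k) * ennreal t"
      using k divide_le_posI_ennreal[of "ennreal (2 powi k)" _ "ennreal t"] by (auto simp: not_le[symmetric])
    then show ?thesis
      using t by (auto simp: not_le mult.commute simp flip: ennreal_mult)
  qed
  then obtain k :: "complex \<Rightarrow> int"
    where k: "\<And>z. z \<in> S \<Longrightarrow> ennreal (t * 2 powi k z) < (\<integral>\<^sup>+u\<in>carc z (2 powi k z). F u \<partial>circle)"
    by metis
  define r where "r z = (2::real) powi k z" for z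
  have rpos: "r z > 0" for z by (simp add: r_def)
  have k': "ennreal (t * r z) < (\<integral>\<^sup>+u\<in>carc z (r z). F u \<partial>circle)" if "z \<in> S" for z
    using k[OF that] by (simp add: r_def)
  \<comment> \<open>The covering lemma asks for bounded radii; the finite integral \<open>I\<close>
    bounds them.\<close>
  have rle: "r z \<le> I / t" if "z \<in> S" for z
  proof -
    have "(\<integral>\<^sup>+u\<in>carc z (r z). F u \<partial>circle) \<le> (\<integral>\<^sup>+u. F u \<partial>circle)"
      by (intro nn_integral_mono) (auto simp: indicator_def)
    with k'[OF that] have "ennreal (t * r z) \<le> ennreal I" using real by (metis less_imp_le order_trans)
    then show ?thesis using real t by (simp add: field_simps)
  qed
  obtain C where C: "countable C" "C \<subseteq> S"
    and disj: "pairwise (\<lambda>i j. disjnt (cball i (r i)) (cball j (r j))) C"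
    and cov: "S \<subseteq> (\<Union>i\<in>C. cball i (5 * r i))"
  proof (rule Vitali_covering_lemma_cballs[where S = S and K = S and a = "\<lambda>i. i" and r = r and B = "I / t"])
    show "S \<subseteq> (\<Union>i\<in>S. cball i (r i))" using rpos by (force intro: less_imp_le)
    show "0 < r i \<and> r i \<le> I / t" if "i \<in> S" for i using rle[OF that] rpos by auto
  qed (use that in blast)
  have S: "norm z = 1" if "z \<in> S" for z using that by (simp add: S_def space_circle)
  have "S \<subseteq> (\<Union>i\<in>C. carc i (5 * r i))"
    using cov S by (force simp: carc_def dist_commute)
  then have "emeasure circle S \<le> emeasure circle (\<Union>i\<in>C. carc i (5 * r i))"
    using C by (intro emeasure_mono) auto
  also have "\<dots> \<le> (\<integral>\<^sup>+i. emeasure circle (carc i (5 * r i)) \<partial>count_space C)"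
  proof -
    have "emeasure circle (\<Union>i\<in>C. carc i (5 * r i)) = (\<integral>\<^sup>+u. indicator (\<Union>i\<in>C. carc i (5 * r i)) u \<partial>circle)"
      using C by (intro nn_integral_indicator[symmetric] sets.countable_UN') auto
    also have "\<dots> \<le> (\<integral>\<^sup>+u. (\<integral>\<^sup>+i. indicator (carc i (5 * r i)) u \<partial>count_space C) \<partial>circle)"
    proof (rule nn_integral_mono)
      fix u
      show "indicator (\<Union>i\<in>C. carc i (5 * r i)) u \<le> (\<integral>\<^sup>+i. indicator (carc i (5 * r i)) u \<partial>count_space C)"
      proof (cases "\<exists>j\<in>C. u \<in> carc j (5 * r j)")
        case True
        then obtain j where "j \<in> C" "u \<in> carc j (5 * r j)" by blast
        then show ?thesis
          using nn_integral_ge_point[of j C "\<lambda>i. indicator (carc i (5 * r i)) u"] by (auto simp: indicator_def)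
      qed auto
    qed
    also have "\<dots> = (\<integral>\<^sup>+i. (\<integral>\<^sup>+u. indicator (carc i (5 * r i)) u \<partial>circle) \<partial>count_space C)"
      using C by (intro nn_integral_count_space_nn_integral) auto
    finally show ?thesis by simp
  qed
  also have "\<dots> \<le> (\<integral>\<^sup>+i. ennreal (35 / t) * (\<integral>\<^sup>+u\<in>carc i (r i). F u \<partial>circle) \<partial>count_space C)"
  proof (rule nn_integral_mono, simp)
    fix i assume i: "i \<in> C"
    have "emeasure circle (carc i (5 * r i)) \<le> ennreal (35 / t) * ennreal (t * r i)"
      using emeasure_carc_le[of i "5 * r i"] i C S rpos[of i] t
      by (auto simp flip: ennreal_mult)
    also have "\<dots> \<le> ennreal (35 / t) * (\<integral>\<^sup>+u\<in>carc i (r i). F u \<partial>circle)"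
      using k'[of i] i C by (intro mult_left_mono) auto
    finally show "emeasure circle (carc i (5 * r i)) \<le> ennreal (35 / t) * (\<integral>\<^sup>+u\<in>carc i (r i). F u \<partial>circle)" .
  qed
  also have "\<dots> = ennreal (35 / t) * (\<integral>\<^sup>+i. (\<integral>\<^sup>+u\<in>carc i (r i). F u \<partial>circle) \<partial>count_space C)"
    by (simp add: nn_integral_cmult)
  also have "(\<integral>\<^sup>+i. (\<integral>\<^sup>+u\<in>carc i (r i). F u \<partial>circle) \<partial>count_space C)
    = (\<integral>\<^sup>+u. (\<integral>\<^sup>+i. F u * indicator (carc i (r i)) u \<partial>count_space C) \<partial>circle)"
    using C by (intro nn_integral_count_space_nn_integral[symmetric]) auto
  also have "\<dots> \<le> (\<integral>\<^sup>+u. F u \<partial>circle)"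
  proof (rule nn_integral_mono)
    fix u assume "u \<in> space circle"
    have one: "i = j" if "i \<in> C" "j \<in> C" "u \<in> carc i (r i)" "u \<in> carc j (r j)" for i j
      using disj that unfolding pairwise_def disjnt_iff carc_def
      by (metis (no_types, lifting) dist_commute mem_Collect_eq mem_cball)
    show "(\<integral>\<^sup>+i. F u * indicator (carc i (r i)) u \<partial>count_space C) \<le> F u"
    proof (cases "\<exists>i\<in>C. u \<in> carc i (r i)")
      case True
      then obtain i where i: "i \<in> C" "u \<in> carc i (r i)" by blast
      have "(\<integral>\<^sup>+i. F u * indicator (carc i (r i)) u \<partial>count_space C) = (\<integral>\<^sup>+j. F u * indicator {i} j \<partial>count_space C)"
        using i one by (intro nn_integral_cong) (auto simp: indicator_def)
      also have "\<dots> = F u" using i by (simp add: nn_integral_cmult)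
      finally show ?thesis by simp
    next
      case False
      then have "(\<integral>\<^sup>+i. F u * indicator (carc i (r i)) u \<partial>count_space C) = (\<integral>\<^sup>+i. 0 \<partial>count_space C)"
        by (intro nn_integral_cong) (auto simp: indicator_def)
      then show ?thesis by simp
    qed
  qed
  finally show ?thesis by (simp add: S_def mult_left_mono)
qed

lemma hlmax_add:
  assumes [measurable]: "F \<in> borel_measurable circle" "G \<in> borel_measurable circle"
  shows "hlmax (\<lambda>u. F u + G u) z \<le> hlmax F z + hlmax G z"
  unfolding hlmax_def
proof (rule SUP_least)
  fix k :: int
  have "(\<integral>\<^sup>+u\<in>carc z (2 powi k). (F u + G u) \<partial>circle) / ennreal (2 powi k)
    = (\<integral>\<^sup>+u\<in>carc z (2 powi k). F u \<partial>circle) / ennreal (2 powi k) + (\<integral>\<^sup>+u\<in>carc z (2 powi k). G u \<partial>circle) / ennreal (2 powi k)"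
    by (simp add: distrib_right nn_integral_add add_divide_distrib_ennreal)
  also have "\<dots> \<le> (SUP k::int. (\<integral>\<^sup>+u\<in>carc z (2 powi k). F u \<partial>circle) / ennreal (2 powi k))
     + (SUP k::int. (\<integral>\<^sup>+u\<in>carc z (2 powi k). G u \<partial>circle) / ennreal (2 powi k))"
    by (intro add_mono SUP_upper) auto
  finally show "(\<integral>\<^sup>+u\<in>carc z (2 powi k). (F u + G u) \<partial>circle) / ennreal (2 powi k) \<le> \<dots>" .
qed

lemma hlmax_mono:
  assumes "\<And>u. u \<in> space circle \<Longrightarrow> F u \<le> G u"
  shows "hlmax F z \<le> hlmax G z"
  unfolding hlmax_def by (intro SUP_mono' divide_right_mono_ennreal nn_integral_mono mult_right_mono assms) auto

lemma hlmax_const_le: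
  assumes "norm z = 1"
  shows "hlmax (\<lambda>_. c) z \<le> 7 * c"
  unfolding hlmax_def
proof (rule SUP_least)
  fix k :: int
  have "(\<integral>\<^sup>+u\<in>carc z (2 powi k). c \<partial>circle) = c * emeasure circle (carc z (2 powi k))"
    by (simp add: nn_integral_cmult)
  also have "\<dots> \<le> c * ennreal (7 * 2 powi k)"
    using emeasure_carc_le[OF assms, of "2 powi k"] by (intro mult_left_mono) auto
  also have "\<dots> = ennreal (2 powi k) * (7 * c)"
    by (simp add: ennreal_mult mult_ac)
  finally show "(\<integral>\<^sup>+u\<in>carc z (2 powi k). c \<partial>circle) / ennreal (2 powi k) \<le> 7 * c"
    by (intro divide_le_posI_ennreal) auto
qed

text \<open>The values of \<open>F\<close> up to \<open>t / 14\<close> contribute at most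
  \<open>7 * (t / 14) = t / 2\<close> to \<open>hlmax F\<close>, so the maximal function of the
  remaining part has to exceed \<open>t / 2\<close>. Restricting the integral to large values of
  \<open>F\<close> is what makes interpolation possible.\<close>

lemma hlmax_weak_type_truncated:
  assumes [measurable]: "F \<in> borel_measurable circle" and t: "t > 0"
  shows "emeasure circle {z \<in> space circle. hlmax F z > ennreal t}
    \<le> ennreal (70 / t) * (\<integral>\<^sup>+u\<in>{u. F u > ennreal (t / 14)}. F u \<partial>circle)"
proof -
  define G where "G u = F u * indicator {u. F u > ennreal (t / 14)} u" for u
  have [measurable]: "G \<in> borel_measurable circle"
    unfolding G_def by measurable
  have "hlmax G z > ennreal (t / 2)" if z: "z \<in> space circle" "hlmax F z > ennreal t" for z
  proof (rule ccontr)
    assume neg: "\<not> ennreal (t / 2) < hlmax G z"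
    have "hlmax F z \<le> hlmax (\<lambda>u. G u + ennreal (t / 14)) z"
      by (rule hlmax_mono) (auto simp: G_def indicator_def not_less)
    also have "\<dots> \<le> hlmax G z + hlmax (\<lambda>_. ennreal (t / 14)) z"
      by (rule hlmax_add) auto
    also have "\<dots> \<le> ennreal (t / 2) + 7 * ennreal (t / 14)"
      using neg z by (intro add_mono hlmax_const_le) (auto simp: space_circle not_less)
    also have "\<dots> = ennreal t"
    proof -
      have "7 * ennreal (t / 14) = ennreal (7 * (t / 14))"
        using t by (subst ennreal_mult) auto
      then show ?thesis using t by (simp flip: ennreal_plus)
    qed
    finally show False using z by simp
  qed
  then have "emeasure circle {z \<in> space circle. hlmax F z > ennreal t}
    \<le> emeasure circle {z \<in> space circle. hlmax G z > ennreal (t / 2)}"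
    by (intro emeasure_mono) auto
  also have "\<dots> \<le> ennreal (35 / (t / 2)) * (\<integral>\<^sup>+u. G u \<partial>circle)"
    using t by (intro hlmax_weak_type) auto
  finally show ?thesis by (simp add: G_def)
qed

lemma exists_dyadic_scale:
  fixes c d :: real
  assumes "0 < c" "c < d"
  shows "\<exists>j::nat. 2 ^ j * c < d \<and> d \<le> 2 ^ Suc j * c"
proof -
  define n where "n = (LEAST n::nat. d \<le> 2 ^ n * c)"
  obtain m :: nat where "d / c < 2 ^ m"
    using real_arch_pow[of 2 "d / c"] by auto
  then have "d \<le> 2 ^ m * c" using assms by (simp add: field_simps)
  then have n: "d \<le> 2 ^ n * c" unfolding n_def by (rule LeastI)
  with assms have "n \<noteq> 0" by (intro notI) auto
  then obtain j where j: "n = Suc j" by (cases n) auto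
  then have "\<not> d \<le> 2 ^ j * c" unfolding n_def by (intro not_less_Least) auto
  with n j show ?thesis by (auto simp: not_le)
qed

lemma ennreal_le_suminf: "(f j :: ennreal) \<le> (\<Sum>i. f i)"
  using sum_le_suminf[of f "{j}"] by (auto intro: summableI)

lemma suminf_geometric_ennreal:
  fixes M :: ennreal
  assumes "0 \<le> c" "0 \<le> x" "x < 1"
  shows "(\<Sum>j. ennreal (c * x ^ j) * M) = ennreal (c / (1 - x)) * M"
proof -
  have "(\<Sum>j. ennreal (c * x ^ j)) = ennreal (c / (1 - x))"
  proof (rule suminf_ennreal_eq)
    show "(\<lambda>j. c * x ^ j) sums (c / (1 - x))"
      using sums_mult[OF geometric_sums[of x], of c] assms by simp
  qed (use assms in auto)
  then show ?thesis by simp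
qed

text \<open>On the shell between \<open>2 ^ j * \<rho>\<close> and \<open>2 ^ Suc j * \<rho>\<close>
  the kernel is at most \<open>1 / (4 ^ j * \<rho>)\<close>, so the shell contributes at most
  \<open>4 / 2 ^ j\<close> times \<open>hlmax F z\<close>; these factors add up to 8.\<close>

lemma tail_integral_le_hlmax:
  assumes [measurable]: "F \<in> borel_measurable circle" and \<rho>: "\<rho> > 0"
  shows "(\<integral>\<^sup>+u. F u * ennreal (if dist u z > \<rho> then \<rho> / (dist u z)\<^sup>2 else 0) \<partial>circle) \<le> 8 * hlmax F z"
proof -
  have "(\<integral>\<^sup>+u. F u * ennreal (if dist u z > \<rho> then \<rho> / (dist u z)\<^sup>2 else 0) \<partial>circle)
    \<le> (\<integral>\<^sup>+u. (\<Sum>j. ennreal (1 / (4 ^ j * \<rho>)) * (F u * indicator (carc z (2 ^ Suc j * \<rho>)) u)) \<partial>circle)"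
  proof (rule nn_integral_mono)
    fix u assume u: "u \<in> space circle"
    show "F u * ennreal (if dist u z > \<rho> then \<rho> / (dist u z)\<^sup>2 else 0)
      \<le> (\<Sum>j. ennreal (1 / (4 ^ j * \<rho>)) * (F u * indicator (carc z (2 ^ Suc j * \<rho>)) u))"
    proof (cases "dist u z > \<rho>")
      case True
      then obtain j where j: "2 ^ j * \<rho> < dist u z" "dist u z \<le> 2 ^ Suc j * \<rho>"
        using exists_dyadic_scale[OF \<rho>] by blast
      have "(2 ^ j * \<rho>)\<^sup>2 \<le> (dist u z)\<^sup>2"
        using j \<rho> by (intro power_mono) auto
      then have "\<rho> / (dist u z)\<^sup>2 \<le> \<rho> / (2 ^ j * \<rho>)\<^sup>2"
        using \<rho> True by (intro divide_left_mono mult_pos_pos) auto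
      also have "\<dots> = 1 / (4 ^ j * \<rho>)"
        using \<rho> by (simp add: power_mult_distrib power2_eq_square flip: power_mult_distrib)
      finally have "F u * ennreal (\<rho> / (dist u z)\<^sup>2)
        \<le> ennreal (1 / (4 ^ j * \<rho>)) * (F u * indicator (carc z (2 ^ Suc j * \<rho>)) u)"
        using u j by (auto simp: indicator_carc mult.commute intro!: mult_left_mono mult_right_mono ennreal_leI)
      also have "\<dots> \<le> (\<Sum>j. ennreal (1 / (4 ^ j * \<rho>)) * (F u * indicator (carc z (2 ^ Suc j * \<rho>)) u))"
        by (rule ennreal_le_suminf)
      finally show ?thesis using True by simp
    qed simp
  qed
  also have "\<dots> = (\<Sum>j. ennreal (1 / (4 ^ j * \<rho>)) * (\<integral>\<^sup>+u\<in>carc z (2 ^ Suc j * \<rho>). F u \<partial>circle))"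
    by (simp add: nn_integral_suminf nn_integral_cmult)
  also have "\<dots> \<le> (\<Sum>j. ennreal (1 / (4 ^ j * \<rho>)) * (ennreal (2 * (2 ^ Suc j * \<rho>)) * hlmax F z))"
    using \<rho> by (intro suminf_le mult_left_mono carc_integral_le_hlmax summableI) auto
  also have "\<dots> = (\<Sum>j. ennreal (4 * (1 / 2) ^ j) * hlmax F z)"
  proof -
    have "ennreal (1 / (4 ^ j * \<rho>)) * ennreal (2 * (2 ^ Suc j * \<rho>)) = ennreal (4 * (1 / 2) ^ j)" for j
    proof -
      have "(4::real) ^ j = 2 ^ j * 2 ^ j" by (simp flip: power_mult_distrib)
      then show ?thesis
        using \<rho> by (subst ennreal_mult[symmetric]) (auto simp: field_simps)
    qed
    then show ?thesis by (simp only: mult.assoc[symmetric])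
  qed
  also have "\<dots> = 8 * hlmax F z"
    by (subst suminf_geometric_ennreal) auto
  finally show ?thesis .
qed

text \<open>A form of Lebesgue differentiation for thin annuli. Up to height \<open>n\<close> the
  function contributes at most \<open>n\<close> times the measure of the annulus, which is
  O(epsilon^2); the excess \<open>T n\<close> is controlled by its maximal function, which at almost
  every point is small for a suitable \<open>n\<close>. One exceptional null set serves all
  \<open>C\<close> and \<open>e\<close>.\<close>

lemma AE_annulus_integral_small:
  assumes [measurable]: "G \<in> borel_measurable circle" and fin: "(\<integral>\<^sup>+u. G u \<partial>circle) < \<infinity>"
  shows "AE z in circle. \<forall>C\<ge>0. \<forall>e>0. eventually (\<lambda>\<epsilon>.
    (\<integral>\<^sup>+u. G u * indicator {u. \<epsilon> * (1 - C * \<epsilon>) \<le> dist u z \<and> dist u z \<le> \<epsilon> * (1 + C * \<epsilon>)} u \<partial>circle)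
      \<le> ennreal (e * \<epsilon>)) (at_right 0)"
proof -
  define T where "T n u = G u * indicator {u. G u > ennreal (real n)} u" for n :: nat and u
  have [measurable]: "T n \<in> borel_measurable circle" for n
    unfolding T_def by measurable
  have T0: "(\<lambda>n. \<integral>\<^sup>+u. T n u \<partial>circle) \<longlonglongrightarrow> (\<integral>\<^sup>+u. 0 \<partial>circle)"
  proof (rule nn_integral_dominated_convergence[where w = G])
    show "AE u in circle. (\<lambda>n. T n u) \<longlonglongrightarrow> 0"
      using nn_integral_PInf_AE[OF assms(1) fin[THEN less_imp_neq]]
    proof eventually_elim
      case (elim u)
      then obtain x where x: "G u = ennreal x" "x \<ge> 0" by (cases "G u") auto
      have "eventually (\<lambda>n. T n u = 0) sequentially"
        using eventually_ge_at_top[of "nat \<lceil>x\<rceil>"]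
      proof eventually_elim
        case (elim n)
        then have "x \<le> real n" by linarith
        then show ?case using x by (auto simp: T_def indicator_def ennreal_less_iff)
      qed
      then show ?case by (rule tendsto_eventually)
    qed
  qed (use fin in \<open>auto simp: T_def indicator_def\<close>)
  \<comment> \<open>The points where no \<open>n\<close> works lie in the level sets of all the
    \<open>hlmax (T n)\<close>, whose measures tend to 0 with the integral of
    \<open>T n\<close>.\<close>
  have good: "AE z in circle. \<exists>n. hlmax (T n) z \<le> ennreal e" if e: "e > 0" for e
  proof -
    define B where "B = {z \<in> space circle. \<forall>n. ennreal e < hlmax (T n) z}"
    have [measurable]: "B \<in> sets circle" unfolding B_def by measurable
    have "emeasure circle B \<le> ennreal (35 / e) * (\<integral>\<^sup>+u. T n u \<partial>circle)" for n
    proof -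
      have "emeasure circle B \<le> emeasure circle {z \<in> space circle. ennreal e < hlmax (T n) z}"
        by (intro emeasure_mono) (auto simp: B_def)
      also have "\<dots> \<le> ennreal (35 / e) * (\<integral>\<^sup>+u. T n u \<partial>circle)"
        by (rule hlmax_weak_type) (use e in auto)
      finally show ?thesis .
    qed
    moreover have "(\<lambda>n. ennreal (35 / e) * (\<integral>\<^sup>+u. T n u \<partial>circle)) \<longlonglongrightarrow> ennreal (35 / e) * 0"
      using T0 by (intro ennreal_tendsto_cmult) auto
    ultimately have "emeasure circle B \<le> 0"
      using LIMSEQ_le_const[of "\<lambda>n. ennreal (35 / e) * (\<integral>\<^sup>+u. T n u \<partial>circle)" 0 "emeasure circle B"] by auto
    then show ?thesis
      by (intro AE_I[where N = B]) (auto simp: B_def not_le)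
  qed
  have "AE z in circle. \<forall>k. \<exists>n. hlmax (T n) z \<le> ennreal (1 / real (Suc k))"
    unfolding AE_all_countable by (intro allI good) auto
  with AE_space show ?thesis
  proof eventually_elim
    case (elim z)
    then have z: "norm z = 1" by (simp add: space_circle)
    show ?case
    proof (intro allI impI)
      fix C e :: real assume C: "C \<ge> 0" and e: "e > 0"
      \<comment> \<open>The tail is measured on an arc of radius \<open>2 * \<epsilon>\<close>,
        where \<open>carc_integral_le_hlmax\<close> gives the factor \<open>4 * \<epsilon>\<close>;
        with \<open>e / 8\<close> this is half of the allowed \<open>e * \<epsilon>\<close>.\<close>
      obtain k where k: "1 / real (Suc k) < e / 8"
        using nat_approx_posE[of "e / 8"] e by auto
      obtain n where n: "hlmax (T n) z \<le> ennreal (1 / real (Suc k))"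
        using elim by blast
      \<comment> \<open>The first bound keeps \<open>C * \<epsilon>\<close> below 1/2, so that the
        annulus lies in the arc of radius \<open>2 * \<epsilon>\<close>; the second makes the
        bounded part at most the other half.\<close>
      define \<eta> where "\<eta> = min (1 / (2 * C + 2)) (e / (12 * (C + 1) * (real n + 1)))"
      have \<eta>: "\<eta> > 0" using C e by (auto simp: \<eta>_def)
      show "eventually (\<lambda>\<epsilon>.
        (\<integral>\<^sup>+u. G u * indicator {u. \<epsilon> * (1 - C * \<epsilon>) \<le> dist u z \<and> dist u z \<le> \<epsilon> * (1 + C * \<epsilon>)} u \<partial>circle)
          \<le> ennreal (e * \<epsilon>)) (at_right 0)"
        unfolding eventually_at_right_field
      proof (intro exI[of _ \<eta>] conjI \<eta> allI impI)
        fix \<epsilon> :: real assume \<epsilon>: "0 < \<epsilon>" "\<epsilon> < \<eta>"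
        define A where "A = {u. \<epsilon> * (1 - C * \<epsilon>) \<le> dist u z \<and> dist u z \<le> \<epsilon> * (1 + C * \<epsilon>)}"
        have [measurable]: "(indicator A :: complex \<Rightarrow> ennreal) \<in> borel_measurable circle"
          unfolding A_def by measurable
        have "\<epsilon> * (2 * C + 2) < 1"
          using \<epsilon> C by (auto simp: \<eta>_def field_simps)
        then have C1: "C * \<epsilon> < 1 / 2" "\<epsilon> < 1 / 2"
          using C \<epsilon> by (auto simp: algebra_simps) (smt (verit) mult_nonneg_nonneg)
        have "\<epsilon> < e / (12 * (C + 1) * (real n + 1))"
          using \<epsilon> by (simp add: \<eta>_def)
        then have "\<epsilon> * (12 * (C + 1) * (real n + 1)) < e"
          using C by (subst (asm) pos_less_divide_eq) auto
        moreover have "\<epsilon> * (12 * C * real n) \<le> \<epsilon> * (12 * (C + 1) * (real n + 1))"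
          using C \<epsilon> by (intro mult_left_mono mult_mono) auto
        ultimately have e2: "12 * C * real n * \<epsilon> \<le> e" by (simp add: mult.commute)
        have A2: "A \<subseteq> {u. dist u z \<le> 2 * \<epsilon>}"
        proof
          fix u assume "u \<in> A"
          then have "dist u z \<le> \<epsilon> * (1 + C * \<epsilon>)" by (simp add: A_def)
          also have "\<dots> \<le> \<epsilon> * 2" using C1 \<epsilon> by (intro mult_left_mono) auto
          finally show "u \<in> {u. dist u z \<le> 2 * \<epsilon>}" by simp
        qed
        have "(\<integral>\<^sup>+u. G u * indicator A u \<partial>circle)
          \<le> (\<integral>\<^sup>+u. T n u * indicator (carc z (2 * \<epsilon>)) u + ennreal (real n) * indicator A u \<partial>circle)"
          using A2 by (intro nn_integral_mono) (auto simp: T_def indicator_def carc_eq not_less)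
        also have "\<dots> = (\<integral>\<^sup>+u\<in>carc z (2 * \<epsilon>). T n u \<partial>circle) + ennreal (real n) * (\<integral>\<^sup>+u. indicator A u \<partial>circle)"
          by (simp add: nn_integral_add nn_integral_cmult)
        also have "(\<integral>\<^sup>+u. indicator A u \<partial>circle) = emeasure circle {u \<in> sphere 0 1. \<epsilon> * (1 - C * \<epsilon>) \<le> dist u z \<and> dist u z \<le> \<epsilon> * (1 + C * \<epsilon>)}"
        proof -
          have B: "{u \<in> sphere 0 1. \<epsilon> * (1 - C * \<epsilon>) \<le> dist u z \<and> dist u z \<le> \<epsilon> * (1 + C * \<epsilon>)} \<in> sets circle"
            unfolding space_circle[symmetric] by measurable
          show ?thesis
            by (subst nn_integral_indicator[OF B, symmetric]) (auto intro!: nn_integral_cong simp: A_def indicator_def space_circle)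
        qed
        also have "\<dots> \<le> ennreal (3 * (\<epsilon> * (1 + C * \<epsilon>) - \<epsilon> * (1 - C * \<epsilon>)))"
        proof (rule emeasure_circle_annulus[OF z])
          show "0 \<le> \<epsilon> * (1 - C * \<epsilon>)" using C1 \<epsilon> by auto
          show "\<epsilon> * (1 - C * \<epsilon>) \<le> \<epsilon> * (1 + C * \<epsilon>)" using C \<epsilon> by (intro mult_left_mono) auto
          have "\<epsilon> * (1 + C * \<epsilon>) \<le> (1 / 2) * 2" using C1 \<epsilon> C by (intro mult_mono) auto
          then show "\<epsilon> * (1 + C * \<epsilon>) \<le> 1" by simp
        qed
        also have "3 * (\<epsilon> * (1 + C * \<epsilon>) - \<epsilon> * (1 - C * \<epsilon>)) = 6 * C * \<epsilon> * \<epsilon>"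
          by (simp add: algebra_simps)
        also have "(\<integral>\<^sup>+u\<in>carc z (2 * \<epsilon>). T n u \<partial>circle) \<le> ennreal (2 * (2 * \<epsilon>)) * hlmax (T n) z"
          using \<epsilon> by (intro carc_integral_le_hlmax) auto
        also have "\<dots> \<le> ennreal (2 * (2 * \<epsilon>)) * ennreal (e / 8)"
          using order_trans[OF n ennreal_leI[OF less_imp_le[OF k]]] by (intro mult_left_mono) auto
        also have "\<dots> = ennreal (e * \<epsilon> / 2)"
          using \<epsilon> e by (subst ennreal_mult[symmetric]) (auto simp: algebra_simps)
        finally have "(\<integral>\<^sup>+u. G u * indicator A u \<partial>circle) \<le> ennreal (e * \<epsilon> / 2) + ennreal (real n) * ennreal (6 * C * \<epsilon> * \<epsilon>)"
          by (simp add: add_mono mult_left_mono)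
        also have "\<dots> = ennreal (e * \<epsilon> / 2 + real n * (6 * C * \<epsilon> * \<epsilon>))"
          using \<epsilon> e C by (simp add: ennreal_mult ennreal_plus)
        also have "\<dots> \<le> ennreal (e * \<epsilon>)"
        proof (rule ennreal_leI)
          have "(12 * C * real n * \<epsilon>) * \<epsilon> \<le> e * \<epsilon>" using e2 \<epsilon> by (intro mult_right_mono) auto
          then show "e * \<epsilon> / 2 + real n * (6 * C * \<epsilon> * \<epsilon>) \<le> e * \<epsilon>" by (simp add: algebra_simps)
        qed
        finally show "(\<integral>\<^sup>+u. G u * indicator {u. \<epsilon> * (1 - C * \<epsilon>) \<le> dist u z \<and> dist u z \<le> \<epsilon> * (1 + C * \<epsilon>)} u \<partial>circle)
          \<le> ennreal (e * \<epsilon>)" by (simp add: A_def)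
      qed
    qed
  qed
qed

section \<open>Dyadic cells\<close>

text \<open>The ceiling matches the range \<open>{-pi<..pi}\<close> of \<open>Arg\<close>: cells
  contain their right end point and are numbered from 1 to \<open>2 ^ n\<close>.\<close>

definition cell_index :: "nat \<Rightarrow> complex \<Rightarrow> int" where
  "cell_index n z = \<lceil>2 ^ n * ((Arg z + pi) / (2 * pi))\<rceil>"

definition cell :: "nat \<Rightarrow> int \<Rightarrow> complex set" where
  "cell n k = {z \<in> space circle. cell_index n z = k}"

text \<open>The right end point belongs to the cell and serves as its reference point for
  truncations.\<close>

definition cell_end :: "nat \<Rightarrow> int \<Rightarrow> complex" where
  "cell_end n k = cis (2 * pi * real_of_int k / 2 ^ n - pi)"

definition cell_length :: "nat \<Rightarrow> real" where
  "cell_length n = 2 * pi / 2 ^ n"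

lemma cell_length_pos [simp]: "cell_length n > 0"
  by (simp add: cell_length_def)

lemma cell_length_neq_0 [simp]: "cell_length n \<noteq> 0"
  by (simp add: cell_length_def)

lemma cell_length_nonneg [simp]: "cell_length n \<ge> 0"
  by (simp add: cell_length_def)

lemma cell_length_Suc: "cell_length n = 2 * cell_length (Suc n)"
  by (simp add: cell_length_def)

lemma cell_length_0: "cell_length 0 = 2 * pi"
  by (simp add: cell_length_def)

lemma cell_length_tendsto: "cell_length \<longlonglongrightarrow> 0"
proof -
  have "(\<lambda>n. 2 * pi * (1 / 2) ^ n) \<longlonglongrightarrow> 2 * pi * 0"
    by (intro tendsto_mult_left LIMSEQ_realpow_zero) auto
  then show ?thesis
    by (simp add: cell_length_def[abs_def] power_divide)
qed

lemma norm_cell_end [simp]: "norm (cell_end n k) = 1"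
  by (simp add: cell_end_def)

text \<open>\<open>Arg\<close> is continuous off the closed negative real axis and constant on that
  axis without 0.\<close>

lemma Arg_measurable [measurable]: "Arg \<in> borel_measurable borel"
proof -
  have "(\<lambda>z. indicator (- \<real>\<^sub>\<le>\<^sub>0) z *\<^sub>R Arg z) \<in> borel_measurable borel"
    by (intro borel_measurable_continuous_on_indicator) (auto intro!: continuous_at_imp_continuous_on continuous_at_Arg)
  moreover have "(\<lambda>z. indicator (\<real>\<^sub>\<le>\<^sub>0 - {0}) z *\<^sub>R pi) \<in> borel_measurable (borel :: complex measure)"
    by (intro borel_measurable_scaleR borel_measurable_indicator) auto
  ultimately have *: "(\<lambda>z. indicator (- \<real>\<^sub>\<le>\<^sub>0) z *\<^sub>R Arg z + indicator (\<real>\<^sub>\<le>\<^sub>0 - {0}) z *\<^sub>R pi) \<in> borel_measurable borel"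
    by (rule borel_measurable_add)
  have "Arg z = indicator (- \<real>\<^sub>\<le>\<^sub>0) z *\<^sub>R Arg z + indicator (\<real>\<^sub>\<le>\<^sub>0 - {0}) z *\<^sub>R pi" for z
  proof (cases "z = 0")
    case False
    then show ?thesis
      by (auto simp: indicator_def Arg_eq_pi complex_nonpos_Reals_iff complex_eq_iff)
  qed (simp add: Arg_zero)
  then have eq: "Arg = (\<lambda>z. indicator (- \<real>\<^sub>\<le>\<^sub>0) z *\<^sub>R Arg z + indicator (\<real>\<^sub>\<le>\<^sub>0 - {0}) z *\<^sub>R pi)"
    by (rule ext)
  show ?thesis
    by (subst eq) (rule *)
qed

lemma cell_index_measurable [measurable]: "cell_index n \<in> measurable circle (count_space UNIV)"
proof -
  have "cell_index n \<in> measurable borel (count_space UNIV)"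
    unfolding cell_index_def by measurable
  then show ?thesis by (rule borel_measurable_circleI)
qed

lemma cell_sets [measurable]: "cell n k \<in> sets circle"
  unfolding cell_def by measurable

lemma cell_index_bounds: "cell_index n z \<in> {1..2 ^ n}"
proof -
  define t where "t = (Arg z + pi) / (2 * pi)"
  have t: "0 < t" "t \<le> 1"
    using Arg_bounded[of z] by (auto simp: t_def field_simps)
  then have "0 < 2 ^ n * t" "2 ^ n * t \<le> real_of_int (2 ^ n)"
    by (auto simp: mult_le_cancel_left1)
  then show ?thesis
    unfolding cell_index_def t_def[symmetric]
    by (auto simp: ceiling_le_iff less_ceiling_iff zero_less_ceiling int_one_le_iff_zero_less)
qed

lemma cell_index_cis:
  assumes "y \<in> {-pi<..pi}"
  shows "cell_index n (cis y) = \<lceil>(y + pi) / cell_length n\<rceil>"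
  using assms by (simp add: cell_index_def Arg_cis cell_length_def field_simps)

lemma cell_index_cell_end:
  assumes "k \<in> {1..2 ^ n}"
  shows "cell_index n (cell_end n k) = k"
proof -
  have "real_of_int k \<le> real_of_int (2 ^ n)"
    using assms by (subst of_int_le_iff) auto
  then have "2 * pi * real_of_int k / 2 ^ n - pi \<in> {-pi<..pi}"
    using assms by (auto simp: field_simps)
  then show ?thesis
    unfolding cell_end_def by (subst cell_index_cis) (auto simp: cell_length_def)
qed

lemma cell_end_in_cell: "k \<in> {1..2 ^ n} \<Longrightarrow> cell_end n k \<in> cell n k"
  by (simp add: cell_def space_circle cell_index_cell_end)

lemma dist_cis_le: "dist (cis a) (cis b) \<le> \<bar>a - b\<bar>"
proof -
  have "(dist (cis a) (cis b))\<^sup>2 = (cos a - cos b)\<^sup>2 + (sin a - sin b)\<^sup>2"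
    by (simp add: dist_norm cmod_power2)
  also have "\<dots> = 2 - 2 * cos (a - b)"
    using sin_cos_squared_add[of a] sin_cos_squared_add[of b]
    by (simp add: cos_diff power2_eq_square algebra_simps)
  also have "\<dots> = (2 * sin ((a - b) / 2))\<^sup>2"
  proof -
    have halves: "2 * ((a - b) / 2) = a - b" by simp
    have "cos (a - b) = 1 - 2 * (sin ((a - b) / 2))\<^sup>2"
      using cos_double_sin[of "(a - b) / 2"] unfolding halves .
    then show ?thesis by (simp add: power2_eq_square)
  qed
  finally have "dist (cis a) (cis b) = \<bar>2 * sin ((a - b) / 2)\<bar>"
    by (metis abs_of_nonneg power2_eq_iff_nonneg power2_abs abs_ge_zero zero_le_dist)
  then show ?thesis
    using abs_sin_x_le_abs_x[of "(a - b) / 2"] by (simp add: abs_mult)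
qed

lemma cis_Arg_circle: "norm z = 1 \<Longrightarrow> cis (Arg z) = z"
  by (subst cis_Arg) (auto simp: sgn_eq)

lemma dist_cell_end:
  assumes "z \<in> cell n k"
  shows "dist z (cell_end n k) \<le> cell_length n"
proof -
  define x where "x = 2 ^ n * ((Arg z + pi) / (2 * pi))"
  have k: "k = \<lceil>x\<rceil>" using assms by (simp add: cell_def cell_index_def x_def)
  have "x \<le> real_of_int k" "real_of_int k < x + 1"
    unfolding k by linarith+
  then have "cell_length n * x \<le> cell_length n * real_of_int k" "cell_length n * real_of_int k \<le> cell_length n * x + cell_length n"
    using mult_left_mono[of "real_of_int k" "x + 1" "cell_length n"] by (auto simp: distrib_left)
  moreover have "cell_length n * x = Arg z + pi" by (simp add: x_def cell_length_def)
  moreover have "cell_length n * real_of_int k = 2 * pi * real_of_int k / 2 ^ n"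
    by (simp add: cell_length_def)
  ultimately have "\<bar>Arg z - (2 * pi * real_of_int k / 2 ^ n - pi)\<bar> \<le> cell_length n"
    unfolding abs_le_iff by linarith
  then have "dist (cis (Arg z)) (cell_end n k) \<le> cell_length n"
    unfolding cell_end_def using dist_cis_le order_trans by blast
  then show ?thesis using assms by (simp add: cell_def space_circle cis_Arg_circle)
qed

text \<open>Cells are nested because the ceiling of \<open>x / 2\<close> is determined by the
  ceiling of \<open>x\<close>; so the index at generation \<open>n\<close> is a function of that at
  generation \<open>Suc n\<close>.\<close>

lemma cell_index_parent:
  assumes "cell_index (Suc n) z = cell_index (Suc n) w"
  shows "cell_index n z = cell_index n w"
proof -
  have half: "\<lceil>x / 2\<rceil> = (\<lceil>x\<rceil> + 1) div 2" for x :: real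
    by (simp add: ceiling_eq_iff) linarith
  have "cell_index n v = (cell_index (Suc n) v + 1) div 2" for v
  proof -
    have "2 ^ n * ((Arg v + pi) / (2 * pi)) = (2 ^ Suc n * ((Arg v + pi) / (2 * pi))) / 2" by simp
    then show ?thesis unfolding cell_index_def by (simp only: half)
  qed
  then show ?thesis using assms by simp
qed

lemma cell_index_coarser:
  assumes "m \<le> n" "cell_index n z = cell_index n w"
  shows "cell_index m z = cell_index m w"
  using assms by (induction rule: inc_induct) (auto intro: cell_index_parent)

lemma emeasure_cell:
  assumes k: "k \<in> {1..2 ^ n}"
  shows "emeasure circle (cell n k) = ennreal (cell_length n)"
proof -
  have "real_of_int k \<le> real_of_int (2 ^ n)"
    using k by (subst of_int_le_iff) auto
  then have kn: "real_of_int k \<le> 2 ^ n" "1 \<le> real_of_int k"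
    using k by auto
  define L where "L = cell_length n"
  have L: "L > 0" "L * 2 ^ n = 2 * pi" by (auto simp: L_def cell_length_def)
  define a where "a = L * (real_of_int k - 1) - pi"
  have a: "-pi \<le> a" "a + L \<le> pi"
  proof -
    show "-pi \<le> a" using L kn by (simp add: a_def)
    have "L * real_of_int k \<le> L * 2 ^ n" using L kn by (intro mult_left_mono) auto
    then show "a + L \<le> pi" using L by (simp add: a_def algebra_simps)
  qed
  have "emeasure circle (cell n k) = (\<integral>\<^sup>+z. indicator (cell n k) z \<partial>circle)" by simp
  also have "\<dots> = (\<integral>\<^sup>+y\<in>{-pi..pi}. indicator (cell n k) (cis y) \<partial>lborel)"
    by (rule nn_integral_circle') simp
  also have "\<dots> = (\<integral>\<^sup>+y. indicator {a<..a + L} y \<partial>lborel)"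
  proof (rule nn_integral_cong_AE)
    have "AE y in lborel. y \<noteq> -pi" by (rule AE_lborel_singleton)
    then show "AE y in lborel. indicator (cell n k) (cis y) * indicator {-pi..pi} y = (indicator {a<..a + L} y :: ennreal)"
    proof eventually_elim
      case (elim y)
      have "cis y \<in> cell n k \<longleftrightarrow> y \<in> {a<..a + L}" if "y \<in> {-pi..pi}"
      proof -
        have "y \<in> {-pi<..pi}" using that elim by auto
        then have "cis y \<in> cell n k \<longleftrightarrow> \<lceil>(y + pi) / L\<rceil> = k"
          by (simp add: cell_def space_circle cell_index_cis L_def)
        also have "\<dots> \<longleftrightarrow> real_of_int k - 1 < (y + pi) / L \<and> (y + pi) / L \<le> real_of_int k"
          by (simp add: ceiling_eq_iff)
        also have "\<dots> \<longleftrightarrow> y \<in> {a<..a + L}"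
          using L by (auto simp: a_def field_simps)
        finally show ?thesis .
      qed
      then show ?case using a by (auto simp: indicator_def)
    qed
  qed
  also have "\<dots> = ennreal L" using L by simp
  finally show ?thesis by (simp add: L_def)
qed

text \<open>The exceptional points are the finitely many cell ends and -1, where \<open>Arg\<close>
  jumps. Functions constant on cells are thereby locally constant almost everywhere.\<close>

lemma cell_locally_constant:
  "AE z in circle. \<exists>d>0. \<forall>u\<in>space circle. dist u z < d \<longrightarrow> cell_index n u = cell_index n z"
proof -
  have "AE z in circle. \<forall>k\<in>{0..(2::int) ^ n}. z \<noteq> cell_end n k"
    by (rule AE_finite_allI) (auto simp: AE_circle_neq)
  moreover have "AE z in circle. z \<noteq> -1" by (rule AE_circle_neq)
  ultimately show ?thesis using AE_space
  proof eventually_elim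
    case (elim z)
    define X where "X u = 2 ^ n * ((Arg u + pi) / (2 * pi))" for u
    have z: "norm z = 1" using elim by (simp add: space_circle)
    have "z \<notin> \<real>\<^sub>\<le>\<^sub>0"
    proof
      assume "z \<in> \<real>\<^sub>\<le>\<^sub>0"
      then obtain r where "z = - complex_of_real r" "r \<ge> 0"
        by (auto elim!: nonpos_Reals_cases) (metis of_real_minus minus_minus neg_0_le_iff_le)
      with z have "z = -1" by auto
      with elim show False by simp
    qed
    then have cont: "isCont X z"
      unfolding X_def by (intro continuous_intros continuous_at_Arg) auto
    have notint: "X z \<noteq> real_of_int \<lceil>X z\<rceil>"
    proof
      assume eq: "X z = real_of_int \<lceil>X z\<rceil>"
      define k where "k = \<lceil>X z\<rceil>"
      have kb: "k \<in> {1..2 ^ n}" using cell_index_bounds[of n z] by (simp add: k_def X_def cell_index_def)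
      have "real_of_int k = 2 ^ n * ((Arg z + pi) / (2 * pi))" using eq by (simp add: k_def X_def)
      then have "2 * pi * real_of_int k / 2 ^ n - pi = Arg z" by (simp add: field_simps)
      then have "cell_end n k = z" using z by (simp add: cell_end_def cis_Arg_circle)
      with elim kb show False by auto
    qed
    define e where "e = min (real_of_int \<lceil>X z\<rceil> - X z) (X z - (real_of_int \<lceil>X z\<rceil> - 1))"
    have "e > 0" using notint by (auto simp: e_def) linarith+
    with cont obtain d where d: "d > 0" "\<And>u. dist u z < d \<Longrightarrow> dist (X u) (X z) < e"
      unfolding continuous_at_eps_delta by blast
    show ?case
    proof (intro exI conjI ballI impI)
      fix u assume "dist u z < d"
      then have "\<bar>X u - X z\<bar> < e" using d by (simp add: dist_real_def)
      then have "\<lceil>X u\<rceil> = \<lceil>X z\<rceil>" unfolding ceiling_eq_iff e_def by linarith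
      then show "cell_index n u = cell_index n z" by (simp add: cell_index_def X_def)
    qed (use d in simp)
  qed
qed

lemma cell_nonempty_index: "z \<in> cell n k \<Longrightarrow> k \<in> {1..2 ^ n}"
  using cell_index_bounds[of n z] by (auto simp: cell_def)

lemma cell_subset_carc: "z \<in> cell n k \<Longrightarrow> cell n k \<subseteq> carc z (2 * cell_length n)"
proof
  fix u assume "z \<in> cell n k" "u \<in> cell n k"
  then have "dist u z \<le> cell_length n + cell_length n"
    using dist_cell_end[of z n k] dist_cell_end[of u n k] dist_triangle2[of u z "cell_end n k"] by linarith
  then show "u \<in> carc z (2 * cell_length n)"
    using \<open>u \<in> cell n k\<close> by (simp add: carc_eq cell_def)
qed

lemma norm_integral_le_integral:
  fixes f :: "'a \<Rightarrow> 'b::{banach, second_countable_topology}"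
  assumes "integrable M f" "integrable M g" "\<And>x. x \<in> space M \<Longrightarrow> norm (f x) \<le> g x"
  shows "norm (integral\<^sup>L M f) \<le> integral\<^sup>L M g"
proof -
  have "(LINT x|M. norm (f x)) \<le> integral\<^sup>L M g"
    using assms by (intro integral_mono) auto
  then show ?thesis using integral_norm_bound[of M f] by linarith
qed

section \<open>Averages over cells\<close>

definition cell_avg :: "nat \<Rightarrow> (complex \<Rightarrow> complex) \<Rightarrow> complex \<Rightarrow> complex" where
  "cell_avg n f z = (LINT u|circle. indicator (cell n (cell_index n z)) u *\<^sub>R f u) /\<^sub>R cell_length n"

lemma cell_avg_cong: "cell_index n z = cell_index n w \<Longrightarrow> cell_avg n f z = cell_avg n f w"
  by (simp add: cell_avg_def)

lemma cell_avg_measurable [measurable]: "cell_avg n f \<in> borel_measurable circle"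
proof -
  have "(\<lambda>z. (\<lambda>k. (LINT u|circle. indicator (cell n k) u *\<^sub>R f u) /\<^sub>R cell_length n) (cell_index n z))
    \<in> borel_measurable circle"
    by (rule measurable_compose[OF cell_index_measurable]) simp
  then show ?thesis by (simp add: cell_avg_def[abs_def])
qed

lemma cell_avg_bounded: "\<exists>B. \<forall>z. norm (cell_avg n f z) \<le> B"
proof -
  define h where "h k = (LINT u|circle. indicator (cell n k) u *\<^sub>R f u) /\<^sub>R cell_length n" for k
  have "finite ((\<lambda>k. norm (h k)) ` {1..2 ^ n})" by simp
  then have "norm (h k) \<le> Max ((\<lambda>k. norm (h k)) ` {1..2 ^ n})" if "k \<in> {1..2 ^ n}" for k
    using that by (intro Max_ge) auto
  then show ?thesis
    using cell_index_bounds by (metis cell_avg_def h_def)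
qed

lemma indicator_cell_eq:
  "u \<in> space circle \<Longrightarrow> indicator (cell n (cell_index n w)) u = (if cell_index n u = cell_index n w then 1 else 0)"
  by (auto simp: indicator_def cell_def)

text \<open>The averaging kernel is symmetric and has mass 1 in each variable, so
  \<open>nn_integral_ennpowr_le\<close> with \<open>m = 1\<close> followed by Fubini gives the
  estimate.\<close>

lemma nn_integral_cell_avg_powr:
  assumes [measurable]: "f \<in> borel_measurable circle" and q: "1 \<le> q"
  shows "(\<integral>\<^sup>+z. ennpowr (ennreal (norm (cell_avg n f z))) q \<partial>circle)
    \<le> ennreal (2 powr q) * (\<integral>\<^sup>+z. ennpowr (ennreal (norm (f z))) q \<partial>circle)"
proof -
  interpret P: pair_sigma_finite circle circle ..
  define k where "k z u = ennreal (if cell_index n u = cell_index n z then 1 / cell_length n else 0)" for z u :: complex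
  have k1: "(\<integral>\<^sup>+u. k z u \<partial>circle) = 1" if "z \<in> space circle" for z
  proof -
    have "(\<integral>\<^sup>+u. k z u \<partial>circle) = (\<integral>\<^sup>+u. ennreal (1 / cell_length n) * indicator (cell n (cell_index n z)) u \<partial>circle)"
      by (intro nn_integral_cong) (auto simp: k_def indicator_cell_eq)
    also have "\<dots> = ennreal (1 / cell_length n) * ennreal (cell_length n)"
      using cell_index_bounds by (simp add: nn_integral_cmult emeasure_cell)
    also have "\<dots> = 1" by (subst ennreal_mult[symmetric]) auto
    finally show ?thesis .
  qed
  have [measurable]: "(\<lambda>(z, u). k z u) \<in> borel_measurable (circle \<Otimes>\<^sub>M circle)"
    unfolding k_def by measurable
  have ksym: "k z u = k u z" for z u by (auto simp: k_def)
  have "(\<integral>\<^sup>+z. ennpowr (ennreal (norm (cell_avg n f z))) q \<partial>circle)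
    \<le> (\<integral>\<^sup>+z. ennreal (2 powr q * 1 powr (q - 1)) * (\<integral>\<^sup>+u. ennpowr (ennreal (norm (f u))) q * k z u \<partial>circle) \<partial>circle)"
  proof (rule nn_integral_mono)
    fix z assume z: "z \<in> space circle"
    have "ennreal (norm (cell_avg n f z)) = ennreal (1 / cell_length n) * ennreal (norm (LINT u|circle. indicator (cell n (cell_index n z)) u *\<^sub>R f u))"
      by (simp add: cell_avg_def divide_inverse flip: ennreal_mult)
    also have "\<dots> \<le> ennreal (1 / cell_length n) * (\<integral>\<^sup>+u. ennreal (norm (indicator (cell n (cell_index n z)) u *\<^sub>R f u)) \<partial>circle)"
    proof (intro mult_left_mono)
      show "ennreal (norm (LINT u|circle. indicator (cell n (cell_index n z)) u *\<^sub>R f u)) \<le> (\<integral>\<^sup>+u. ennreal (norm (indicator (cell n (cell_index n z)) u *\<^sub>R f u)) \<partial>circle)"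
      proof (cases "integrable circle (\<lambda>u. indicator (cell n (cell_index n z)) u *\<^sub>R f u)")
        case True
        then show ?thesis by (rule integral_norm_bound_ennreal)
      qed (simp add: not_integrable_integral_eq)
    qed simp
    also have "\<dots> = (\<integral>\<^sup>+u. ennreal (norm (f u)) * k z u \<partial>circle)"
      by (subst nn_integral_cmult[symmetric])
         (auto intro!: nn_integral_cong simp: k_def indicator_cell_eq mult.commute)
    finally have "ennpowr (ennreal (norm (cell_avg n f z))) q \<le> ennpowr (\<integral>\<^sup>+u. ennreal (norm (f u)) * k z u \<partial>circle) q"
      using q by (intro ennpowr_mono) auto
    also have "\<dots> \<le> ennreal (2 powr q * 1 powr (q - 1)) * (\<integral>\<^sup>+u. ennpowr (ennreal (norm (f u))) q * k z u \<partial>circle)"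
      using q k1[OF z] z by (intro nn_integral_ennpowr_le) auto
    finally show "ennpowr (ennreal (norm (cell_avg n f z))) q \<le> \<dots>" .
  qed
  also have "\<dots> = ennreal (2 powr q) * (\<integral>\<^sup>+z. (\<integral>\<^sup>+u. ennpowr (ennreal (norm (f u))) q * k z u \<partial>circle) \<partial>circle)"
    by (simp add: nn_integral_cmult)
  also have "(\<integral>\<^sup>+z. (\<integral>\<^sup>+u. ennpowr (ennreal (norm (f u))) q * k z u \<partial>circle) \<partial>circle)
    = (\<integral>\<^sup>+u. (\<integral>\<^sup>+z. ennpowr (ennreal (norm (f u))) q * k z u \<partial>circle) \<partial>circle)"
    by (rule P.Fubini') simp
  also have "\<dots> = (\<integral>\<^sup>+u. ennpowr (ennreal (norm (f u))) q \<partial>circle)"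
  proof (rule nn_integral_cong)
    fix u assume u: "u \<in> space circle"
    have "(\<integral>\<^sup>+z. k z u \<partial>circle) = 1"
      using k1[OF u] by (subst ksym)
    then show "(\<integral>\<^sup>+z. ennpowr (ennreal (norm (f u))) q * k z u \<partial>circle) = ennpowr (ennreal (norm (f u))) q"
      using u by (simp add: nn_integral_cmult)
  qed
  finally show ?thesis .
qed

text \<open>Averaging is self-adjoint, so weak convergence of the averages only needs the pointwise
  convergence of the averages of the bounded test function.\<close>

lemma cell_avg_weak_tendsto:
  assumes f: "integrable circle f" and [measurable]: "g \<in> borel_measurable circle"
    and B: "\<And>z. z \<in> space circle \<Longrightarrow> norm (g z) \<le> B"
    and cont: "AE z in circle. \<forall>e>0. \<exists>d>0. \<forall>u\<in>space circle. dist u z < d \<longrightarrow> norm (g u - g z) < e"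
  shows "(\<lambda>n. LINT z|circle. cell_avg n f z * g z) \<longlonglongrightarrow> (LINT z|circle. f z * g z)"
proof -
  have [measurable]: "f \<in> borel_measurable circle" using f by auto
  have gint: "integrable circle g"
    by (rule circle.integrable_const_bound[where B = B]) (auto intro!: AE_I2 B)
  have swap: "(LINT z|circle. cell_avg n f z * g z) = (LINT z|circle. f z * cell_avg n g z)" for n
  proof -
    define k where "k z u = (if cell_index n u = cell_index n z then 1 / cell_length n else 0)" for z u :: complex
    have avg: "cell_avg n h z = (LINT u|circle. k z u *\<^sub>R h u)" for h z
    proof -
      have "(LINT u|circle. k z u *\<^sub>R h u) = (LINT u|circle. (1 / cell_length n) *\<^sub>R (indicator (cell n (cell_index n z)) u *\<^sub>R h u))"
        by (intro Bochner_Integration.integral_cong) (auto simp: k_def indicator_cell_eq)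
      then show ?thesis
        by (simp add: cell_avg_def divide_inverse del: scaleR_scaleR)
    qed
    have [measurable]: "(\<lambda>(z, u). k z u) \<in> borel_measurable (circle \<Otimes>\<^sub>M circle)"
      unfolding k_def by measurable
    interpret P: pair_sigma_finite circle circle ..
    have int: "integrable (circle \<Otimes>\<^sub>M circle) (\<lambda>(z, u). k z u *\<^sub>R (f u * g z))"
    proof (rule Bochner_Integration.integrable_bound)
      show "integrable (circle \<Otimes>\<^sub>M circle) (\<lambda>(z, u). (1 / cell_length n) *\<^sub>R (norm (f u) * norm (g z)))"
      proof (rule P.Fubini_integrable)
        show "integrable circle (\<lambda>x. LINT y|circle. norm (case (x, y) of (z, u) \<Rightarrow> (1 / cell_length n) *\<^sub>R (norm (f u) * norm (g z))))"
          using gint by (simp add: abs_mult)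
      qed (use f in auto)
      show "AE x in circle \<Otimes>\<^sub>M circle. norm (case x of (z, u) \<Rightarrow> k z u *\<^sub>R (f u * g z))
        \<le> norm (case x of (z, u) \<Rightarrow> (1 / cell_length n) *\<^sub>R (norm (f u) * norm (g z)))"
        by (auto simp: k_def norm_mult abs_mult)
    qed measurable
    have "(LINT z|circle. cell_avg n f z * g z) = (LINT z|circle. (LINT u|circle. k z u *\<^sub>R (f u * g z)))"
      by (simp add: avg flip: integral_mult_left_zero)
    also have "\<dots> = (LINT u|circle. (LINT z|circle. k z u *\<^sub>R (f u * g z)))"
      by (rule P.Fubini_integral[OF int, symmetric])
    also have "\<dots> = (LINT u|circle. f u * (LINT z|circle. k u z *\<^sub>R g z))"
      by (simp add: k_def eq_commute flip: integral_mult_right_zero)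
    finally show ?thesis by (simp add: avg)
  qed
  have conv: "AE z in circle. (\<lambda>n. cell_avg n g z) \<longlonglongrightarrow> g z"
    using cont AE_space
  proof eventually_elim
    case (elim z)
    show ?case
    proof (rule LIMSEQ_I)
      fix e :: real assume e: "e > 0"
      then obtain d where d: "d > 0" "\<And>u. u \<in> space circle \<Longrightarrow> dist u z < d \<Longrightarrow> norm (g u - g z) < e / 2"
        using elim by (meson half_gt_zero)
      have "eventually (\<lambda>n. cell_length n < d / 2) sequentially"
        using order_tendstoD(2)[OF cell_length_tendsto, of "d / 2"] d by simp
      then obtain n0 where n0: "\<And>n. n \<ge> n0 \<Longrightarrow> cell_length n < d / 2"
        by (auto simp: eventually_sequentially)
      show "\<exists>no. \<forall>n\<ge>no. norm (cell_avg n g z - g z) < e"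
      proof (intro exI allI impI)
        fix n assume "n \<ge> n0"
        define Q where "Q = cell n (cell_index n z)"
        have zQ: "z \<in> Q" using elim by (simp add: Q_def cell_def)
        have mQ: "measure circle Q = cell_length n"
          using emeasure_cell[OF cell_index_bounds, of n z] by (simp add: Q_def measure_def less_imp_le)
        have [measurable]: "Q \<in> sets circle" by (simp add: Q_def)
        have iQ: "integrable circle (\<lambda>u. indicator Q u *\<^sub>R g u)"
          using gint by (intro integrable_mult_indicator) auto
        have iQ': "integrable circle (\<lambda>u. indicator Q u *\<^sub>R g z)"
          by (intro integrable_mult_indicator) auto
        have "(LINT u|circle. indicator Q u *\<^sub>R g z) = cell_length n *\<^sub>R g z"
          using mQ by (subst integral_scaleR_left) (auto simp: less_top[symmetric])
        then have "cell_avg n g z - g z = ((LINT u|circle. indicator Q u *\<^sub>R g u) - (LINT u|circle. indicator Q u *\<^sub>R g z)) /\<^sub>R cell_length n"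
          using less_imp_neq[OF cell_length_pos[of n]] by (simp add: cell_avg_def Q_def scaleR_diff_right)
        also have "\<dots> = (LINT u|circle. indicator Q u *\<^sub>R (g u - g z)) /\<^sub>R cell_length n"
          using iQ iQ' by (simp add: scaleR_diff_right)
        finally have *: "norm (cell_avg n g z - g z) = norm (LINT u|circle. indicator Q u *\<^sub>R (g u - g z)) / cell_length n"
          by (simp add: divide_inverse mult.commute less_imp_le)
        have "norm (LINT u|circle. indicator Q u *\<^sub>R (g u - g z)) \<le> (LINT u|circle. indicator Q u * (e / 2))"
        proof (rule norm_integral_le_integral)
          show "integrable circle (\<lambda>u. indicator Q u *\<^sub>R (g u - g z))"
            using iQ iQ' by (simp add: scaleR_diff_right)
          show "integrable circle (\<lambda>u. indicator Q u * (e / 2))"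
            by (intro integrable_mult_left) (auto simp: less_top[symmetric])
          fix u assume u: "u \<in> space circle"
          have "dist u z < d" if "u \<in> Q"
            using that cell_subset_carc[OF zQ[unfolded Q_def]] n0[OF \<open>n \<ge> n0\<close>] by (auto simp: Q_def carc_def)
          then show "norm (indicator Q u *\<^sub>R (g u - g z)) \<le> indicator Q u * (e / 2)"
            using d(2)[OF u] by (auto simp: indicator_def less_imp_le)
        qed
        also have "\<dots> = cell_length n * (e / 2)" using mQ by simp
        finally have "norm (cell_avg n g z - g z) \<le> e / 2"
          by (simp add: * divide_le_eq mult.commute)
        then show "norm (cell_avg n g z - g z) < e" using e by simp
      qed
    qed
  qed
  have bound: "norm (cell_avg n g z) \<le> B" if "z \<in> space circle" for n z
  proof -
    define Q where "Q = cell n (cell_index n z)"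
    have [measurable]: "Q \<in> sets circle" by (simp add: Q_def)
    have mQ: "measure circle Q = cell_length n"
      using emeasure_cell[OF cell_index_bounds, of n z] by (simp add: Q_def measure_def less_imp_le)
    have "norm (LINT u|circle. indicator Q u *\<^sub>R g u) \<le> (LINT u|circle. indicator Q u * B)"
    proof (rule norm_integral_le_integral)
      show "integrable circle (\<lambda>u. indicator Q u * B)"
        by (intro integrable_mult_left) (auto simp: less_top[symmetric])
      show "integrable circle (\<lambda>u. indicator Q u *\<^sub>R g u)"
        using gint by (intro integrable_mult_indicator) auto
    qed (use B in \<open>auto simp: indicator_def\<close>)
    also have "\<dots> = cell_length n * B" using mQ by simp
    finally have "norm (LINT u|circle. indicator Q u *\<^sub>R g u) / cell_length n \<le> B"
      by (simp add: divide_le_eq mult.commute)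
    then show ?thesis by (simp add: cell_avg_def Q_def divide_inverse mult.commute less_imp_le)
  qed
  have "(\<lambda>n. LINT z|circle. f z * cell_avg n g z) \<longlonglongrightarrow> (LINT z|circle. f z * g z)"
  proof (rule integral_dominated_convergence[where w = "\<lambda>z. norm (f z) * B"])
    show "AE z in circle. (\<lambda>n. f z * cell_avg n g z) \<longlonglongrightarrow> f z * g z"
      using conv by eventually_elim (intro tendsto_intros)
  qed (use f bound in \<open>auto simp: norm_mult intro!: mult_left_mono\<close>)
  then show ?thesis by (simp add: swap)
qed

section \<open>Truncated and principal value integrals\<close>

definition cker :: "complex \<Rightarrow> complex \<Rightarrow> complex" where
  "cker z w = 1 / (z / w - 1)"

lemma cker_measurable [measurable (raw)]:
  assumes [measurable]: "f \<in> borel_measurable M" "g \<in> borel_measurable M"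
  shows "(\<lambda>x. cker (f x) (g x)) \<in> borel_measurable M"
  unfolding cker_def by measurable

text \<open>On the diagonal both sides are divisions by zero and hence 0, and likewise in
  \<open>norm_cker\<close>; the kernel vanishes there by convention.\<close>

lemma cker_eq: "w \<noteq> 0 \<Longrightarrow> cker z w = w / (z - w)"
  by (cases "z = w") (auto simp: cker_def field_simps)

lemma norm_cker: "norm w = 1 \<Longrightarrow> norm (cker z w) = 1 / dist w z"
  using cker_eq[of w z] by (cases "w = 0") (auto simp: norm_divide dist_norm norm_minus_commute)

text \<open>Over a common denominator the difference gains a factor \<open>dist v v'\<close> and one
  more power of decay; this smoothness controls far integrals.\<close>

lemma cker_diff:
  assumes "norm w = 1" "w \<noteq> v" "w \<noteq> v'"
  shows "norm (cker v w - cker v' w) = dist v v' / (dist w v * dist w v')"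
proof -
  have "w \<noteq> 0" using assms by auto
  then have "cker v w - cker v' w = w * (v' - v) / ((v - w) * (v' - w))"
    using assms by (simp add: cker_eq field_simps)
  then show ?thesis
    using assms by (simp add: norm_divide norm_mult dist_norm norm_minus_commute)
qed

definition far :: "complex \<Rightarrow> real \<Rightarrow> (complex \<Rightarrow> complex) \<Rightarrow> complex \<Rightarrow> complex" where
  "far c r f w = (if dist w c > r then f w else 0)"

definition near :: "complex \<Rightarrow> real \<Rightarrow> (complex \<Rightarrow> complex) \<Rightarrow> complex \<Rightarrow> complex" where
  "near c r f w = (if dist w c \<le> r then f w else 0)"

lemma near_add_far: "near c r f w + far c r f w = f w"
  by (simp add: near_def far_def)

lemma far_measurable [measurable]:
  assumes [measurable]: "f \<in> borel_measurable circle"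
  shows "far c r f \<in> borel_measurable circle"
  unfolding far_def[abs_def] by measurable

lemma near_measurable [measurable]:
  assumes [measurable]: "f \<in> borel_measurable circle"
  shows "near c r f \<in> borel_measurable circle"
  unfolding near_def[abs_def] by measurable

lemma integrable_restrict_circle:
  fixes f :: "complex \<Rightarrow> complex"
  assumes f: "integrable circle f" and [measurable]: "Measurable.pred circle P"
  shows "integrable circle (\<lambda>w. if P w then f w else 0)"
proof (rule Bochner_Integration.integrable_bound[OF f])
  have [measurable]: "f \<in> borel_measurable circle" using f by auto
  show "(\<lambda>w. if P w then f w else 0) \<in> borel_measurable circle" by measurable
qed auto

lemma integrable_far: "integrable circle f \<Longrightarrow> integrable circle (far c r f)"
  unfolding far_def by (rule integrable_restrict_circle) auto

lemma integrable_near: "integrable circle f \<Longrightarrow> integrable circle (near c r f)"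
  unfolding near_def by (rule integrable_restrict_circle) auto

lemma norm_integral_le_nn_integral: "ennreal (norm (integral\<^sup>L M f)) \<le> (\<integral>\<^sup>+x. ennreal (norm (f x)) \<partial>M)"
  by (cases "integrable M f") (auto simp: integral_norm_bound_ennreal not_integrable_integral_eq)

text \<open>The map is the reflection of the circle that fixes \<open>z\<close>, a conjugation
  followed by a rotation.\<close>

lemma distr_circle_reflect:
  assumes z: "norm z = 1"
  shows "distr circle circle (\<lambda>w. z\<^sup>2 * cnj w) = circle"
proof (rule measure_eqI)
  have [measurable]: "cnj \<in> circle \<rightarrow>\<^sub>M circle"
    by (intro measurable_to_circle borel_measurable_circleI borel_measurable_continuous_onI continuous_intros)
       (auto simp: space_circle)
  have [measurable]: "(\<lambda>w. z\<^sup>2 * w) \<in> circle \<rightarrow>\<^sub>M circle"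
    using z by (intro measurable_to_circle) (auto simp: norm_mult norm_power space_circle)
  have [measurable]: "(\<lambda>w. z\<^sup>2 * cnj w) \<in> circle \<rightarrow>\<^sub>M circle" by measurable
  fix A assume "A \<in> sets (distr circle circle (\<lambda>w. z\<^sup>2 * cnj w))"
  then have [measurable]: "A \<in> sets circle" by simp
  have "emeasure circle A = (\<integral>\<^sup>+w. indicator A w \<partial>circle)" by simp
  also have "\<dots> = (\<integral>\<^sup>+w. indicator A (z\<^sup>2 * w) \<partial>circle)"
    by (rule nn_integral_circle_rotate) (use z in \<open>auto simp: norm_power\<close>)
  also have "\<dots> = (\<integral>\<^sup>+w. indicator A (z\<^sup>2 * cnj w) \<partial>circle)"
    by (rule nn_integral_circle_cnj) measurable
  also have "\<dots> = (\<integral>\<^sup>+w. indicator A w \<partial>distr circle circle (\<lambda>w. z\<^sup>2 * cnj w))"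
    by (rule nn_integral_distr[symmetric]) auto
  finally show "emeasure (distr circle circle (\<lambda>w. z\<^sup>2 * cnj w)) A = emeasure circle A" by simp
qed simp

text \<open>The reflection of the circle about \<open>z\<close> exchanges the two values of the kernel with sum \<open>-1\<close>.\<close>

lemma integral_cker_truncated:
  assumes z: "norm z = 1" and e: "e > 0"
  shows "(LINT w|circle. indicator {w. dist w z > e} w *\<^sub>R cker z w)
    = (LINT w|circle. indicator {w. dist w z > e} w *\<^sub>R (- 1 / 2))"
proof -
  have [measurable]: "(\<lambda>w. z\<^sup>2 * cnj w) \<in> circle \<rightarrow>\<^sub>M circle"
    using z by (intro measurable_to_circle borel_measurable_circleI borel_measurable_continuous_onI continuous_intros)
      (auto simp: norm_mult norm_power space_circle)
  define h where "h w = indicator {w. dist w z > e} w *\<^sub>R cker z w" for w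
  have [measurable]: "h \<in> borel_measurable circle" unfolding h_def by measurable
  have hint: "integrable circle h"
  proof (rule circle.integrable_const_bound[where B = "1 / e"])
    show "AE w in circle. norm (h w) \<le> 1 / e"
      using e by (intro AE_I2) (auto simp: h_def indicator_def space_circle norm_cker intro!: divide_left_mono mult_pos_pos)
  qed simp
  have "integral\<^sup>L circle h = integral\<^sup>L (distr circle circle (\<lambda>w. z\<^sup>2 * cnj w)) h"
    by (simp add: distr_circle_reflect[OF z])
  also have "\<dots> = (LINT w|circle. h (z\<^sup>2 * cnj w))"
    by (rule integral_distr) auto
  finally have refl: "integral\<^sup>L circle h = (LINT w|circle. h (z\<^sup>2 * cnj w))" .
  have hint': "integrable circle (\<lambda>w. h (z\<^sup>2 * cnj w))"
    using hint distr_circle_reflect[OF z] by (subst integrable_distr_eq[symmetric, where N = circle]) auto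
  have sum: "h w + h (z\<^sup>2 * cnj w) = indicator {w. dist w z > e} w *\<^sub>R (- 1)" if w: "w \<in> space circle" for w
  proof -
    have w1: "norm w = 1" "w \<noteq> 0" using w by (auto simp: space_circle)
    have z0: "z \<noteq> 0" using z by auto
    have "z\<^sup>2 * cnj w - z = z * cnj w * (z - w)"
      using w1 by (simp add: cnj_eq_inverse_circle power2_eq_square field_simps)
    then have d: "dist (z\<^sup>2 * cnj w) z = dist w z"
      using z w1 by (simp add: dist_norm norm_mult norm_minus_commute)
    have "cker z w + cker z (z\<^sup>2 * cnj w) = -1" if "w \<noteq> z"
    proof -
      have "cker z (z\<^sup>2 * cnj w) = 1 / (w / z - 1)"
        using w1 z0 by (simp add: cker_def cnj_eq_inverse_circle power2_eq_square)
      also have "\<dots> = z / (w - z)" using z0 that by (simp add: field_simps)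
      finally show ?thesis
        using that w1 by (simp add: cker_eq field_simps)
    qed
    then show ?thesis
      using e d by (cases "w = z") (auto simp: h_def d indicator_def)
  qed
  have "2 * integral\<^sup>L circle h = (LINT w|circle. h w + h (z\<^sup>2 * cnj w))"
    using hint hint' refl by simp
  also have "\<dots> = (LINT w|circle. indicator {w. dist w z > e} w *\<^sub>R (- 1))"
    by (intro Bochner_Integration.integral_cong sum) auto
  also have "\<dots> = 2 * (LINT w|circle. indicator {w. dist w z > e} w *\<^sub>R (- 1 / 2))"
    by (subst integral_mult_right_zero[symmetric]) (auto intro!: Bochner_Integration.integral_cong)
  finally show ?thesis by (simp add: h_def[abs_def])
qed

text \<open>For such functions the principal values exist almost everywhere, so that no general existence theorem
  is needed; averages over dyadic cells are of this kind.\<close>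

definition nice :: "(complex \<Rightarrow> complex) \<Rightarrow> bool" where
  "nice f \<longleftrightarrow> f \<in> borel_measurable circle \<and> (\<exists>B. \<forall>z\<in>space circle. norm (f z) \<le> B)
    \<and> (AE z in circle. \<exists>d>0. \<forall>u\<in>space circle. dist u z < d \<longrightarrow> f u = f z)"

lemma nice_measurable: "nice f \<Longrightarrow> f \<in> borel_measurable circle"
  by (simp add: nice_def)

lemma nice_integrable:
  assumes "nice f" shows "integrable circle f"
proof -
  obtain B where "\<forall>z\<in>space circle. norm (f z) \<le> B" using assms by (auto simp: nice_def)
  then show ?thesis
    by (intro circle.integrable_const_bound[where B = B] nice_measurable assms) auto
qed

text \<open>Cutting at distance \<open>r\<close> from \<open>c\<close> creates new jumps only where
  \<open>dist u c = r\<close>, a null set.\<close>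

lemma nice_near:
  assumes f: "nice f" and c: "norm c = 1"
  shows "nice (near c r f)"
proof -
  obtain B where B: "\<forall>z\<in>space circle. norm (f z) \<le> B" using f by (auto simp: nice_def)
  have "AE z in circle. \<exists>d>0. \<forall>u\<in>space circle. dist u z < d \<longrightarrow> near c r f u = near c r f z"
    using AE_circle_dist_neq[OF c, of r] f[unfolded nice_def, THEN conjunct2, THEN conjunct2]
  proof eventually_elim
    case (elim z)
    then obtain d where d: "d > 0" "\<And>u. u \<in> space circle \<Longrightarrow> dist u z < d \<Longrightarrow> f u = f z" by blast
    show ?case
    proof (intro exI conjI ballI impI)
      show "min d \<bar>dist z c - r\<bar> > 0" using d elim by auto
      fix u assume u: "u \<in> space circle" "dist u z < min d \<bar>dist z c - r\<bar>"
      then have "f u = f z" using d by auto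
      moreover have "dist u c \<le> r \<longleftrightarrow> dist z c \<le> r"
        using u dist_triangle[of u c z] dist_triangle[of z c u] by (auto simp: dist_commute)
      ultimately show "near c r f u = near c r f z" by (simp add: near_def)
    qed
  qed
  moreover have "\<forall>z\<in>space circle. norm (near c r f z) \<le> max B 0"
    using B by (auto simp: near_def)
  ultimately show ?thesis
    using nice_measurable[OF f] by (auto simp: nice_def)
qed

lemma nice_cell_avg: "nice (cell_avg n f)"
proof -
  have "AE z in circle. \<exists>d>0. \<forall>u\<in>space circle. dist u z < d \<longrightarrow> cell_avg n f u = cell_avg n f z"
    using cell_locally_constant[of n] by eventually_elim (meson cell_avg_cong)
  then show ?thesis
    using cell_avg_bounded[of n f] by (auto simp: nice_def)
qed

text \<open>Hoelder on an arc, through \<open>le_add_ennpowr\<close> at level \<open>s\<close>: the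
  constant term gives \<open>7 * R * s\<close>, the power term \<open>2 * R * s\<close>.\<close>

lemma hlmax_powr_bound:
  assumes [measurable]: "F \<in> borel_measurable circle" and q: "1 \<le> q" and s: "s > 0" and R: "R > 0"
    and z: "norm z = 1" and le: "hlmax (\<lambda>u. ennpowr (F u) q) z \<le> ennreal (s powr q)"
  shows "(\<integral>\<^sup>+u\<in>carc z R. F u \<partial>circle) \<le> ennreal (9 * R * s)"
proof -
  have "(\<integral>\<^sup>+u\<in>carc z R. F u \<partial>circle)
    \<le> (\<integral>\<^sup>+u. ennreal s * indicator (carc z R) u + ennreal (s powr (1 - q)) * (ennpowr (F u) q * indicator (carc z R) u) \<partial>circle)"
    using le_add_ennpowr[OF q s] by (intro nn_integral_mono) (auto simp: indicator_def)
  also have "\<dots> = ennreal s * emeasure circle (carc z R) + ennreal (s powr (1 - q)) * (\<integral>\<^sup>+u\<in>carc z R. ennpowr (F u) q \<partial>circle)"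
    by (simp add: nn_integral_add nn_integral_cmult)
  also have "\<dots> \<le> ennreal s * ennreal (7 * R) + ennreal (s powr (1 - q)) * (ennreal (2 * R) * ennreal (s powr q))"
    using emeasure_carc_le[OF z, of R] R
    by (intro add_mono mult_left_mono order_trans[OF carc_integral_le_hlmax[OF R] mult_left_mono[OF le]]) auto
  also have "\<dots> = ennreal (s * (7 * R) + s powr (1 - q) * (2 * R * s powr q))"
    using s R by (simp add: ennreal_mult ennreal_plus)
  also have "s powr (1 - q) * (2 * R * s powr q) = 2 * R * s"
    using s by (simp add: powr_diff)
  finally show ?thesis by (simp add: algebra_simps)
qed

lemma hlmax_le_of_powr:
  assumes [measurable]: "F \<in> borel_measurable circle" and "1 \<le> q" "s > 0"
    and "norm z = 1" "hlmax (\<lambda>u. ennpowr (F u) q) z \<le> ennreal (s powr q)"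
  shows "hlmax F z \<le> ennreal (9 * s)"
  unfolding hlmax_def
proof (rule SUP_least)
  fix k :: int
  have "(\<integral>\<^sup>+u\<in>carc z (2 powi k). F u \<partial>circle) \<le> ennreal (9 * 2 powi k * s)"
    using assms by (intro hlmax_powr_bound[of F q]) auto
  also have "\<dots> = ennreal (2 powi k) * ennreal (9 * s)"
    using assms by (simp flip: ennreal_mult add: mult_ac)
  finally show "(\<integral>\<^sup>+u\<in>carc z (2 powi k). F u \<partial>circle) / ennreal (2 powi k) \<le> ennreal (9 * s)"
    by (intro divide_le_posI_ennreal) auto
qed

text \<open>An abstraction of the reciprocals of finite Blaschke products. The quantitative bounds
  rest on the modulus of \<open>m N\<close> being 1 and are uniform in \<open>N\<close>; the
  Lipschitz constants, which may grow with \<open>N\<close>, serve for the existence of principal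
  values and for continuity.\<close>

locale multiplier_family =
  fixes m :: "nat \<Rightarrow> complex \<Rightarrow> complex"
  assumes m_measurable [measurable]: "\<And>N. m N \<in> borel_measurable circle"
    and norm_m: "\<And>N z. norm z = 1 \<Longrightarrow> norm (m N z) = 1"
    and lipschitz_m: "\<And>N. \<exists>L. \<forall>w z. norm w = 1 \<longrightarrow> norm z = 1 \<longrightarrow> norm (m N w - m N z) \<le> L * dist w z"
begin

text \<open>No principal value is taken: the integral converges absolutely when \<open>f\<close> is
  integrable and vanishes near \<open>z\<close>.\<close>

definition S :: "nat \<Rightarrow> (complex \<Rightarrow> complex) \<Rightarrow> complex \<Rightarrow> complex" where
  "S N f z = (LINT w|circle. f w * m N w * cker z w)"

definition has_pv :: "nat \<Rightarrow> (complex \<Rightarrow> complex) \<Rightarrow> complex \<Rightarrow> bool" where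
  "has_pv N f z \<longleftrightarrow> (\<exists>l. ((\<lambda>e. S N (far z e f) z) \<longlongrightarrow> l) (at_right 0))"

definition PV :: "nat \<Rightarrow> (complex \<Rightarrow> complex) \<Rightarrow> complex \<Rightarrow> complex" where
  "PV N f z = pv_integral (\<lambda>w. f w * m N w * cker z w) z"

definition TM :: "(complex \<Rightarrow> complex) \<Rightarrow> complex \<Rightarrow> ennreal" where
  "TM f z = (SUP N\<in>{1..}. ennreal (norm (PV N f z)))"

text \<open>Integrals of \<open>f\<close> away from a cell only, so that no principal value is involved. On each cell of
  generation \<open>n\<close> the value is constant, and the level sets of the supremum over \<open>n\<close> are unions of
  cells.\<close>

definition tsharp_cell :: "nat \<Rightarrow> (complex \<Rightarrow> complex) \<Rightarrow> int \<Rightarrow> ennreal" where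
  "tsharp_cell n f k = (SUP N\<in>{1..}. SUP v\<in>cell n k.
     ennreal (norm (S N (far (cell_end n k) (2 * cell_length n) f) v)))"

definition tsharp :: "(complex \<Rightarrow> complex) \<Rightarrow> complex \<Rightarrow> ennreal" where
  "tsharp f z = (SUP n. tsharp_cell n f (cell_index n z))"

lemma PV_eq:
  assumes [measurable]: "f \<in> borel_measurable circle"
  shows "PV N f z = (if has_pv N f z then Lim (at_right 0) (\<lambda>e. S N (far z e f) z) else 0)"
proof -
  have "(\<lambda>e. LINT u|circle. indicator {u. dist u z > e} u *\<^sub>R (f u * m N u * cker z u)) = (\<lambda>e. S N (far z e f) z)"
    by (auto simp: S_def far_def indicator_def fun_eq_iff intro!: Bochner_Integration.integral_cong)
  moreover have "(\<lambda>w. f w * m N w * cker z w) \<in> borel_measurable circle" by measurable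
  ultimately show ?thesis
    unfolding PV_def has_pv_def by (subst pv_integral_circle) auto
qed

lemma PV_tendsto:
  assumes "f \<in> borel_measurable circle" "((\<lambda>e. S N (far z e f) z) \<longlongrightarrow> l) (at_right 0)"
  shows "PV N f z = l" "has_pv N f z"
  using assms tendsto_Lim[OF trivial_limit_at_right_real assms(2)] by (auto simp: PV_eq has_pv_def)

lemma tsharp_measurable [measurable]: "tsharp f \<in> borel_measurable circle"
proof -
  have "(\<lambda>z. tsharp_cell n f (cell_index n z)) \<in> borel_measurable circle" for n
    by (rule measurable_compose[OF cell_index_measurable]) simp
  then show ?thesis unfolding tsharp_def by measurable
qed

lemma S_integrable:
  assumes f: "integrable circle f" and r: "r > 0"
    and z: "\<And>w. w \<in> space circle \<Longrightarrow> dist w z \<le> r \<Longrightarrow> f w = 0"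
  shows "integrable circle (\<lambda>w. f w * m N w * cker z w)"
proof (rule Bochner_Integration.integrable_bound)
  have [measurable]: "f \<in> borel_measurable circle" using f by auto
  show "(\<lambda>w. f w * m N w * cker z w) \<in> borel_measurable circle" by measurable
  show "integrable circle (\<lambda>w. (1 / r) *\<^sub>R f w)" using f by auto
  show "AE w in circle. norm (f w * m N w * cker z w) \<le> norm ((1 / r) *\<^sub>R f w)"
  proof (rule AE_I2)
    fix w assume w: "w \<in> space circle"
    show "norm (f w * m N w * cker z w) \<le> norm ((1 / r) *\<^sub>R f w)"
    proof (cases "dist w z \<le> r")
      case False
      then have "1 / dist w z \<le> 1 / r" using r by (intro divide_left_mono mult_pos_pos) auto
      then have "norm (f w) * (1 / dist w z) \<le> norm (f w) * (1 / r)" by (rule mult_left_mono) simp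
      then show ?thesis using w r by (simp add: norm_mult norm_m norm_cker space_circle)
    qed (use z w in auto)
  qed
qed

lemma S_add:
  assumes "integrable circle (\<lambda>w. f w * m N w * cker z w)" "integrable circle (\<lambda>w. g w * m N w * cker z w)"
  shows "S N (\<lambda>w. f w + g w) z = S N f z + S N g z"
  unfolding S_def by (simp add: distrib_right assms)

lemma norm_S_le:
  "ennreal (norm (S N f z)) \<le> (\<integral>\<^sup>+w. ennreal (norm (f w)) * ennreal (1 / dist w z) \<partial>circle)"
proof -
  have "ennreal (norm (S N f z)) \<le> (\<integral>\<^sup>+w. ennreal (norm (f w * m N w * cker z w)) \<partial>circle)"
    unfolding S_def by (rule norm_integral_le_nn_integral)
  also have "\<dots> = (\<integral>\<^sup>+w. ennreal (norm (f w)) * ennreal (1 / dist w z) \<partial>circle)"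
    by (intro nn_integral_cong) (simp add: norm_mult norm_m norm_cker space_circle flip: ennreal_mult)
  finally show ?thesis .
qed

text \<open>For \<open>e < r\<close> the truncated integrals of \<open>f\<close> and of the sum
  differ by the constant \<open>S N g z\<close>, so the existence of the principal value is decided
  near \<open>z\<close>. This is the additivity that the default value 0 leaves intact.\<close>

lemma has_pv_add_far:
  assumes f: "integrable circle f" "integrable circle g" and r: "r > 0"
    and g0: "\<And>w. w \<in> space circle \<Longrightarrow> dist w z \<le> r \<Longrightarrow> g w = 0"
  shows "has_pv N (\<lambda>w. f w + g w) z \<longleftrightarrow> has_pv N f z"
    and "has_pv N f z \<Longrightarrow> PV N (\<lambda>w. f w + g w) z = PV N f z + S N g z"
proof -
  have [measurable]: "f \<in> borel_measurable circle" "g \<in> borel_measurable circle" using f by auto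
  have eq: "eventually (\<lambda>e. S N (far z e (\<lambda>w. f w + g w)) z = S N (far z e f) z + S N g z) (at_right 0)"
    unfolding eventually_at_right_field
  proof (intro exI conjI allI impI)
    fix e :: real assume e: "0 < e" "e < r"
    have "S N (far z e (\<lambda>w. f w + g w)) z = S N (\<lambda>w. far z e f w + g w) z"
      unfolding S_def using e g0 by (intro Bochner_Integration.integral_cong) (auto simp: far_def)
    also have "\<dots> = S N (far z e f) z + S N g z"
    proof (rule S_add)
      show "integrable circle (\<lambda>w. far z e f w * m N w * cker z w)"
        using e f by (intro S_integrable[where r = e] integrable_far) (auto simp: far_def)
      show "integrable circle (\<lambda>w. g w * m N w * cker z w)"
        by (rule S_integrable[OF f(2) r g0])
    qed
    finally show "S N (far z e (\<lambda>w. f w + g w)) z = S N (far z e f) z + S N g z" .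
  qed (use r in simp)
  have lim: "((\<lambda>e. S N (far z e (\<lambda>w. f w + g w)) z) \<longlongrightarrow> l) (at_right 0)
    \<longleftrightarrow> ((\<lambda>e. S N (far z e f) z) \<longlongrightarrow> l - S N g z) (at_right 0)" for l
  proof -
    have "((\<lambda>e. S N (far z e (\<lambda>w. f w + g w)) z) \<longlongrightarrow> l) (at_right 0)
      \<longleftrightarrow> ((\<lambda>e. S N (far z e f) z + S N g z) \<longlongrightarrow> (l - S N g z) + S N g z) (at_right 0)"
      using tendsto_cong[OF eq] by simp
    also have "\<dots> \<longleftrightarrow> ((\<lambda>e. S N (far z e f) z) \<longlongrightarrow> l - S N g z) (at_right 0)"
      by (rule tendsto_add_const_iff[of "S N g z", simplified add.commute])
    finally show ?thesis .
  qed
  show "has_pv N (\<lambda>w. f w + g w) z \<longleftrightarrow> has_pv N f z"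
    unfolding has_pv_def lim by (metis add_diff_cancel)
  assume "has_pv N f z"
  then obtain l where l: "((\<lambda>e. S N (far z e f) z) \<longlongrightarrow> l) (at_right 0)" by (auto simp: has_pv_def)
  then have "((\<lambda>e. S N (far z e (\<lambda>w. f w + g w)) z) \<longlongrightarrow> l + S N g z) (at_right 0)"
    unfolding lim by simp
  then show "PV N (\<lambda>w. f w + g w) z = PV N f z + S N g z"
    using PV_tendsto[of f N z l] PV_tendsto[of "\<lambda>w. f w + g w" N z "l + S N g z"] l by simp
qed

text \<open>Valid at every point: where the principal value of \<open>f\<close> does not exist, that
  of the sum does not exist either and is 0 by convention.\<close>

lemma norm_PV_add_far:
  assumes f: "integrable circle f" "integrable circle g" and r: "r > 0"
    and g0: "\<And>w. w \<in> space circle \<Longrightarrow> dist w z \<le> r \<Longrightarrow> g w = 0"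
  shows "norm (PV N (\<lambda>w. f w + g w) z) \<le> norm (PV N f z) + norm (S N g z)"
proof (cases "has_pv N f z")
  case True
  then show ?thesis using has_pv_add_far(2)[OF assms] by (simp add: norm_triangle_ineq)
next
  case False
  then have "PV N (\<lambda>w. f w + g w) z = 0"
    using has_pv_add_far(1)[OF assms] f by (subst PV_eq) auto
  then show ?thesis by simp
qed

lemma dist_far_cell:
  assumes "z \<in> cell n k" "dist w (cell_end n k) > 2 * cell_length n"
  shows "dist w z > cell_length n" "dist w (cell_end n k) \<le> 2 * dist w z" "2 * dist w z \<le> 3 * dist w (cell_end n k)"
  using assms dist_cell_end[OF assms(1)] dist_triangle[of w "cell_end n k" z] dist_triangle2[of w z "cell_end n k"]
  by (auto simp: dist_commute)

text \<open>With \<open>r = cell_length n\<close>, the truncation of \<open>PV\<close> at radius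
  \<open>r\<close> about \<open>z\<close> differs from the far integral of \<open>tsharp\<close>
  only on points at distance between \<open>r\<close> and \<open>3 * r\<close> from
  \<open>z\<close>. There the kernel is at most \<open>1 / r\<close>, which costs
  \<open>2 * 3 * r / r = 6\<close> maximal functions.\<close>

lemma TM_le_tsharp:
  assumes f: "integrable circle f" and z: "z \<in> space circle"
  shows "TM f z \<le> tsharp f z + 6 * hlmax (\<lambda>w. ennreal (norm (f w))) z"
  unfolding TM_def
proof (rule SUP_least)
  fix N :: nat assume N: "N \<in> {1..}"
  have [measurable]: "f \<in> borel_measurable circle" using f by auto
  define b where "b = tsharp f z + 6 * hlmax (\<lambda>w. ennreal (norm (f w))) z"
  have bound: "ennreal (norm (S N (far z (cell_length n) f) z)) \<le> b" for n
  proof -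
    define r where "r = cell_length n"
    have r: "r > 0" by (simp add: r_def)
    define k where "k = cell_index n z"
    define c where "c = cell_end n k"
    have zk: "z \<in> cell n k" using z by (simp add: k_def cell_def)
    define h where "h w = (if dist w z > r \<and> dist w c \<le> 2 * r then f w else 0)" for w
    have "integrable circle h" unfolding h_def by (rule integrable_restrict_circle[OF f]) measurable
    have "far z r f = (\<lambda>w. far c (2 * r) f w + h w)"
      using dist_far_cell[OF zk] by (auto simp: far_def h_def fun_eq_iff r_def c_def)
    then have "S N (far z r f) z = S N (\<lambda>w. far c (2 * r) f w + h w) z" by simp
    also have "\<dots> = S N (far c (2 * r) f) z + S N h z"
    proof (rule S_add)
      show "integrable circle (\<lambda>w. far c (2 * r) f w * m N w * cker z w)"
        using dist_far_cell[OF zk] r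
        by (intro S_integrable[where r = r] integrable_far f) (auto simp: far_def r_def c_def not_less[symmetric])
      show "integrable circle (\<lambda>w. h w * m N w * cker z w)"
        by (intro S_integrable[OF \<open>integrable circle h\<close> r]) (simp add: h_def)
    qed
    finally have "norm (S N (far z r f) z) \<le> norm (S N (far c (2 * r) f) z) + norm (S N h z)"
      by (simp add: norm_triangle_ineq)
    then have "ennreal (norm (S N (far z r f) z)) \<le> ennreal (norm (S N (far c (2 * r) f) z)) + ennreal (norm (S N h z))"
      by (simp flip: ennreal_plus)
    also have "ennreal (norm (S N (far c (2 * r) f) z)) \<le> tsharp f z"
    proof -
      have "ennreal (norm (S N (far c (2 * r) f) z)) \<le> tsharp_cell n f k"
        unfolding tsharp_cell_def r_def c_def using N zk by (intro SUP_upper2[of N] SUP_upper2[of z]) auto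
      also have "\<dots> \<le> tsharp f z" unfolding tsharp_def k_def by (rule SUP_upper) simp
      finally show ?thesis .
    qed
    also have "ennreal (norm (S N h z)) \<le> 6 * hlmax (\<lambda>w. ennreal (norm (f w))) z"
    proof -
      have "ennreal (norm (S N h z)) \<le> (\<integral>\<^sup>+w. ennreal (norm (h w)) * ennreal (1 / dist w z) \<partial>circle)"
        by (rule norm_S_le)
      also have "\<dots> \<le> (\<integral>\<^sup>+w. ennreal (1 / r) * (ennreal (norm (f w)) * indicator (carc z (3 * r)) w) \<partial>circle)"
      proof (rule nn_integral_mono)
        fix w assume w: "w \<in> space circle"
        show "ennreal (norm (h w)) * ennreal (1 / dist w z) \<le> ennreal (1 / r) * (ennreal (norm (f w)) * indicator (carc z (3 * r)) w)"
        proof (cases "dist w z > r \<and> dist w c \<le> 2 * r")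
          case True
          then have "dist w z \<le> 3 * r"
            using dist_cell_end[OF zk] dist_triangle2[of w z c] by (simp add: c_def r_def)
          moreover have "1 / dist w z \<le> 1 / r" using True r by (intro divide_left_mono mult_pos_pos) auto
          ultimately show ?thesis
            using True w by (auto simp: h_def indicator_carc mult.commute[of "ennreal (1 / r)"] intro!: mult_left_mono ennreal_leI)
        qed (auto simp: h_def)
      qed
      also have "\<dots> = ennreal (1 / r) * (\<integral>\<^sup>+w\<in>carc z (3 * r). ennreal (norm (f w)) \<partial>circle)"
        by (simp add: nn_integral_cmult)
      also have "\<dots> \<le> ennreal (1 / r) * (ennreal (2 * (3 * r)) * hlmax (\<lambda>w. ennreal (norm (f w))) z)"
        using r by (intro mult_left_mono carc_integral_le_hlmax) auto
      also have "\<dots> = 6 * hlmax (\<lambda>w. ennreal (norm (f w))) z"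
      proof -
        have "ennreal (1 / r) * ennreal (2 * (3 * r)) = ennreal 6"
          using r by (subst ennreal_mult[symmetric]) auto
        then show ?thesis by (simp only: mult.assoc[symmetric]) simp
      qed
      finally show ?thesis .
    qed
    finally show ?thesis by (simp add: b_def r_def add_mono)
  qed
  show "ennreal (norm (PV N f z)) \<le> tsharp f z + 6 * hlmax (\<lambda>w. ennreal (norm (f w))) z"
  proof (cases "has_pv N f z")
    case True
    then obtain l where l: "((\<lambda>e. S N (far z e f) z) \<longlongrightarrow> l) (at_right 0)" by (auto simp: has_pv_def)
    \<comment> \<open>An existing limit may be followed along the radii \<open>cell_length n\<close>
      alone.\<close>
    have "filterlim cell_length (at_right 0) sequentially"
      unfolding filterlim_at using cell_length_tendsto by auto
    from filterlim_compose[OF l this] have "(\<lambda>n. S N (far z (cell_length n) f) z) \<longlonglongrightarrow> l" .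
    then have "(\<lambda>n. ennreal (norm (S N (far z (cell_length n) f) z))) \<longlonglongrightarrow> ennreal (norm l)"
      by (intro tendsto_ennrealI tendsto_norm)
    then have "ennreal (norm l) \<le> b"
      by (rule LIMSEQ_le_const2) (use bound in auto)
    then show ?thesis using PV_tendsto[OF _ l] by (simp add: b_def)
  next
    case False
    then show ?thesis by (subst PV_eq) auto
  qed
qed

text \<open>Points of one cell are at most \<open>2 * r\<close> apart, so the kernels differ by at
  most \<open>2 * r / (D / 2)^2\<close>, where \<open>D\<close> is the distance of \<open>w\<close>
  from the cell end. As \<open>dist w z \<le> 3 / 2 * D\<close>, this is at most 18 times
  \<open>r / (dist w z)^2\<close>, and \<open>tail_integral_le_hlmax\<close> supplies the factor 8
  of 144.\<close>

lemma S_far_oscillation: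
  assumes f: "integrable circle f" and v: "z \<in> cell n k" "v \<in> cell n k" "v' \<in> cell n k"
  defines "g \<equiv> far (cell_end n k) (2 * cell_length n) f"
  shows "ennreal (norm (S N g v)) \<le> ennreal (norm (S N g v')) + 144 * hlmax (\<lambda>w. ennreal (norm (f w))) z"
proof -
  have [measurable]: "f \<in> borel_measurable circle" using f by auto
  define r where "r = cell_length n"
  have r: "r > 0" by (simp add: r_def)
  define c where "c = cell_end n k"
  have g: "g w = (if dist w c > 2 * r then f w else 0)" for w by (simp add: g_def far_def r_def c_def)
  have int: "integrable circle (\<lambda>w. g w * m N w * cker u w)" if "u \<in> cell n k" for u
    using dist_far_cell[OF that] r unfolding g_def
    by (intro S_integrable[where r = r] integrable_far f) (auto simp: far_def r_def not_less[symmetric])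
  have "S N g v - S N g v' = (LINT w|circle. g w * m N w * (cker v w - cker v' w))"
    unfolding S_def using int v by (simp add: right_diff_distrib)
  then have "ennreal (norm (S N g v - S N g v')) \<le> (\<integral>\<^sup>+w. ennreal (norm (g w * m N w * (cker v w - cker v' w))) \<partial>circle)"
    by (simp add: norm_integral_le_nn_integral)
  also have "\<dots> \<le> (\<integral>\<^sup>+w. 18 * (ennreal (norm (f w)) * ennreal (if dist w z > r then r / (dist w z)\<^sup>2 else 0)) \<partial>circle)"
  proof (rule nn_integral_mono)
    fix w assume w: "w \<in> space circle"
    then have w1: "norm w = 1" by (simp add: space_circle)
    show "ennreal (norm (g w * m N w * (cker v w - cker v' w)))
      \<le> 18 * (ennreal (norm (f w)) * ennreal (if dist w z > r then r / (dist w z)\<^sup>2 else 0))"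
    proof (cases "dist w c > 2 * r")
      case True
      define D where "D = dist w c"
      have D: "D > 2 * r" using True by (simp add: D_def)
      have dz: "dist w z > r" "dist w z \<le> 3 / 2 * D" "D / 2 \<le> dist w v" "D / 2 \<le> dist w v'"
        using dist_far_cell[OF v(1), of w] dist_far_cell[OF v(2), of w] dist_far_cell[OF v(3), of w] True
        by (auto simp: D_def c_def r_def)
      have vv: "dist v v' \<le> 2 * r"
        using dist_cell_end[OF v(2)] dist_cell_end[OF v(3)] dist_triangle2[of v v' c] by (simp add: c_def r_def)
      have "norm (cker v w - cker v' w) = dist v v' / (dist w v * dist w v')"
        using dz D r w1 by (intro cker_diff) auto
      also have "\<dots> \<le> 2 * r / (D / 2 * (D / 2))"
        using vv dz D r by (intro frac_le mult_mono mult_pos_pos) auto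
      also have "\<dots> = 8 * r / D\<^sup>2" by (simp add: power2_eq_square)
      also have "\<dots> \<le> 18 * (r / (dist w z)\<^sup>2)"
      proof -
        have "(dist w z)\<^sup>2 \<le> (3 / 2 * D)\<^sup>2" using dz by (intro power_mono) auto
        then have "4 * (dist w z)\<^sup>2 \<le> 9 * D\<^sup>2" by (simp add: power_mult_distrib power_divide)
        then have "r * (4 * (dist w z)\<^sup>2) \<le> r * (9 * D\<^sup>2)" using r by (intro mult_left_mono) auto
        moreover have "dist w z > 0" "D > 0" using dz D r by auto
        ultimately show ?thesis by (simp add: field_simps)
      qed
      finally have "norm (f w) * norm (cker v w - cker v' w) \<le> norm (f w) * (18 * (r / (dist w z)\<^sup>2))"
        by (rule mult_left_mono) simp
      then have "norm (g w * m N w * (cker v w - cker v' w)) \<le> norm (f w) * (18 * (r / (dist w z)\<^sup>2))"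
        using True w1 by (simp add: g norm_mult norm_m)
      then have "ennreal (norm (g w * m N w * (cker v w - cker v' w))) \<le> ennreal (18 * (norm (f w) * (r / (dist w z)\<^sup>2)))"
        by (intro ennreal_leI) (simp add: mult_ac)
      also have "\<dots> = 18 * (ennreal (norm (f w)) * ennreal (r / (dist w z)\<^sup>2))"
      proof -
        have "ennreal (18 * (norm (f w) * (r / (dist w z)\<^sup>2))) = ennreal 18 * ennreal (norm (f w) * (r / (dist w z)\<^sup>2))"
          using r by (intro ennreal_mult) auto
        also have "ennreal (norm (f w) * (r / (dist w z)\<^sup>2)) = ennreal (norm (f w)) * ennreal (r / (dist w z)\<^sup>2)"
          using r by (intro ennreal_mult) auto
        finally show ?thesis by simp
      qed
      finally show ?thesis using dz by simp
    qed (simp add: g)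
  qed
  also have "\<dots> = 18 * (\<integral>\<^sup>+w. (ennreal (norm (f w)) * ennreal (if dist w z > r then r / (dist w z)\<^sup>2 else 0)) \<partial>circle)"
    by (rule nn_integral_cmult) measurable
  also have "\<dots> \<le> 18 * (8 * hlmax (\<lambda>w. ennreal (norm (f w))) z)"
    by (intro mult_left_mono tail_integral_le_hlmax r) auto
  finally have d: "ennreal (norm (S N g v - S N g v')) \<le> 144 * hlmax (\<lambda>w. ennreal (norm (f w))) z"
    by (simp add: mult.assoc[symmetric])
  have "norm (S N g v) \<le> norm (S N g v') + norm (S N g v - S N g v')"
    by (metis add.commute norm_triangle_sub)
  then have "ennreal (norm (S N g v)) \<le> ennreal (norm (S N g v')) + ennreal (norm (S N g v - S N g v'))"
    by (simp flip: ennreal_plus)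
  then show ?thesis using d by (meson add_left_mono order_trans)
qed

text \<open>Where \<open>f\<close> is locally constant, \<open>F = f * m N\<close> satisfies a
  Lipschitz bound centred at \<open>z\<close>. Then \<open>F w - F z\<close> times the kernel is
  bounded, and for the constant \<open>F z\<close> the symmetry in
  \<open>integral_cker_truncated\<close> replaces the kernel by -1/2. Dominated convergence gives
  the limit.\<close>

lemma has_pv_nice:
  assumes f: "nice f"
  shows "AE z in circle. \<forall>N. has_pv N f z"
proof -
  have [measurable]: "f \<in> borel_measurable circle" using f by (rule nice_measurable)
  obtain B0 where B0: "\<forall>z\<in>space circle. norm (f z) \<le> B0" using f by (auto simp: nice_def)
  define B where "B = max B0 0"
  have B: "norm (f z) \<le> B" "B \<ge> 0" if "z \<in> space circle" for z using B0 that by (auto simp: B_def)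
  show ?thesis
    using f[unfolded nice_def, THEN conjunct2, THEN conjunct2] AE_space
  proof eventually_elim
    case (elim z)
    then have z: "norm z = 1" "z \<in> space circle" by (auto simp: space_circle)
    obtain d where d: "d > 0" "\<And>u. u \<in> space circle \<Longrightarrow> dist u z < d \<Longrightarrow> f u = f z" using elim by blast
    show ?case
    proof
      fix N
      obtain L0 where L0: "\<And>w z. norm w = 1 \<Longrightarrow> norm z = 1 \<Longrightarrow> norm (m N w - m N z) \<le> L0 * dist w z"
        using lipschitz_m by blast
      define L where "L = max L0 0"
      have L: "norm (m N w - m N z) \<le> L * dist w z" "L \<ge> 0" if "norm w = 1" for w
        using L0[OF that z(1)] mult_right_mono[of L0 L "dist w z"] by (auto simp: L_def)
      define F where "F w = f w * m N w" for w
      have [measurable]: "F \<in> borel_measurable circle" unfolding F_def by measurable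
      \<comment> \<open>The first summand serves points near \<open>z\<close>, the second those at
        distance at least \<open>d\<close>, where only boundedness is available.\<close>
      define C where "C = B * L + 2 * B / d"
      have FB: "norm (F w) \<le> B" if "w \<in> space circle" for w
        using B[OF that] that by (simp add: F_def norm_mult norm_m space_circle)
      have lip: "norm (F w - F z) \<le> C * dist w z" if w: "w \<in> space circle" for w
      proof (cases "dist w z < d")
        case True
        have "norm (F w - F z) = norm (f z) * norm (m N w - m N z)"
          using d(2)[OF w True] by (simp add: F_def norm_mult flip: right_diff_distrib)
        also have "\<dots> \<le> B * (L * dist w z)"
          using B[OF z(2)] L w by (intro mult_mono) (auto simp: space_circle)
        also have "\<dots> \<le> C * dist w z"
          using d B[OF z(2)] by (simp add: C_def distrib_right)
        finally show ?thesis .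
      next
        case False
        have "norm (F w - F z) \<le> B + B"
          using norm_triangle_ineq4[of "F w" "F z"] FB[OF w] FB[OF z(2)] by linarith
        also have "\<dots> = 2 * B / d * d" using d by simp
        also have "\<dots> \<le> 2 * B / d * dist w z" using False d B[OF z(2)] by (intro mult_left_mono) auto
        also have "\<dots> \<le> C * dist w z"
          using B[OF z(2)] L[OF z(1)] by (simp add: C_def distrib_right)
        finally show ?thesis .
      qed
      have C0: "C \<ge> 0" using B[OF z(2)] L[OF z(1)] d by (simp add: C_def)
      define h where "h w = (F w - F z) * cker z w + F z * (- 1 / 2)" for w
      have [measurable]: "h \<in> borel_measurable circle" unfolding h_def by measurable
      have hb: "norm (h w) \<le> C + B" if w: "w \<in> space circle" for w
      proof -
        have "norm ((F w - F z) * cker z w) \<le> C"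
        proof (cases "w = z")
          case False
          then show ?thesis
            using lip[OF w] w by (simp add: norm_mult norm_cker space_circle pos_divide_le_eq)
        qed (use C0 in simp)
        moreover have "norm (F z * (- 1 / 2)) \<le> B"
          using FB[OF z(2)] B[OF z(2)] by (simp add: norm_mult norm_divide)
        ultimately show ?thesis
          unfolding h_def using norm_triangle_ineq[of "(F w - F z) * cker z w" "F z * (- 1 / 2)"] by linarith
      qed
      have Sh: "S N (far z e f) z = (LINT w|circle. indicator {w. dist w z > e} w *\<^sub>R h w)" if e: "e > 0" for e
      proof -
        define I where "I = (indicator {w. dist w z > e} :: complex \<Rightarrow> real)"
        have [measurable]: "I \<in> borel_measurable circle" unfolding I_def by measurable
        have ik: "norm (I w *\<^sub>R cker z w) \<le> 1 / e" if "w \<in> space circle" for w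
          using e that by (auto simp: I_def indicator_def norm_cker space_circle intro!: divide_left_mono mult_pos_pos)
        have i1: "integrable circle (\<lambda>w. I w *\<^sub>R cker z w)"
          by (rule circle.integrable_const_bound[where B = "1 / e"], rule AE_I2, rule ik) measurable
        have i2: "integrable circle (\<lambda>w. I w *\<^sub>R h w)"
          using hb C0 B[OF z(2)] by (intro circle.integrable_const_bound[where B = "C + B"]) (auto intro!: AE_I2 simp: I_def indicator_def)
        have i3: "integrable circle (\<lambda>w. I w *\<^sub>R (- 1 / 2 :: complex))"
          by (rule circle.integrable_const_bound[where B = 1]) (auto intro!: AE_I2 simp: I_def indicator_def)
        have "S N (far z e f) z = (LINT w|circle. I w *\<^sub>R h w + (F z * (I w *\<^sub>R cker z w) - F z * (I w *\<^sub>R (- 1 / 2))))"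
          unfolding S_def by (intro Bochner_Integration.integral_cong) (auto simp: far_def I_def h_def F_def indicator_def algebra_simps)
        also have "\<dots> = (LINT w|circle. I w *\<^sub>R h w) + (F z * (LINT w|circle. I w *\<^sub>R cker z w) - F z * (LINT w|circle. I w *\<^sub>R (- 1 / 2)))"
        proof -
          have "(LINT w|circle. a w + (t * b w - t * c w)) = integral\<^sup>L circle a + (t * integral\<^sup>L circle b - t * integral\<^sup>L circle c)"
            if "integrable circle a" "integrable circle b" "integrable circle c" for a b c :: "complex \<Rightarrow> complex" and t
            using that by simp
          from this[OF i2 i1 i3] show ?thesis .
        qed
        also have "\<dots> = (LINT w|circle. I w *\<^sub>R h w)"
          using integral_cker_truncated[OF z(1) e] by (simp add: I_def)
        finally show ?thesis by (simp add: I_def)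
      qed
      have "((\<lambda>e. LINT w|circle. indicator {w. dist w z > e} w *\<^sub>R h w) \<longlongrightarrow> (LINT w|circle. indicator {w. dist w z > 0} w *\<^sub>R h w)) (at_right 0)"
      proof (rule tendsto_at_right_sequentially[where b = 1])
        fix X :: "nat \<Rightarrow> real" assume X: "\<And>n. 0 < X n" "X \<longlonglongrightarrow> 0"
        show "(\<lambda>n. LINT w|circle. indicator {w. dist w z > X n} w *\<^sub>R h w) \<longlonglongrightarrow> (LINT w|circle. indicator {w. dist w z > 0} w *\<^sub>R h w)"
        proof (rule integral_dominated_convergence[where w = "\<lambda>_. C + B"])
          show "AE w in circle. (\<lambda>n. indicator {w. dist w z > X n} w *\<^sub>R h w) \<longlonglongrightarrow> indicator {w. dist w z > 0} w *\<^sub>R h w"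
          proof (rule AE_I2, rule tendsto_eventually)
            fix w
            show "eventually (\<lambda>n. indicator {w. dist w z > X n} w *\<^sub>R h w = indicator {w. dist w z > 0} w *\<^sub>R h w) sequentially"
            proof (cases "w = z")
              case False
              then have "eventually (\<lambda>n. X n < dist w z) sequentially"
                using order_tendstoD(2)[OF X(2), of "dist w z"] by simp
              then show ?thesis by eventually_elim (use False in auto)
            next
              case True
              then show ?thesis using X(1) by (auto simp: indicator_def less_le_not_le intro!: always_eventually)
            qed
          qed
          show "AE w in circle. norm (indicator {w. dist w z > X n} w *\<^sub>R h w) \<le> C + B" for n
            using hb C0 B[OF z(2)] by (intro AE_I2) (auto simp: indicator_def)
        qed auto
      qed simp
      then have "((\<lambda>e. S N (far z e f) z) \<longlongrightarrow> (LINT w|circle. indicator {w. dist w z > 0} w *\<^sub>R h w)) (at_right 0)"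
        by (rule tendsto_cong[THEN iffD1, rotated]) (auto simp: eventually_at_right_field Sh intro!: exI[of _ 1])
      then show "has_pv N f z" by (auto simp: has_pv_def)
    qed
  qed
qed

text \<open>\<open>PV\<close> involves a limit over a continuous parameter and a case distinction.
  Where the limit exists it can be taken along \<open>cell_length n\<close>, and that sequential
  limit is measurable.\<close>

lemma TM_nice_AE_measurable:
  assumes f: "nice f"
  obtains H where "H \<in> borel_measurable circle" "AE z in circle. TM f z = H z"
proof -
  have [measurable]: "f \<in> borel_measurable circle" using f by (rule nice_measurable)
  define h where "h N z = lim (\<lambda>n. S N (far z (cell_length n) f) z)" for N z
  have meas: "(\<lambda>z. S N (far z e f) z) \<in> borel_measurable circle" for N e
    unfolding S_def far_def by measurable
  have [measurable]: "h N \<in> borel_measurable circle" for N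
    unfolding h_def by (intro borel_measurable_lim_metric meas)
  have "AE z in circle. TM f z = (SUP N\<in>{1..}. ennreal (norm (h N z)))"
    using has_pv_nice[OF f]
  proof eventually_elim
    case (elim z)
    have "PV N f z = h N z" for N
    proof -
      from elim obtain l where l: "((\<lambda>e. S N (far z e f) z) \<longlongrightarrow> l) (at_right 0)"
        unfolding has_pv_def by blast
      have "filterlim cell_length (at_right 0) sequentially"
        unfolding filterlim_at using cell_length_tendsto by auto
      from filterlim_compose[OF l this] have "(\<lambda>n. S N (far z (cell_length n) f) z) \<longlonglongrightarrow> l" .
      then show ?thesis using PV_tendsto[OF _ l] by (simp add: h_def limI)
    qed
    then show ?case by (simp add: TM_def)
  qed
  then show ?thesis by (intro that[of "\<lambda>z. SUP N\<in>{1..}. ennreal (norm (h N z))"]) auto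
qed

end

section \<open>The weak type estimate\<close>

lemma integrable_of_powr:
  fixes f :: "complex \<Rightarrow> complex"
  assumes [measurable]: "f \<in> borel_measurable circle" and q: "1 \<le> q"
    and fin: "(\<integral>\<^sup>+z. ennpowr (ennreal (norm (f z))) q \<partial>circle) < \<infinity>"
  shows "integrable circle f"
proof (rule integrableI_bounded)
  have "(\<integral>\<^sup>+z. ennreal (norm (f z)) \<partial>circle) \<le> (\<integral>\<^sup>+z. 1 + ennpowr (ennreal (norm (f z))) q \<partial>circle)"
    using le_add_ennpowr[OF q, of 1] by (intro nn_integral_mono) auto
  also have "\<dots> = ennreal (2 * pi) + (\<integral>\<^sup>+z. ennpowr (ennreal (norm (f z))) q \<partial>circle)"
    by (simp add: nn_integral_add emeasure_space_circle)
  also have "\<dots> < \<infinity>" using fin by simp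
  finally show "(\<integral>\<^sup>+z. ennreal (norm (f z)) \<partial>circle) < \<infinity>" .
qed simp

context multiplier_family
begin

lemma continuous_on_m: "continuous_on (sphere 0 1) (m N)"
proof -
  obtain L where L: "\<And>w z. norm w = 1 \<Longrightarrow> norm z = 1 \<Longrightarrow> norm (m N w - m N z) \<le> L * dist w z"
    using lipschitz_m by blast
  have "(max L 0)-lipschitz_on (sphere 0 1) (m N)"
  proof (rule lipschitz_onI)
    fix x y :: complex assume "x \<in> sphere 0 1" "y \<in> sphere 0 1"
    then have "norm (m N x - m N y) \<le> L * dist x y" using L by auto
    also have "\<dots> \<le> max L 0 * dist x y" by (intro mult_right_mono) auto
    finally show "dist (m N x) (m N y) \<le> max L 0 * dist x y" by (simp add: dist_norm)
  qed simp
  then show ?thesis by (rule lipschitz_on_continuous_on)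
qed

text \<open>A Cotlar-type inequality. For every \<open>v'\<close> in the cell, the moduli of
  \<open>S N g v\<close> and \<open>S N g v'\<close> are within 144 maximal functions, and for
  almost every \<open>v'\<close> the latter is the difference of the principal values of
  \<open>f\<close> and of its near part \<open>f1\<close>. Averaging over \<open>v'\<close> leaves
  the mean of \<open>TM f\<close>, the mean of \<open>TM f1\<close>, which the L^q bound controls
  since \<open>f1\<close> lives on an arc of radius \<open>3 * r\<close> about \<open>z\<close>, and
  the maximal function.\<close>

lemma tsharp_le_of_hlmax:
  assumes q: "1 \<le> q" and A: "1 \<le> A"
    and TM_bound: "\<And>f. nice f \<Longrightarrow> (\<integral>\<^sup>+z. ennpowr (TM f z) q \<partial>circle)
      \<le> ennreal (A powr q) * (\<integral>\<^sup>+z. ennpowr (ennreal (norm (f z))) q \<partial>circle)"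
    and f: "nice f" and s: "s > 0" and z: "z \<in> space circle"
    and H: "H \<in> borel_measurable circle" "AE z in circle. TM f z = H z"
    and hf: "hlmax (\<lambda>u. ennpowr (ennreal (norm (f u))) q) z \<le> ennreal ((s / A) powr q)"
    and hH: "hlmax (\<lambda>u. ennpowr (H u) q) z \<le> ennreal (s powr q)"
  shows "tsharp f z \<le> ennreal (1400 * s)"
  unfolding tsharp_def tsharp_cell_def
proof (intro SUP_least)
  fix n N :: nat and v
  assume N: "N \<in> {1..}" and v: "v \<in> cell n (cell_index n z)"
  have [measurable]: "f \<in> borel_measurable circle" using f by (rule nice_measurable)
  note H(1)[measurable]
  have z1: "norm z = 1" using z by (simp add: space_circle)
  define k where "k = cell_index n z"
  define c where "c = cell_end n k"
  define r where "r = cell_length n"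
  have r: "r > 0" by (simp add: r_def)
  have zk: "z \<in> cell n k" using z by (simp add: k_def cell_def)
  define g where "g = far c (2 * r) f"
  define f1 where "f1 = near c (2 * r) f"
  have f1: "nice f1" unfolding f1_def c_def by (rule nice_near[OF f]) simp
  have [measurable]: "f1 \<in> borel_measurable circle" using f1 by (rule nice_measurable)
  obtain H1 where H1 [measurable]: "H1 \<in> borel_measurable circle" and TH1: "AE z in circle. TM f1 z = H1 z"
    using TM_nice_AE_measurable[OF f1] by blast
  define X where "X = ennreal (norm (S N g v))"
  have "hlmax (\<lambda>w. ennreal (norm (f w))) z \<le> ennreal (9 * (s / A))"
    using s A q by (intro hlmax_le_of_powr[OF _ q _ z1 hf]) auto
  also have "\<dots> \<le> ennreal (9 * s)"
    using s A by (intro ennreal_leI) (simp add: divide_le_eq)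
  finally have hl: "144 * hlmax (\<lambda>w. ennreal (norm (f w))) z \<le> ennreal (1296 * s)"
    using mult_left_mono[of _ "ennreal (9 * s)" "144 :: ennreal"] s by (simp add: ennreal_mult mult.assoc[symmetric])
  \<comment> \<open>The splitting of \<open>PV N f\<close> is available where the principal values
    exist, hence the almost everywhere statement; \<open>H\<close> and \<open>H1\<close> are
    measurable versions of \<open>TM f\<close> and \<open>TM f1\<close>.\<close>
  have ptw: "AE v' in circle. X * indicator (cell n k) v' \<le> H v' * indicator (cell n k) v' + H1 v' * indicator (cell n k) v' + ennreal (1296 * s) * indicator (cell n k) v'"
    using has_pv_nice[OF f] H(2) TH1
  proof eventually_elim
    case (elim v')
    show ?case
    proof (cases "v' \<in> cell n k")
      case True
      have fsum: "(\<lambda>w. f1 w + g w) = f" by (simp add: f1_def g_def near_add_far)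
      have far0: "g w = 0" if "dist w v' \<le> r" for w
        using dist_far_cell[OF True, of w] that by (auto simp: g_def far_def c_def r_def)
      have gint: "integrable circle g" unfolding g_def by (rule integrable_far[OF nice_integrable[OF f]])
      have "has_pv N f1 v'" "PV N f v' = PV N f1 v' + S N g v'"
        using has_pv_add_far[of f1 g r v' N] r far0 elim nice_integrable[OF f1] gint
        by (auto simp: fsum)
      then have "norm (S N g v') \<le> norm (PV N f v') + norm (PV N f1 v')"
        by (metis add_diff_cancel_left' norm_triangle_ineq4)
      then have "ennreal (norm (S N g v')) \<le> ennreal (norm (PV N f v')) + ennreal (norm (PV N f1 v'))"
        by (simp flip: ennreal_plus)
      also have "\<dots> \<le> TM f v' + TM f1 v'"
        unfolding TM_def using N by (intro add_mono SUP_upper) auto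
      finally have 1: "ennreal (norm (S N g v')) \<le> H v' + H1 v'" using elim by simp
      have "X \<le> ennreal (norm (S N g v')) + 144 * hlmax (\<lambda>w. ennreal (norm (f w))) z"
        unfolding X_def g_def c_def r_def using v True zk k_def
        by (intro S_far_oscillation nice_integrable f) auto
      also have "\<dots> \<le> H v' + H1 v' + ennreal (1296 * s)"
        using 1 hl by (rule add_mono)
      finally show ?thesis using True by simp
    qed simp
  qed
  have ck: "cell n k \<subseteq> carc z (2 * r)" using cell_subset_carc[OF zk] by (simp add: r_def)
  have mk: "emeasure circle (cell n k) = ennreal r"
    unfolding r_def by (rule emeasure_cell) (use cell_nonempty_index[OF zk] in simp)
  have "X * ennreal r = (\<integral>\<^sup>+v'. X * indicator (cell n k) v' \<partial>circle)"
    by (simp add: nn_integral_cmult mk)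
  also have "\<dots> \<le> (\<integral>\<^sup>+v'. H v' * indicator (cell n k) v' + H1 v' * indicator (cell n k) v' + ennreal (1296 * s) * indicator (cell n k) v' \<partial>circle)"
    by (rule nn_integral_mono_AE[OF ptw])
  also have "\<dots> = (\<integral>\<^sup>+v'\<in>cell n k. H v' \<partial>circle) + (\<integral>\<^sup>+v'\<in>cell n k. H1 v' \<partial>circle) + ennreal (1296 * s) * ennreal r"
    by (simp add: nn_integral_add nn_integral_cmult mk)
  also have "(\<integral>\<^sup>+v'\<in>cell n k. H v' \<partial>circle) \<le> ennreal (9 * (2 * r) * s)"
  proof -
    have "(\<integral>\<^sup>+v'\<in>cell n k. H v' \<partial>circle) \<le> (\<integral>\<^sup>+v'\<in>carc z (2 * r). H v' \<partial>circle)"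
      using ck by (intro nn_integral_mono mult_left_mono) (auto simp: indicator_def)
    also have "\<dots> \<le> ennreal (9 * (2 * r) * s)"
      by (rule hlmax_powr_bound[OF H(1) q s _ z1 hH]) (use r in simp)
    finally show ?thesis .
  qed
  also have "(\<integral>\<^sup>+v'\<in>cell n k. H1 v' \<partial>circle) \<le> ennreal (7 * r * s)"
  proof -
    have "(\<integral>\<^sup>+v'\<in>cell n k. H1 v' \<partial>circle) \<le> (\<integral>\<^sup>+v'. ennreal s * indicator (cell n k) v' + ennreal (s powr (1 - q)) * ennpowr (H1 v') q \<partial>circle)"
      using le_add_ennpowr[OF q s] by (intro nn_integral_mono) (auto simp: indicator_def)
    also have "\<dots> = ennreal s * ennreal r + ennreal (s powr (1 - q)) * (\<integral>\<^sup>+v'. ennpowr (H1 v') q \<partial>circle)"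
      by (simp add: nn_integral_add nn_integral_cmult mk)
    also have "(\<integral>\<^sup>+v'. ennpowr (H1 v') q \<partial>circle) = (\<integral>\<^sup>+v'. ennpowr (TM f1 v') q \<partial>circle)"
      using TH1 by (intro nn_integral_cong_AE) auto
    also have "\<dots> \<le> ennreal (A powr q) * (\<integral>\<^sup>+z. ennpowr (ennreal (norm (f1 z))) q \<partial>circle)"
      by (rule TM_bound[OF f1])
    also have "(\<integral>\<^sup>+z. ennpowr (ennreal (norm (f1 z))) q \<partial>circle) \<le> (\<integral>\<^sup>+w\<in>carc z (3 * r). ennpowr (ennreal (norm (f w))) q \<partial>circle)"
    proof (intro nn_integral_mono)
      fix w assume w: "w \<in> space circle"
      have "dist w z \<le> 3 * r" if "dist w c \<le> 2 * r"
        using that dist_cell_end[OF zk] dist_triangle2[of w z c] by (simp add: c_def r_def)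
      then show "ennpowr (ennreal (norm (f1 w))) q \<le> ennpowr (ennreal (norm (f w))) q * indicator (carc z (3 * r)) w"
        using w by (auto simp: f1_def near_def indicator_carc)
    qed
    also have "\<dots> \<le> ennreal (2 * (3 * r)) * hlmax (\<lambda>u. ennpowr (ennreal (norm (f u))) q) z"
      using r by (intro carc_integral_le_hlmax) auto
    also have "\<dots> \<le> ennreal (2 * (3 * r)) * ennreal ((s / A) powr q)"
      by (intro mult_left_mono hf) auto
    finally have "(\<integral>\<^sup>+v'\<in>cell n k. H1 v' \<partial>circle) \<le> ennreal s * ennreal r + ennreal (s powr (1 - q)) * (ennreal (A powr q) * (ennreal (2 * (3 * r)) * ennreal ((s / A) powr q)))"
      by (simp add: mult_left_mono add_left_mono)
    also have "\<dots> = ennreal (s * r + s powr (1 - q) * (A powr q * (2 * (3 * r) * (s / A) powr q)))"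
      using s r A by (simp add: ennreal_mult ennreal_plus)
    also have "s powr (1 - q) * (A powr q * (2 * (3 * r) * (s / A) powr q)) = 6 * r * s"
      using s A by (simp add: powr_divide powr_diff)
    finally show ?thesis by (simp add: algebra_simps)
  qed
  \<comment> \<open>The total is 18 + 7 + 1296 = 1321, rounded up to 1400.\<close>
  finally have "X * ennreal r \<le> ennreal (9 * (2 * r) * s) + ennreal (7 * r * s) + ennreal (1296 * s) * ennreal r"
    by (simp add: add_mono)
  also have "\<dots> = ennreal (1321 * s * r)"
    using s r by (simp add: algebra_simps flip: ennreal_mult ennreal_plus)
  finally have "norm (S N g v) * r \<le> 1321 * s * r"
    using s r by (simp add: X_def flip: ennreal_mult)
  then have "norm (S N g v) \<le> 1321 * s" using r by simp
  then show "ennreal (norm (S N (far (cell_end n (cell_index n z)) (2 * cell_length n) f) v)) \<le> ennreal (1400 * s)"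
    using s by (auto simp: g_def c_def k_def r_def intro!: ennreal_leI)
qed

text \<open>Outside the level sets of two maximal functions \<open>tsharp_le_of_hlmax\<close>
  applies; the weak type bound gives 35 for each of them, together 70.\<close>

lemma tsharp_weak_nice:
  assumes q: "1 \<le> q" and A: "1 \<le> A"
    and TM_bound: "\<And>f. nice f \<Longrightarrow> (\<integral>\<^sup>+z. ennpowr (TM f z) q \<partial>circle)
      \<le> ennreal (A powr q) * (\<integral>\<^sup>+z. ennpowr (ennreal (norm (f z))) q \<partial>circle)"
    and f: "nice f" and s: "s > 0"
  shows "emeasure circle {z \<in> space circle. tsharp f z > ennreal (1400 * s)}
    \<le> ennreal (70 * (A / s) powr q) * (\<integral>\<^sup>+z. ennpowr (ennreal (norm (f z))) q \<partial>circle)"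
proof -
  have [measurable]: "f \<in> borel_measurable circle" using f by (rule nice_measurable)
  obtain H where H [measurable]: "H \<in> borel_measurable circle" and TH: "AE z in circle. TM f z = H z"
    using TM_nice_AE_measurable[OF f] by blast
  define I where "I = (\<integral>\<^sup>+z. ennpowr (ennreal (norm (f z))) q \<partial>circle)"
  define E1 where "E1 = {z \<in> space circle. hlmax (\<lambda>u. ennpowr (ennreal (norm (f u))) q) z > ennreal ((s / A) powr q)}"
  define E2 where "E2 = {z \<in> space circle. hlmax (\<lambda>u. ennpowr (H u) q) z > ennreal (s powr q)}"
  have [measurable]: "E1 \<in> sets circle" "E2 \<in> sets circle" by (auto simp: E1_def E2_def)
  have "{z \<in> space circle. tsharp f z > ennreal (1400 * s)} \<subseteq> E1 \<union> E2"
    using tsharp_le_of_hlmax[OF q A TM_bound f s _ H TH] by (auto simp: E1_def E2_def not_le[symmetric])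
  then have "emeasure circle {z \<in> space circle. tsharp f z > ennreal (1400 * s)} \<le> emeasure circle (E1 \<union> E2)"
    by (intro emeasure_mono) auto
  also have "\<dots> \<le> emeasure circle E1 + emeasure circle E2"
    by (rule emeasure_subadditive) auto
  also have "emeasure circle E1 \<le> ennreal (35 / ((s / A) powr q)) * I"
    unfolding E1_def I_def using s A by (intro hlmax_weak_type) auto
  also have "emeasure circle E2 \<le> ennreal (35 / (s powr q)) * (\<integral>\<^sup>+z. ennpowr (H z) q \<partial>circle)"
    unfolding E2_def using s by (intro hlmax_weak_type) auto
  also have "(\<integral>\<^sup>+z. ennpowr (H z) q \<partial>circle) = (\<integral>\<^sup>+z. ennpowr (TM f z) q \<partial>circle)"
    using TH by (intro nn_integral_cong_AE) auto
  also have "\<dots> \<le> ennreal (A powr q) * I"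
    unfolding I_def by (rule TM_bound[OF f])
  finally have "emeasure circle {z \<in> space circle. tsharp f z > ennreal (1400 * s)}
    \<le> ennreal (35 / ((s / A) powr q)) * I + ennreal (35 / (s powr q)) * (ennreal (A powr q) * I)"
    by (simp add: mult_left_mono add_left_mono)
  also have "\<dots> = (ennreal (35 / ((s / A) powr q)) + ennreal (35 / (s powr q)) * ennreal (A powr q)) * I"
    by (simp add: distrib_right mult.assoc)
  also have "ennreal (35 / ((s / A) powr q)) + ennreal (35 / (s powr q)) * ennreal (A powr q) = ennreal (70 * (A / s) powr q)"
    using s A by (simp add: powr_divide flip: ennreal_mult ennreal_plus)
  finally show ?thesis by (simp add: I_def)
qed

text \<open>For fixed \<open>v\<close> the far integral is the pairing of \<open>f\<close> with the
  bounded function \<open>G\<close>, which is continuous off the null set at distance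
  \<open>2 * r\<close> from \<open>c\<close>; so weak convergence of the averages suffices.\<close>

lemma S_far_cell_avg_tendsto:
  assumes f: "integrable circle f" and v: "v \<in> cell n k"
  shows "(\<lambda>j. S N (far (cell_end n k) (2 * cell_length n) (cell_avg j f)) v)
    \<longlonglongrightarrow> S N (far (cell_end n k) (2 * cell_length n) f) v"
proof -
  define c where "c = cell_end n k"
  define r where "r = cell_length n"
  have r: "r > 0" by (simp add: r_def)
  define G where "G w = (if dist w c > 2 * r then m N w * cker v w else 0)" for w
  have [measurable]: "G \<in> borel_measurable circle" unfolding G_def by measurable
  have SG: "S N (far c (2 * r) h) v = (LINT w|circle. h w * G w)" for h
    unfolding S_def by (intro Bochner_Integration.integral_cong) (auto simp: far_def G_def)
  have vd: "dist w v > r" if "dist w c > 2 * r" for w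
    using dist_far_cell[OF v, of w] that by (simp add: c_def r_def)
  have "(\<lambda>j. LINT z|circle. cell_avg j f z * G z) \<longlonglongrightarrow> (LINT z|circle. f z * G z)"
  proof (rule cell_avg_weak_tendsto[OF f])
    fix w assume w: "w \<in> space circle"
    show "norm (G w) \<le> 1 / r"
      using w r vd[of w] by (auto simp: G_def norm_mult norm_m norm_cker space_circle intro!: divide_left_mono mult_pos_pos)
  next
    have "AE w in circle. dist w c \<noteq> 2 * r" by (rule AE_circle_dist_neq) (simp add: c_def)
    then show "AE w in circle. \<forall>e>0. \<exists>d>0. \<forall>u\<in>space circle. dist u w < d \<longrightarrow> norm (G u - G w) < e"
      using AE_space
    proof eventually_elim
      case (elim w)
      show ?case
      proof (intro allI impI)
        fix e :: real assume e: "e > 0"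
        show "\<exists>d>0. \<forall>u\<in>space circle. dist u w < d \<longrightarrow> norm (G u - G w) < e"
        proof (cases "dist w c > 2 * r")
          case True
          define U where "U = {u \<in> sphere 0 1. dist u c > 2 * r}"
          have "v \<notin> U" using vd[of v] r by (auto simp: U_def)
          then have "continuous_on U (\<lambda>u. m N u * (u / (v - u)))"
            by (intro continuous_intros continuous_on_subset[OF continuous_on_m]) (auto simp: U_def)
          moreover have "w \<in> U" using True elim by (auto simp: U_def space_circle)
          ultimately obtain d where d: "d > 0" "\<And>u. u \<in> U \<Longrightarrow> dist u w < d \<Longrightarrow> dist (m N u * (u / (v - u))) (m N w * (w / (v - w))) < e"
            using e unfolding continuous_on_iff by blast
          have GU: "G u = m N u * (u / (v - u))" if "u \<in> U" for u
          proof -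
            have "u \<noteq> 0" using that by (auto simp: U_def)
            then show ?thesis using that by (simp add: G_def U_def cker_eq)
          qed
          show ?thesis
          proof (intro exI conjI ballI impI)
            show "min d (dist w c - 2 * r) > 0" using d True by simp
            fix u assume u: "u \<in> space circle" "dist u w < min d (dist w c - 2 * r)"
            then have "u \<in> U"
              using dist_triangle[of w c u] by (auto simp: U_def space_circle dist_commute)
            then show "norm (G u - G w) < e"
              using d(2)[of u] u \<open>w \<in> U\<close> by (simp add: GU dist_norm)
          qed
        next
          case False
          show ?thesis
          proof (intro exI conjI ballI impI)
            show "2 * r - dist w c > 0" using False elim by simp
            fix u assume "dist u w < 2 * r - dist w c"
            then have "dist u c < 2 * r" using dist_triangle[of u c w] by simp
            then show "norm (G u - G w) < e" using False e by (simp add: G_def)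
          qed
        qed
      qed
    qed
  qed simp
  then show ?thesis by (simp add: SG[unfolded c_def r_def])
qed

text \<open>The inequality \<open>tsharp f z > t\<close> is witnessed by one triple
  \<open>n\<close>, \<open>N\<close>, \<open>v\<close>, and being strict it persists for the
  averages with large \<open>j\<close>; Fatou's lemma then transfers the bound from averages to
  \<open>f\<close>. The additional \<open>2 powr q\<close> is the cost of averaging in
  \<open>nn_integral_cell_avg_powr\<close>.\<close>

lemma tsharp_weak:
  assumes q: "1 \<le> q" and A: "1 \<le> A"
    and TM_bound: "\<And>f. nice f \<Longrightarrow> (\<integral>\<^sup>+z. ennpowr (TM f z) q \<partial>circle)
      \<le> ennreal (A powr q) * (\<integral>\<^sup>+z. ennpowr (ennreal (norm (f z))) q \<partial>circle)"
    and [measurable]: "f \<in> borel_measurable circle" and s: "s > 0"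
  shows "emeasure circle {z \<in> space circle. tsharp f z > ennreal (1400 * s)}
    \<le> ennreal (70 * 2 powr q * (A / s) powr q) * (\<integral>\<^sup>+z. ennpowr (ennreal (norm (f z))) q \<partial>circle)"
proof -
  define I where "I = (\<integral>\<^sup>+z. ennpowr (ennreal (norm (f z))) q \<partial>circle)"
  define C where "C = 70 * 2 powr q * (A / s) powr q"
  have C: "C > 0" using A s by (simp add: C_def)
  show ?thesis
  proof (cases "I = \<infinity>")
    case True
    then show ?thesis using C by (simp add: I_def[symmetric] C_def[symmetric] ennreal_mult_top)
  next
    case False
    then have f: "integrable circle f"
      using q by (intro integrable_of_powr) (auto simp: I_def less_top)
    define t where "t = 1400 * s"
    define E where "E f = {z \<in> space circle. tsharp f z > ennreal t}" for f
    have [measurable]: "E g \<in> sets circle" for g by (simp add: E_def)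
    have "emeasure circle (E f) = (\<integral>\<^sup>+z. indicator (E f) z \<partial>circle)" by simp
    also have "\<dots> \<le> (\<integral>\<^sup>+z. liminf (\<lambda>j. indicator (E (cell_avg j f)) z) \<partial>circle)"
    proof (rule nn_integral_mono)
      fix z assume z: "z \<in> space circle"
      show "indicator (E f) z \<le> liminf (\<lambda>j. indicator (E (cell_avg j f)) z :: ennreal)"
      proof (cases "z \<in> E f")
        case True
        then obtain n N v where N: "N \<ge> 1" and v: "v \<in> cell n (cell_index n z)"
          and gt: "ennreal t < ennreal (norm (S N (far (cell_end n (cell_index n z)) (2 * cell_length n) f) v))"
          by (auto simp: E_def tsharp_def tsharp_cell_def less_SUP_iff)
        have gt': "t < norm (S N (far (cell_end n (cell_index n z)) (2 * cell_length n) f) v)"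
          using gt s by (subst (asm) ennreal_less_iff) (auto simp: t_def)
        have "eventually (\<lambda>j. t < norm (S N (far (cell_end n (cell_index n z)) (2 * cell_length n) (cell_avg j f)) v)) sequentially"
          by (rule order_tendstoD(1)[OF tendsto_norm[OF S_far_cell_avg_tendsto[OF f v]] gt'])
        then have "eventually (\<lambda>j. 1 \<le> (indicator (E (cell_avg j f)) z :: ennreal)) sequentially"
        proof eventually_elim
          case (elim j)
          have "ennreal t < ennreal (norm (S N (far (cell_end n (cell_index n z)) (2 * cell_length n) (cell_avg j f)) v))"
            using elim s by (subst ennreal_less_iff) (auto simp: t_def)
          also have "\<dots> \<le> tsharp (cell_avg j f) z"
            unfolding tsharp_def tsharp_cell_def using N v
            by (intro SUP_upper2[of n] SUP_upper2[of N] SUP_upper2[of v]) auto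
          finally show ?case using z by (simp add: E_def)
        qed
        then have "1 \<le> liminf (\<lambda>j. indicator (E (cell_avg j f)) z :: ennreal)" by (rule Liminf_bounded)
        then show ?thesis using True by simp
      qed simp
    qed
    also have "\<dots> \<le> liminf (\<lambda>j. \<integral>\<^sup>+z. indicator (E (cell_avg j f)) z \<partial>circle)"
      by (rule nn_integral_liminf) simp
    also have "\<dots> \<le> liminf (\<lambda>j. ennreal C * I)"
    proof (rule Liminf_mono, rule always_eventually, rule allI)
      fix j
      have "emeasure circle (E (cell_avg j f)) \<le> ennreal (70 * (A / s) powr q) * (\<integral>\<^sup>+z. ennpowr (ennreal (norm (cell_avg j f z))) q \<partial>circle)"
        unfolding E_def t_def by (rule tsharp_weak_nice[OF q A TM_bound nice_cell_avg s])
      also have "\<dots> \<le> ennreal (70 * (A / s) powr q) * (ennreal (2 powr q) * I)"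
        unfolding I_def by (intro mult_left_mono nn_integral_cell_avg_powr q) auto
      also have "\<dots> = ennreal C * I"
        using s A by (simp add: C_def mult.assoc[symmetric] flip: ennreal_mult) (simp add: mult_ac)
      finally show "(\<integral>\<^sup>+z. indicator (E (cell_avg j f)) z \<partial>circle) \<le> ennreal C * I" by simp
    qed
    also have "\<dots> = ennreal C * I" by (rule Liminf_const) simp
    finally show ?thesis by (simp add: E_def t_def C_def I_def)
  qed
qed

text \<open>At generation 0 the truncation radius \<open>4 * pi\<close> exceeds the diameter of the
  circle, so the far part is empty. For this reason every cell selected in the good-lambda argument
  has a parent.\<close>

lemma tsharp_cell_0: "tsharp_cell 0 f k = 0"
proof -
  have "S N (far (cell_end 0 k) (2 * cell_length 0) f) v = 0" for N v
  proof -
    have "far (cell_end 0 k) (2 * cell_length 0) f w = 0" if "w \<in> space circle" for w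
    proof -
      have "dist w (cell_end 0 k) \<le> norm w + norm (cell_end 0 k)"
        using norm_triangle_ineq4[of w "cell_end 0 k"] by (simp add: dist_norm)
      also have "\<dots> \<le> 2 * cell_length 0"
        using that pi_gt3 by (simp add: space_circle cell_length_0)
      finally show ?thesis by (simp add: far_def)
    qed
    then have "S N (far (cell_end 0 k) (2 * cell_length 0) f) v = (LINT w|circle. 0)"
      unfolding S_def by (intro Bochner_Integration.integral_cong) auto
    then show ?thesis by simp
  qed
  then show ?thesis unfolding tsharp_cell_def by (intro antisym SUP_least) auto
qed

text \<open>The far part of \<open>f\<close> is already controlled at the cell of generation \<open>n\<close>, so only the part of \<open>f\<close>
  near that cell can make \<open>tsharp\<close> large.\<close>

lemma tsharp_localize:
  assumes f: "integrable circle f" and x: "x \<in> space circle" and l: "l > 0"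
    and parent: "\<And>j. j \<le> n \<Longrightarrow> tsharp_cell j f (cell_index j x) \<le> ennreal l"
    and big: "tsharp f x > ennreal (2 * l)"
  shows "tsharp (near (cell_end n (cell_index n x)) (2 * cell_length n) f) x > ennreal l"
proof -
  define c where "c = cell_end n (cell_index n x)"
  define r where "r = cell_length n"
  have r: "r > 0" by (simp add: r_def)
  define f1 where "f1 = near c (2 * r) f"
  obtain j N v where N: "N \<ge> 1" and v: "v \<in> cell j (cell_index j x)"
    and gt: "ennreal (2 * l) < ennreal (norm (S N (far (cell_end j (cell_index j x)) (2 * cell_length j) f) v))"
    using big by (auto simp: tsharp_def tsharp_cell_def less_SUP_iff)
  define cj where "cj = cell_end j (cell_index j x)"
  define rj where "rj = cell_length j"
  have rj: "rj > 0" by (simp add: rj_def)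
  have "ennreal (norm (S N (far cj (2 * rj) f) v)) \<le> tsharp_cell j f (cell_index j x)"
    unfolding tsharp_cell_def cj_def rj_def using N v by (intro SUP_upper2[of N] SUP_upper2[of v]) auto
  then have "\<not> tsharp_cell j f (cell_index j x) \<le> ennreal l"
    using gt l order_trans[of "ennreal (norm (S N (far cj (2 * rj) f) v))" "tsharp_cell j f (cell_index j x)" "ennreal l"]
    by (auto simp: cj_def rj_def ennreal_less_iff)
  then have jn: "Suc n \<le> j" using parent[of j] by (meson not_less_eq_eq)
  have rjr: "2 * rj \<le> r"
  proof -
    have "(2::real) ^ Suc n \<le> 2 ^ j" using jn by (rule power_increasing) simp
    then have "2 * pi / 2 ^ j \<le> 2 * pi / 2 ^ Suc n" by (intro divide_left_mono) auto
    then show ?thesis by (simp add: rj_def r_def cell_length_def)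
  qed
  have vn: "v \<in> cell n (cell_index n x)"
    using v jn cell_index_coarser[of n j v x] by (auto simp: cell_def)
  have cjn: "cj \<in> cell n (cell_index n x)"
    using cell_end_in_cell[OF cell_index_bounds, of j x] jn cell_index_coarser[of n j cj x] by (auto simp: cell_def cj_def)
  \<comment> \<open>The far region of the coarse cell lies in that of the fine one because
    \<open>2 * r - r \<ge> 2 * rj\<close>; so the remainder only sees the near part
    \<open>f1\<close>.\<close>
  have dcj: "dist w cj > 2 * rj" if "dist w c > 2 * r" for w
    using that dist_cell_end[OF cjn] dist_triangle2[of w c cj] rjr by (simp add: c_def r_def dist_commute)
  have split: "far cj (2 * rj) f = (\<lambda>w. far c (2 * r) f w + far cj (2 * rj) f1 w)"
    using dcj by (auto simp: fun_eq_iff far_def f1_def near_def)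
  have "S N (far cj (2 * rj) f) v = S N (far c (2 * r) f) v + S N (far cj (2 * rj) f1) v"
  proof (subst split, rule S_add)
    show "integrable circle (\<lambda>w. far c (2 * r) f w * m N w * cker v w)"
      using dist_far_cell[OF vn] r
      by (intro S_integrable[where r = r] integrable_far f) (auto simp: far_def r_def c_def not_less[symmetric])
    show "integrable circle (\<lambda>w. far cj (2 * rj) f1 w * m N w * cker v w)"
      using dist_far_cell[OF v] rj unfolding f1_def
      by (intro S_integrable[where r = rj] integrable_far integrable_near f) (auto simp: far_def rj_def cj_def not_less[symmetric])
  qed
  then have tri: "norm (S N (far cj (2 * rj) f) v) \<le> norm (S N (far c (2 * r) f) v) + norm (S N (far cj (2 * rj) f1) v)"
    by (simp add: norm_triangle_ineq)
  have "ennreal (norm (S N (far c (2 * r) f) v)) \<le> tsharp_cell n f (cell_index n x)"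
    unfolding tsharp_cell_def c_def r_def using N vn by (intro SUP_upper2[of N] SUP_upper2[of v]) auto
  also have "\<dots> \<le> ennreal l" by (rule parent) simp
  finally have "norm (S N (far c (2 * r) f) v) \<le> l" using l by simp
  moreover have "2 * l < norm (S N (far cj (2 * rj) f) v)"
    using gt l by (auto simp: cj_def rj_def ennreal_less_iff)
  ultimately have "l < norm (S N (far cj (2 * rj) f1) v)" using tri by linarith
  then have "ennreal l < ennreal (norm (S N (far cj (2 * rj) f1) v))"
    using l by (simp add: ennreal_less_iff)
  also have "\<dots> \<le> tsharp f1 x"
    unfolding tsharp_def tsharp_cell_def cj_def rj_def using N v
    by (intro SUP_upper2[of j] SUP_upper2[of N] SUP_upper2[of v]) auto
  finally show ?thesis by (simp add: f1_def c_def r_def)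
qed

text \<open>The set \<open>tsharp f > l\<close> is split by the first generation at which the level
  \<open>l\<close> is exceeded. On a cell of that generation the parent still obeys the bound
  \<open>l\<close>, so by \<open>tsharp_localize\<close> only the part of \<open>f\<close> near the
  parent matters, and the weak type bound applies to it. If the cell meets \<open>E\<close>, the
  maximal function at one point bounds that part; the arc of radius \<open>3 * r\<close>, with
  \<open>r\<close> the length of the parent, gives \<open>2 * 3 * r\<close>, which is 12 cell
  lengths.\<close>

lemma tsharp_good_lambda:
  assumes weak: "\<And>f s. f \<in> borel_measurable circle \<Longrightarrow> s > 0 \<Longrightarrow>
      emeasure circle {z \<in> space circle. tsharp f z > ennreal s}
        \<le> ennreal ((B / s) powr q) * (\<integral>\<^sup>+z. ennpowr (ennreal (norm (f z))) q \<partial>circle)"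
    and B: "B > 0" and f: "integrable circle f" and l: "l > 0" and g: "g > 0"
  shows "emeasure circle {z \<in> space circle. tsharp f z > ennreal (2 * l)
      \<and> hlmax (\<lambda>u. ennpowr (ennreal (norm (f u))) q) z \<le> ennreal ((g * l) powr q)}
    \<le> ennreal (12 * (B * g) powr q) * emeasure circle {z \<in> space circle. tsharp f z > ennreal l}"
proof -
  have [measurable]: "f \<in> borel_measurable circle" using f by auto
  define M where "M = hlmax (\<lambda>u. ennpowr (ennreal (norm (f u))) q)"
  have [measurable]: "M \<in> borel_measurable circle" unfolding M_def by measurable
  define \<eta> where "\<eta> = ennreal (12 * (B * g) powr q)"
  define V where "V n z = tsharp_cell n f (cell_index n z)" for n z
  have [measurable]: "V n \<in> borel_measurable circle" for n
    unfolding V_def by (rule measurable_compose[OF cell_index_measurable]) simp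
  define E where "E = {z \<in> space circle. tsharp f z > ennreal (2 * l) \<and> M z \<le> ennreal ((g * l) powr q)}"
  have [measurable]: "E \<in> sets circle" unfolding E_def by measurable
  \<comment> \<open>A stopping time: \<open>A n\<close> consists of whole cells of generation
    \<open>n\<close>, because \<open>V j\<close> with \<open>j \<le> n\<close> is constant on such a
    cell.\<close>
  define A where "A n = {z \<in> space circle. V n z > ennreal l \<and> (\<forall>j<n. V j z \<le> ennreal l)}" for n
  have [measurable]: "A n \<in> sets circle" for n unfolding A_def by measurable
  have disj: "disjoint_family A"
    unfolding disjoint_family_on_def A_def by (auto, metis linorder_neqE_nat not_le)
  have l2: "ennreal l < ennreal (2 * l)" using l by (simp add: ennreal_less_iff)
  have EA: "E \<subseteq> (\<Union>n. A n)"
  proof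
    fix z assume z: "z \<in> E"
    then have "ennreal l < tsharp f z" using l2 by (auto simp: E_def)
    then have ex: "\<exists>n. ennreal l < V n z" by (auto simp: tsharp_def V_def less_SUP_iff)
    define n where "n = (LEAST n. ennreal l < V n z)"
    have "ennreal l < V n z" unfolding n_def using ex by (rule LeastI_ex)
    moreover have "V j z \<le> ennreal l" if "j < n" for j
      using not_less_Least[of j "\<lambda>n. ennreal l < V n z"] that by (simp add: n_def not_less)
    ultimately show "z \<in> (\<Union>n. A n)" using z by (auto simp: A_def E_def)
  qed
  have cellA: "cell n k \<subseteq> A n" if "z \<in> A n" "z \<in> cell n k" for n k z
  proof
    fix w assume w: "w \<in> cell n k"
    then have "cell_index j w = cell_index j z" if "j \<le> n" for j
      using \<open>z \<in> cell n k\<close> that by (intro cell_index_coarser[of j n]) (auto simp: cell_def)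
    then have "V j w = V j z" if "j \<le> n" for j using that by (simp add: V_def)
    then show "w \<in> A n" using \<open>z \<in> A n\<close> w by (auto simp: A_def cell_def)
  qed
  have key: "emeasure circle (E \<inter> A n \<inter> cell n k) \<le> \<eta> * emeasure circle (A n \<inter> cell n k)" for n k
  proof (cases "E \<inter> A n \<inter> cell n k = {}")
    case False
    then obtain z where z: "z \<in> E" "z \<in> A n" "z \<in> cell n k" by auto
    have "n \<noteq> 0"
    proof
      assume "n = 0"
      then have "V n z = 0" by (simp add: V_def tsharp_cell_0)
      then show False using z by (simp add: A_def)
    qed
    then obtain n' where n': "n = Suc n'" by (cases n) auto
    define p where "p = cell_index n' z"
    define c where "c = cell_end n' p"
    define r where "r = cell_length n'"
    have r: "r > 0" "r = 2 * cell_length n"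
      unfolding r_def n' by (rule cell_length_pos, rule cell_length_Suc)
    have zs: "z \<in> space circle" using z by (simp add: cell_def)
    have zp: "z \<in> cell n' p" using zs by (simp add: p_def cell_def)
    define f1 where "f1 = near c (2 * r) f"
    have [measurable]: "f1 \<in> borel_measurable circle" unfolding f1_def by measurable
    have "E \<inter> A n \<inter> cell n k \<subseteq> {x \<in> space circle. tsharp f1 x > ennreal l}"
    proof
      fix x assume x: "x \<in> E \<inter> A n \<inter> cell n k"
      then have "cell_index n x = cell_index n z" using z by (simp add: cell_def)
      then have "cell_index n' x = p" unfolding p_def n' by (rule cell_index_parent)
      then have "ennreal l < tsharp f1 x"
        using tsharp_localize[OF f _ l, of x n'] x n' by (auto simp: f1_def c_def r_def E_def A_def V_def)
      then show "x \<in> {x \<in> space circle. tsharp f1 x > ennreal l}" using x by (auto simp: E_def)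
    qed
    then have "emeasure circle (E \<inter> A n \<inter> cell n k) \<le> emeasure circle {x \<in> space circle. tsharp f1 x > ennreal l}"
      by (intro emeasure_mono) auto
    also have "\<dots> \<le> ennreal ((B / l) powr q) * (\<integral>\<^sup>+z. ennpowr (ennreal (norm (f1 z))) q \<partial>circle)"
      using l by (intro weak) auto
    also have "(\<integral>\<^sup>+z. ennpowr (ennreal (norm (f1 z))) q \<partial>circle) \<le> (\<integral>\<^sup>+w\<in>carc z (3 * r). ennpowr (ennreal (norm (f w))) q \<partial>circle)"
    proof (intro nn_integral_mono)
      fix w assume w: "w \<in> space circle"
      have "dist w z \<le> 3 * r" if "dist w c \<le> 2 * r"
        using that dist_cell_end[OF zp] dist_triangle2[of w z c] by (simp add: c_def r_def)
      then show "ennpowr (ennreal (norm (f1 w))) q \<le> ennpowr (ennreal (norm (f w))) q * indicator (carc z (3 * r)) w"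
        using w by (auto simp: f1_def near_def indicator_carc)
    qed
    also have "\<dots> \<le> ennreal (2 * (3 * r)) * M z"
      unfolding M_def using r by (intro carc_integral_le_hlmax) auto
    also have "M z \<le> ennreal ((g * l) powr q)" using z by (simp add: E_def)
    finally have "emeasure circle (E \<inter> A n \<inter> cell n k) \<le> ennreal ((B / l) powr q) * (ennreal (2 * (3 * r)) * ennreal ((g * l) powr q))"
      by (simp add: mult_left_mono)
    also have "\<dots> = ennreal ((B / l) powr q * (2 * (3 * r) * (g * l) powr q))"
      using r by (simp add: ennreal_mult)
    also have "(B / l) powr q * (2 * (3 * r) * (g * l) powr q) = 12 * (B * g) powr q * cell_length n"
      using B l g r by (simp add: powr_divide powr_mult)
    also have "ennreal (12 * (B * g) powr q * cell_length n) = \<eta> * ennreal (cell_length n)"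
      unfolding \<eta>_def by (rule ennreal_mult) auto
    also have "ennreal (cell_length n) = emeasure circle (A n \<inter> cell n k)"
      using cellA[OF z(2,3)] emeasure_cell[OF cell_nonempty_index[OF z(3)]] by (simp add: Int_absorb1)
    finally show ?thesis .
  qed simp
  have finite_sum: "emeasure circle Z = (\<Sum>k\<in>{1..2 ^ n}. emeasure circle (Z \<inter> cell n k))" if [measurable]: "Z \<in> sets circle" for Z n
  proof -
    have "Z = (\<Union>k\<in>{1..2 ^ n}. Z \<inter> cell n k)"
      using cell_index_bounds[of n] sets.sets_into_space[OF that] by (auto simp: cell_def)
    then have "emeasure circle Z = emeasure circle (\<Union>k\<in>{1..2 ^ n}. Z \<inter> cell n k)" by simp
    also have "\<dots> = (\<Sum>k\<in>{1..2 ^ n}. emeasure circle (Z \<inter> cell n k))"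
      by (rule sum_emeasure[symmetric]) (auto simp: disjoint_family_on_def cell_def)
    finally show ?thesis .
  qed
  have keyA: "emeasure circle (E \<inter> A n) \<le> \<eta> * emeasure circle (A n)" for n
  proof -
    have "emeasure circle (E \<inter> A n) = (\<Sum>k\<in>{1..2 ^ n}. emeasure circle (E \<inter> A n \<inter> cell n k))"
      by (rule finite_sum) simp
    also have "\<dots> \<le> (\<Sum>k\<in>{1..2 ^ n}. \<eta> * emeasure circle (A n \<inter> cell n k))"
      by (intro sum_mono key)
    also have "\<dots> = \<eta> * emeasure circle (A n)"
      by (simp add: finite_sum[of "A n" n] sum_distrib_left)
    finally show ?thesis .
  qed
  have "emeasure circle E = emeasure circle (\<Union>n. E \<inter> A n)"
    using EA by (intro arg_cong[where f = "emeasure circle"]) auto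
  also have "\<dots> = (\<Sum>n. emeasure circle (E \<inter> A n))"
    using disj by (intro suminf_emeasure[symmetric]) (auto simp: disjoint_family_on_def)
  also have "\<dots> \<le> (\<Sum>n. \<eta> * emeasure circle (A n))"
    by (intro suminf_le keyA) auto
  also have "\<dots> = \<eta> * emeasure circle (\<Union>n. A n)"
    using disj by (subst suminf_emeasure[symmetric, of A]) auto
  also have "emeasure circle (\<Union>n. A n) \<le> emeasure circle {z \<in> space circle. tsharp f z > ennreal l}"
    by (intro emeasure_mono) (auto simp: A_def V_def tsharp_def less_SUP_iff)
  finally show ?thesis by (simp add: E_def M_def \<eta>_def mult_left_mono)
qed

end

section \<open>From weak type estimates to \<open>L\<^sup>p\<close> bounds\<close>

text \<open>A geometric series over the integers below \<open>log 2 x\<close>, the dyadic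
  counterpart of integrating \<open>t powr (a - 1)\<close> from 0 to \<open>x\<close>.\<close>

lemma count_int_geometric:
  assumes a: "a > 0" and x: "x \<ge> 0"
  shows "(\<integral>\<^sup>+k. ennreal (if 2 powr real_of_int k < x then (2 powr real_of_int k) powr a else 0) \<partial>count_space UNIV)
    \<le> ennreal (x powr a / (1 - 2 powr (- a)))"
proof (cases "x = 0")
  case True
  then have "\<not> 2 powr real_of_int k < x" for k using powr_gt_zero[of 2 "real_of_int k"] by (simp add: not_less)
  then show ?thesis by simp
next
  case False
  with x have x: "x > 0" by simp
  define K where "K = \<lceil>log 2 x\<rceil> - 1"
  have K: "2 powr real_of_int k < x \<longleftrightarrow> k \<le> K" for k
  proof -
    have "2 powr real_of_int k < x \<longleftrightarrow> real_of_int k < log 2 x" using x by (simp add: powr_less_iff)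
    also have "\<dots> \<longleftrightarrow> k \<le> K" unfolding K_def by linarith
    finally show ?thesis .
  qed
  define c where "c = (2 powr real_of_int K) powr a"
  define \<theta> where "\<theta> = 2 powr (- a)"
  have \<theta>: "0 \<le> \<theta>" "\<theta> < 1" using a powr_less_mono[of "-a" 0 2] by (auto simp: \<theta>_def)
  have "(\<integral>\<^sup>+k. ennreal (if 2 powr real_of_int k < x then (2 powr real_of_int k) powr a else 0) \<partial>count_space UNIV)
    = (\<integral>\<^sup>+k. ennreal ((2 powr real_of_int k) powr a) * indicator {..K} k \<partial>count_space UNIV)"
    by (intro nn_integral_cong) (auto simp: K indicator_def)
  also have "\<dots> = (\<integral>\<^sup>+k. ennreal ((2 powr real_of_int k) powr a) \<partial>count_space {..K})"
    by (simp add: nn_integral_count_space_indicator)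
  also have "\<dots> = (\<integral>\<^sup>+j. ennreal ((2 powr real_of_int (K - int j)) powr a) \<partial>count_space UNIV)"
  proof (rule nn_integral_bij_count_space[symmetric])
    show "bij_betw (\<lambda>j. K - int j) UNIV {..K}"
      by (rule bij_betw_byWitness[where f' = "\<lambda>k. nat (K - k)"]) auto
  qed
  also have "\<dots> = (\<Sum>j. ennreal (c * \<theta> ^ j) * 1)"
  proof -
    have "(2 powr real_of_int (K - int j)) powr a = c * \<theta> ^ j" for j
    proof -
      have "\<theta> ^ j = 2 powr (- a * real j)" by (simp add: \<theta>_def powr_powr flip: powr_realpow)
      then show ?thesis by (simp add: c_def powr_powr algebra_simps flip: powr_add)
    qed
    then show ?thesis by (simp add: nn_integral_count_space_nat)
  qed
  also have "\<dots> = ennreal (c / (1 - \<theta>)) * 1"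
    using \<theta> by (intro suminf_geometric_ennreal) (auto simp: c_def)
  also have "\<dots> \<le> ennreal (x powr a / (1 - \<theta>))"
    using \<theta> K[of K] a by (auto simp: c_def intro!: ennreal_leI divide_right_mono powr_mono2)
  finally show ?thesis by (simp add: \<theta>_def)
qed

text \<open>A dyadic layer-cake bound: for finite \<open>u > 0\<close> the largest power of 2
  strictly below \<open>u\<close> is enough by itself, and for \<open>u = \<infinity>\<close> the
  sum diverges.\<close>

lemma ennpowr_le_dyadic_sum:
  assumes p: "p > 0"
  shows "ennpowr u p \<le> ennreal (2 powr p) *
    (\<integral>\<^sup>+k. ennreal ((2 powr real_of_int k) powr p) * (if ennreal (2 powr real_of_int k) < u then 1 else 0) \<partial>count_space UNIV)"
    (is "_ \<le> _ * ?S")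
proof -
  have pt: "ennreal ((2 powr real_of_int k) powr p) \<le> ?S" if "ennreal (2 powr real_of_int k) < u" for k
    using nn_integral_ge_point[of k UNIV "\<lambda>k. ennreal ((2 powr real_of_int k) powr p) * (if ennreal (2 powr real_of_int k) < u then 1 else 0)"] that
    by simp
  show ?thesis
  proof (cases u)
    case (real x)
    show ?thesis
    proof (cases "x = 0")
      case False
      with real have x: "x > 0" by simp
      define k where "k = \<lceil>log 2 x\<rceil> - 1"
      have "real_of_int k < log 2 x" "log 2 x \<le> real_of_int k + 1" unfolding k_def by linarith+
      then have k: "2 powr real_of_int k < x" "x \<le> 2 powr (real_of_int k + 1)"
        using x by (auto simp: powr_less_iff log_le_iff)
      then have x2: "x \<le> 2 * 2 powr real_of_int k" by (simp add: powr_add)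
      have "ennpowr u p = ennreal (x powr p)" using real x by (simp add: ennpowr_ennreal)
      also have "\<dots> \<le> ennreal ((2 * 2 powr real_of_int k) powr p)"
        using x2 x p by (intro ennreal_leI powr_mono2) auto
      also have "\<dots> = ennreal (2 powr p) * ennreal ((2 powr real_of_int k) powr p)"
        by (simp add: powr_mult ennreal_mult)
      also have "\<dots> \<le> ennreal (2 powr p) * ?S"
        using k real by (intro mult_left_mono pt) (auto simp: ennreal_less_iff)
      finally show ?thesis .
    qed (use real in simp)
  next
    case top
    have "?S = top"
    proof (rule ccontr)
      assume "?S \<noteq> top"
      then obtain s where s: "?S = ennreal s" "s \<ge> 0" by (cases ?S) auto
      define k where "k = \<lceil>log 2 (s + 1) / p\<rceil>"
      have "log 2 (s + 1) / p \<le> real_of_int k" by (simp add: k_def)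
      then have "log 2 (s + 1) \<le> real_of_int k * p" using p by (simp add: field_simps)
      then have "s + 1 \<le> (2 powr real_of_int k) powr p"
        using s by (simp add: powr_powr log_le_iff)
      moreover have "ennreal ((2 powr real_of_int k) powr p) \<le> ennreal s"
        using pt[of k] top s by (simp add: less_top)
      ultimately show False using s by simp
    qed
    then show ?thesis by (simp add: ennreal_mult_top)
  qed
qed

lemma nn_integral_le_dyadic_sum:
  assumes [measurable]: "F \<in> borel_measurable circle" and p: "p > 0"
  shows "(\<integral>\<^sup>+z. ennpowr (F z) p \<partial>circle) \<le> ennreal (2 powr p) *
    (\<integral>\<^sup>+k. ennreal ((2 powr real_of_int k) powr p) * emeasure circle {z \<in> space circle. F z > ennreal (2 powr real_of_int k)} \<partial>count_space UNIV)"
proof -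
  have "(\<integral>\<^sup>+z. ennpowr (F z) p \<partial>circle) \<le> (\<integral>\<^sup>+z. ennreal (2 powr p) *
    (\<integral>\<^sup>+k. ennreal ((2 powr real_of_int k) powr p) * (if ennreal (2 powr real_of_int k) < F z then 1 else 0) \<partial>count_space UNIV) \<partial>circle)"
    by (intro nn_integral_mono ennpowr_le_dyadic_sum p)
  also have "\<dots> = (\<integral>\<^sup>+z. (\<integral>\<^sup>+k. ennreal (2 powr p) * (ennreal ((2 powr real_of_int k) powr p) * (if ennreal (2 powr real_of_int k) < F z then 1 else 0)) \<partial>count_space UNIV) \<partial>circle)"
    by (simp add: nn_integral_cmult)
  also have "\<dots> = (\<integral>\<^sup>+k. (\<integral>\<^sup>+z. ennreal (2 powr p) * (ennreal ((2 powr real_of_int k) powr p) * (if ennreal (2 powr real_of_int k) < F z then 1 else 0)) \<partial>circle) \<partial>count_space UNIV)"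
    by (rule nn_integral_count_space_nn_integral) auto
  also have "\<dots> = (\<integral>\<^sup>+k. ennreal (2 powr p) * (ennreal ((2 powr real_of_int k) powr p) * emeasure circle {z \<in> space circle. F z > ennreal (2 powr real_of_int k)}) \<partial>count_space UNIV)"
  proof (rule nn_integral_cong)
    fix k :: int
    have "(\<integral>\<^sup>+z. (if ennreal (2 powr real_of_int k) < F z then 1 else 0) \<partial>circle)
      = (\<integral>\<^sup>+z. indicator {z \<in> space circle. F z > ennreal (2 powr real_of_int k)} z \<partial>circle)"
      by (intro nn_integral_cong) (auto simp: indicator_def)
    then show "(\<integral>\<^sup>+z. ennreal (2 powr p) * (ennreal ((2 powr real_of_int k) powr p) * (if ennreal (2 powr real_of_int k) < F z then 1 else 0)) \<partial>circle)
      = ennreal (2 powr p) * (ennreal ((2 powr real_of_int k) powr p) * emeasure circle {z \<in> space circle. F z > ennreal (2 powr real_of_int k)})"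
      by (simp add: nn_integral_cmult)
  qed
  finally show ?thesis by (simp add: nn_integral_cmult)
qed

text \<open>The factor \<open>2 powr (- p - 1)\<close> is chosen so that shifting the dyadic sum by
  one step, which costs \<open>2 powr p\<close>, leaves half of the sum to be absorbed. Absorption
  requires finiteness, hence the sums \<open>D n\<close> over levels below \<open>n\<close>, which
  are finite because the circle has finite length.\<close>

lemma good_lambda_Lp:
  assumes [measurable]: "F \<in> borel_measurable circle" and p: "p > 0"
    and good: "\<And>l. l > 0 \<Longrightarrow> emeasure circle {z \<in> space circle. F z > ennreal (2 * l)}
      \<le> ennreal (2 powr (- p - 1)) * emeasure circle {z \<in> space circle. F z > ennreal l} + Y l"
  shows "(\<integral>\<^sup>+z. ennpowr (F z) p \<partial>circle) \<le> ennreal (2 powr (2 * p + 1)) *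
    (\<integral>\<^sup>+k. ennreal ((2 powr real_of_int k) powr p) * Y (2 powr real_of_int k) \<partial>count_space UNIV)"
proof -
  define t where "t k = 2 powr real_of_int k" for k :: int
  have t: "t k > 0" "t (k + 1) = 2 * t k" for k by (auto simp: t_def powr_add)
  define \<mu> where "\<mu> l = emeasure circle {z \<in> space circle. F z > ennreal l}" for l
  define Z where "Z = (\<integral>\<^sup>+k. ennreal (t k powr p) * Y (t k) \<partial>count_space UNIV)"
  define D where "D n = (\<integral>\<^sup>+k. ennreal (if t k < real n then t k powr p else 0) * \<mu> (t k) \<partial>count_space UNIV)" for n :: nat
  have Dle: "D n \<le> ennreal (2 * 2 powr p) * Z" for n
  proof -
    have "D n \<le> (\<integral>\<^sup>+k. ennreal (if t k < real n then t k powr p else 0) * ennreal (2 * pi) \<partial>count_space UNIV)"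
      unfolding D_def \<mu>_def by (intro nn_integral_mono mult_left_mono emeasure_circle_le) auto
    also have "\<dots> = (\<integral>\<^sup>+k. ennreal (if t k < real n then t k powr p else 0) \<partial>count_space UNIV) * ennreal (2 * pi)"
      by (rule nn_integral_multc) simp
    also have "\<dots> \<le> ennreal (real n powr p / (1 - 2 powr (- p))) * ennreal (2 * pi)"
      unfolding t_def by (intro mult_right_mono count_int_geometric p) auto
    also have "\<dots> < top" by (simp add: ennreal_mult_less_top)
    finally have fin: "D n < top" .
    have "D n = (\<integral>\<^sup>+k. ennreal (if t (k + 1) < real n then t (k + 1) powr p else 0) * \<mu> (t (k + 1)) \<partial>count_space UNIV)"
      unfolding D_def
      by (rule nn_integral_bij_count_space[symmetric, where g = "\<lambda>k. k + 1"])
         (rule bij_betw_byWitness[where f' = "\<lambda>k. k - 1"], auto)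
    also have "\<dots> \<le> (\<integral>\<^sup>+k. ennreal (1 / 2) * (ennreal (if t k < real n then t k powr p else 0) * \<mu> (t k))
        + ennreal (2 powr p) * (ennreal (t k powr p) * Y (t k)) \<partial>count_space UNIV)"
    proof (rule nn_integral_mono)
      fix k :: int
      show "ennreal (if t (k + 1) < real n then t (k + 1) powr p else 0) * \<mu> (t (k + 1))
        \<le> ennreal (1 / 2) * (ennreal (if t k < real n then t k powr p else 0) * \<mu> (t k))
        + ennreal (2 powr p) * (ennreal (t k powr p) * Y (t k))"
      proof (cases "t (k + 1) < real n")
        case True
        then have tn: "t k < real n" using t[of k] by linarith
        have "ennreal (t (k + 1) powr p) * \<mu> (t (k + 1))
          \<le> ennreal (2 powr p * t k powr p) * (ennreal (2 powr (- p - 1)) * \<mu> (t k) + Y (t k))"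
          using good[OF t(1)[of k]] t[of k] by (auto simp: \<mu>_def powr_mult intro!: mult_left_mono)
        also have "\<dots> = ennreal (2 powr p * t k powr p) * ennreal (2 powr (- p - 1)) * \<mu> (t k) + ennreal (2 powr p * t k powr p) * Y (t k)"
          by (simp add: distrib_left mult.assoc)
        also have "ennreal (2 powr p * t k powr p) * ennreal (2 powr (- p - 1)) = ennreal (1 / 2) * ennreal (t k powr p)"
        proof -
          have "2 powr p * t k powr p * 2 powr (- p - 1) = 1 / 2 * t k powr p"
            by (simp add: powr_diff powr_minus field_simps)
          then show ?thesis by (metis ennreal_mult powr_ge_zero mult_nonneg_nonneg zero_le_divide_1_iff zero_le_numeral)
        qed
        also have "ennreal (2 powr p * t k powr p) = ennreal (2 powr p) * ennreal (t k powr p)"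
          by (rule ennreal_mult) auto
        finally show ?thesis using True tn by (simp add: mult.assoc)
      qed simp
    qed
    also have "\<dots> = ennreal (1 / 2) * D n + ennreal (2 powr p) * Z"
      unfolding D_def Z_def by (subst nn_integral_add) (auto simp: nn_integral_cmult)
    finally have le: "D n \<le> ennreal (1 / 2) * D n + ennreal (2 powr p) * Z" .
    show ?thesis
    proof (cases Z)
      case (real z)
      obtain d where d: "D n = ennreal d" "d \<ge> 0" using fin by (cases "D n") auto
      have "d \<le> 1 / 2 * d + 2 powr p * z"
      proof -
        have "ennreal (1 / 2 * d + 2 powr p * z) = ennreal (1 / 2 * d) + ennreal (2 powr p * z)"
          using d real by (intro ennreal_plus) auto
        also have "\<dots> = ennreal (1 / 2) * ennreal d + ennreal (2 powr p) * ennreal z"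
          using d real by (intro arg_cong2[where f = plus] ennreal_mult) auto
        finally have "ennreal d \<le> ennreal (1 / 2 * d + 2 powr p * z)" using le d real by simp
        then show ?thesis using d real by (subst (asm) ennreal_le_iff) auto
      qed
      then have "d \<le> 2 * 2 powr p * z" by simp
      then show ?thesis using d real by (simp flip: ennreal_mult)
    qed (simp add: ennreal_mult_top)
  qed
  have "(\<integral>\<^sup>+k. ennreal (t k powr p) * \<mu> (t k) \<partial>count_space UNIV)
    = (\<integral>\<^sup>+k. (SUP n. ennreal (if t k < real n then t k powr p else 0) * \<mu> (t k)) \<partial>count_space UNIV)"
  proof (rule nn_integral_cong)
    fix k :: int
    obtain n :: nat where n: "t k < real n" using reals_Archimedean2 by blast
    show "ennreal (t k powr p) * \<mu> (t k) = (SUP n. ennreal (if t k < real n then t k powr p else 0) * \<mu> (t k))"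
    proof (rule antisym)
      show "ennreal (t k powr p) * \<mu> (t k) \<le> (SUP n. ennreal (if t k < real n then t k powr p else 0) * \<mu> (t k))"
        using n by (intro SUP_upper2[of n]) auto
    qed (auto intro!: SUP_least)
  qed
  also have "\<dots> = (SUP n. D n)"
    unfolding D_def
    by (intro nn_integral_monotone_convergence_SUP) (auto simp: incseq_def le_fun_def intro!: mult_right_mono)
  also have "\<dots> \<le> ennreal (2 * 2 powr p) * Z" by (intro SUP_least Dle)
  finally have "ennreal (2 powr p) * (\<integral>\<^sup>+k. ennreal (t k powr p) * \<mu> (t k) \<partial>count_space UNIV)
    \<le> ennreal (2 powr p) * (ennreal (2 * 2 powr p) * Z)"
    by (rule mult_left_mono) simp
  also have "\<dots> = ennreal (2 powr (2 * p + 1)) * Z"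
  proof -
    have "ennreal (2 powr p) * ennreal (2 * 2 powr p) = ennreal (2 powr (2 * p + 1))"
    proof -
      have "(2::real) powr (2 * p + 1) = 2 powr (p + (1 + p))" by (rule arg_cong[where f = "(powr) 2"]) simp
      also have "\<dots> = 2 powr p * (2 * 2 powr p)" by (simp only: powr_add powr_one zero_le_numeral)
      finally show ?thesis by (simp only: ennreal_mult[symmetric] powr_ge_zero mult_nonneg_nonneg zero_le_numeral)
    qed
    then show ?thesis by (simp only: mult.assoc[symmetric])
  qed
  finally show ?thesis
    using nn_integral_le_dyadic_sum[OF assms(1) p] by (simp add: t_def \<mu>_def Z_def)
qed

text \<open>A Marcinkiewicz constant: 70 and 14 come from \<open>hlmax_weak_type_truncated\<close>,
  and the denominator from a geometric series of ratio \<open>2 powr (q - p)\<close>, which makes it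
  blow up as \<open>q\<close> approaches \<open>p\<close>.\<close>

definition Kmax :: "real \<Rightarrow> real \<Rightarrow> real" where
  "Kmax q p = 70 * 14 powr (p - q) / (1 - 2 powr (q - p))"

lemma Kmax_pos: "q < p \<Longrightarrow> Kmax q p > 0"
  using powr_less_mono[of "q - p" 0 2] by (auto simp: Kmax_def)

text \<open>Marcinkiewicz interpolation in dyadic form: the truncated weak type bound is inserted,
  sum and integral are exchanged, and \<open>t k powr (p - q)\<close> is summed over the levels with
  \<open>t k < 14 * norm (f u) / g\<close>. The dilation \<open>g\<close> will be the small
  parameter of the good-lambda inequality.\<close>

lemma hlmax_dyadic_sum:
  fixes f :: "complex \<Rightarrow> complex"
  assumes [measurable]: "f \<in> borel_measurable circle" and q: "1 \<le> q" "q < p" and g: "g > 0"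
  shows "(\<integral>\<^sup>+k. ennreal ((2 powr real_of_int k) powr p) * emeasure circle {z \<in> space circle.
      hlmax (\<lambda>u. ennpowr (ennreal (norm (f u))) q) z > ennreal ((g * 2 powr real_of_int k) powr q)} \<partial>count_space UNIV)
    \<le> ennreal (Kmax q p * g powr (- p)) * (\<integral>\<^sup>+z. ennpowr (ennreal (norm (f z))) p \<partial>circle)"
proof -
  define t where "t k = 2 powr real_of_int k" for k :: int
  have t: "t k > 0" for k by (auto simp: t_def)
  define F where "F u = ennpowr (ennreal (norm (f u))) q" for u
  have [measurable]: "F \<in> borel_measurable circle" unfolding F_def by measurable
  have "(\<integral>\<^sup>+k. ennreal (t k powr p) * emeasure circle {z \<in> space circle. hlmax F z > ennreal ((g * t k) powr q)} \<partial>count_space UNIV)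
    \<le> (\<integral>\<^sup>+k. (\<integral>\<^sup>+u. ennreal (70 * g powr (- q)) * (F u * ennreal (if t k < 14 * norm (f u) / g then t k powr (p - q) else 0)) \<partial>circle) \<partial>count_space UNIV)"
  proof (rule nn_integral_mono)
    fix k :: int
    have gt: "g * t k > 0" using g t by simp
    have "emeasure circle {z \<in> space circle. hlmax F z > ennreal ((g * t k) powr q)}
      \<le> ennreal (70 / (g * t k) powr q) * (\<integral>\<^sup>+u\<in>{u. F u > ennreal ((g * t k) powr q / 14)}. F u \<partial>circle)"
      using gt by (intro hlmax_weak_type_truncated) auto
    also have "(\<integral>\<^sup>+u\<in>{u. F u > ennreal ((g * t k) powr q / 14)}. F u \<partial>circle)
      \<le> (\<integral>\<^sup>+u. F u * (if t k < 14 * norm (f u) / g then 1 else 0) \<partial>circle)"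
    proof (intro nn_integral_mono)
      fix u
      have "t k < 14 * norm (f u) / g" if "F u > ennreal ((g * t k) powr q / 14)"
      proof -
        have "(g * t k) powr q / 14 < norm (f u) powr q"
          using that gt by (simp add: F_def ennpowr_ennreal ennreal_less_iff)
        \<comment> \<open>As \<open>q \<ge> 1\<close>, the divisor 14 may be taken inside the
          power.\<close>
        moreover have "(g * t k / 14) powr q \<le> (g * t k) powr q / 14"
        proof -
          have "14 powr 1 \<le> 14 powr q" using q by (intro powr_mono) auto
          then have "(14::real) \<le> 14 powr q" by simp
          then have "(g * t k) powr q / 14 powr q \<le> (g * t k) powr q / 14"
            by (intro divide_left_mono) auto
          then show ?thesis using gt by (subst powr_divide) auto
        qed
        ultimately have "(g * t k / 14) powr q < norm (f u) powr q" by linarith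
        then have "g * t k / 14 < norm (f u)"
          using gt q powr_mono2[of q "norm (f u)" "g * t k / 14"] by (force simp: not_le[symmetric])
        then show ?thesis using g by (simp add: field_simps)
      qed
      then show "F u * indicator {u. F u > ennreal ((g * t k) powr q / 14)} u \<le> F u * (if t k < 14 * norm (f u) / g then 1 else 0)"
        by (auto simp: indicator_def)
    qed
    finally have "ennreal (t k powr p) * emeasure circle {z \<in> space circle. hlmax F z > ennreal ((g * t k) powr q)}
      \<le> ennreal (t k powr p) * (ennreal (70 / (g * t k) powr q) * (\<integral>\<^sup>+u. F u * (if t k < 14 * norm (f u) / g then 1 else 0) \<partial>circle))"
      by (simp add: mult_left_mono)
    also have "\<dots> = ennreal (t k powr p * (70 / (g * t k) powr q)) * (\<integral>\<^sup>+u. F u * (if t k < 14 * norm (f u) / g then 1 else 0) \<partial>circle)"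
    proof -
      have "ennreal (t k powr p * (70 / (g * t k) powr q)) = ennreal (t k powr p) * ennreal (70 / (g * t k) powr q)"
        by (rule ennreal_mult) auto
      then show ?thesis by (simp only: mult.assoc)
    qed
    also have "t k powr p * (70 / (g * t k) powr q) = 70 * g powr (- q) * t k powr (p - q)"
      using g t[of k] by (simp add: powr_mult powr_diff powr_minus field_simps)
    also have "ennreal (70 * g powr (- q) * t k powr (p - q)) * (\<integral>\<^sup>+u. F u * (if t k < 14 * norm (f u) / g then 1 else 0) \<partial>circle)
      = (\<integral>\<^sup>+u. ennreal (70 * g powr (- q) * t k powr (p - q)) * (F u * (if t k < 14 * norm (f u) / g then 1 else 0)) \<partial>circle)"
      by (rule nn_integral_cmult[symmetric]) measurable
    also have "\<dots> = (\<integral>\<^sup>+u. ennreal (70 * g powr (- q)) * (F u * ennreal (if t k < 14 * norm (f u) / g then t k powr (p - q) else 0)) \<partial>circle)"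
      by (intro nn_integral_cong) (auto simp: ennreal_mult mult_ac)
    finally show "ennreal (t k powr p) * emeasure circle {z \<in> space circle. hlmax F z > ennreal ((g * t k) powr q)} \<le> \<dots>" .
  qed
  also have "\<dots> = (\<integral>\<^sup>+u. (\<integral>\<^sup>+k. ennreal (70 * g powr (- q)) * (F u * ennreal (if t k < 14 * norm (f u) / g then t k powr (p - q) else 0)) \<partial>count_space UNIV) \<partial>circle)"
    by (rule nn_integral_count_space_nn_integral[symmetric]) auto
  also have "\<dots> \<le> (\<integral>\<^sup>+u. ennreal (Kmax q p * g powr (- p)) * ennpowr (ennreal (norm (f u))) p \<partial>circle)"
  proof (rule nn_integral_mono)
    fix u
    define x where "x = norm (f u)"
    have x: "x \<ge> 0" by (simp add: x_def)
    have K1: "1 - 2 powr (q - p) > 0" using q powr_less_mono[of "q - p" 0 2] by auto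
    have "(\<integral>\<^sup>+k. ennreal (70 * g powr (- q)) * (F u * ennreal (if t k < 14 * norm (f u) / g then t k powr (p - q) else 0)) \<partial>count_space UNIV)
      = ennreal (70 * g powr (- q)) * (F u * (\<integral>\<^sup>+k. ennreal (if t k < 14 * norm (f u) / g then t k powr (p - q) else 0) \<partial>count_space UNIV))"
      by (simp add: nn_integral_cmult)
    also have "\<dots> \<le> ennreal (70 * g powr (- q)) * (F u * ennreal ((14 * norm (f u) / g) powr (p - q) / (1 - 2 powr (- (p - q)))))"
      unfolding t_def using q g by (intro mult_left_mono count_int_geometric) auto
    also have "\<dots> = ennreal (70 * g powr (- q) * (x powr q * ((14 * x / g) powr (p - q) / (1 - 2 powr (q - p)))))"
    proof -
      have "F u = ennreal (x powr q)" by (simp add: F_def ennpowr_ennreal x_def)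
      then show ?thesis using K1 by (subst ennreal_mult3) (auto simp: x_def)
    qed
    also have "70 * g powr (- q) * (x powr q * ((14 * x / g) powr (p - q) / (1 - 2 powr (q - p)))) = Kmax q p * g powr (- p) * x powr p"
    proof -
      have X: "x powr q * (14 * x / g) powr (p - q) = 14 powr (p - q) * g powr (- (p - q)) * x powr p"
      proof (cases "x = 0")
        case False
        with x have "x powr q * x powr (p - q) = x powr p" by (simp flip: powr_add)
        moreover have "(14 * x / g) powr (p - q) = 14 powr (p - q) * x powr (p - q) * g powr (- (p - q))"
          using powr_divide[of "14 * x" g "p - q"] powr_mult[of 14 x "p - q"] powr_minus[of g "p - q"] x g
          by (simp add: divide_inverse)
        moreover have "x powr q * (14 powr (p - q) * x powr (p - q) * g powr (- (p - q)))
          = 14 powr (p - q) * g powr (- (p - q)) * (x powr q * x powr (p - q))"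
          by (simp only: mult_ac)
        ultimately show ?thesis by (simp only:)
      qed simp
      have G: "g powr (- q) * g powr (- (p - q)) = g powr (- p)" using g by (simp flip: powr_add)
      have ring: "70 * a * (b * (y / d)) = 70 * c / d * e * h"
        if "b * y = c * k * h" "a * k = e" for a b y d c e h k :: real
      proof -
        have "70 * a * (b * (y / d)) = 70 * a * (b * y) / d" by simp
        also have "\<dots> = 70 * c / d * (a * k) * h" unfolding that(1) by simp
        finally show ?thesis unfolding that(2) .
      qed
      show ?thesis unfolding Kmax_def by (rule ring[OF X G])
    qed
    finally show "(\<integral>\<^sup>+k. ennreal (70 * g powr (- q)) * (F u * ennreal (if t k < 14 * norm (f u) / g then t k powr (p - q) else 0)) \<partial>count_space UNIV)
      \<le> ennreal (Kmax q p * g powr (- p)) * ennpowr (ennreal (norm (f u))) p"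
      using Kmax_pos[OF q(2)] g by (simp add: ennpowr_ennreal x_def ennreal_mult)
  qed
  also have "\<dots> = ennreal (Kmax q p * g powr (- p)) * (\<integral>\<^sup>+u. ennpowr (ennreal (norm (f u))) p \<partial>circle)"
    by (rule nn_integral_cmult) measurable
  finally show ?thesis by (simp add: t_def F_def[abs_def])
qed

lemma hlmax_Lp:
  fixes f :: "complex \<Rightarrow> complex"
  assumes [measurable]: "f \<in> borel_measurable circle" and p: "1 < p"
  shows "(\<integral>\<^sup>+z. ennpowr (hlmax (\<lambda>u. ennreal (norm (f u))) z) p \<partial>circle)
    \<le> ennreal (2 powr p * Kmax 1 p) * (\<integral>\<^sup>+z. ennpowr (ennreal (norm (f z))) p \<partial>circle)"
proof -
  have "(\<integral>\<^sup>+z. ennpowr (hlmax (\<lambda>u. ennreal (norm (f u))) z) p \<partial>circle) \<le> ennreal (2 powr p) *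
    (\<integral>\<^sup>+k. ennreal ((2 powr real_of_int k) powr p) * emeasure circle {z \<in> space circle.
      hlmax (\<lambda>u. ennreal (norm (f u))) z > ennreal (2 powr real_of_int k)} \<partial>count_space UNIV)"
    using p by (intro nn_integral_le_dyadic_sum) auto
  also have "\<dots> \<le> ennreal (2 powr p) * (ennreal (Kmax 1 p) * (\<integral>\<^sup>+z. ennpowr (ennreal (norm (f z))) p \<partial>circle))"
    using hlmax_dyadic_sum[of f 1 p 1] p by (intro mult_left_mono) auto
  also have "\<dots> = ennreal (2 powr p * Kmax 1 p) * (\<integral>\<^sup>+z. ennpowr (ennreal (norm (f z))) p \<partial>circle)"
    using Kmax_pos[OF p] by (simp add: ennreal_mult mult.assoc)
  finally show ?thesis .
qed

text \<open>The base of the power \<open>- p\<close> is the good-lambda parameter \<open>g\<close>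
  for \<open>A = 1\<close>: its numerator solves \<open>12 * x powr q = 2 powr (- p - 1)\<close>,
  and its denominator is the weak type constant obtained from \<open>tsharp_weak\<close>, with 2800
  = 2 * 1400.\<close>

definition Ksharp :: "real \<Rightarrow> real \<Rightarrow> real" where
  "Ksharp q p = 2 powr (2 * p + 1) * Kmax q p * ((2 powr (- p - 1) / 12) powr (1 / q) / (2800 * 70 powr (1 / q))) powr (- p)"

lemma Ksharp_pos: "q < p \<Longrightarrow> Ksharp q p > 0"
  using Kmax_pos by (auto simp: Ksharp_def)

context multiplier_family
begin

text \<open>With \<open>g\<close> inversely proportional to \<open>A\<close>, the good-lambda
  inequality has the factor required by \<open>good_lambda_Lp\<close>, and the remaining level sets
  are summed by \<open>hlmax_dyadic_sum\<close>. The factor \<open>A powr p\<close> comes from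
  \<open>g powr (- p)\<close>.\<close>

lemma tsharp_Lp:
  assumes q: "1 \<le> q" "q < p" and A: "1 \<le> A"
    and TM_bound: "\<And>f. nice f \<Longrightarrow> (\<integral>\<^sup>+z. ennpowr (TM f z) q \<partial>circle)
      \<le> ennreal (A powr q) * (\<integral>\<^sup>+z. ennpowr (ennreal (norm (f z))) q \<partial>circle)"
    and f: "integrable circle f"
  shows "(\<integral>\<^sup>+z. ennpowr (tsharp f z) p \<partial>circle)
    \<le> ennreal (Ksharp q p * A powr p) * (\<integral>\<^sup>+z. ennpowr (ennreal (norm (f z))) p \<partial>circle)"
proof -
  have [measurable]: "f \<in> borel_measurable circle" using f by auto
  define \<beta> where "\<beta> = 2800 * 70 powr (1 / q)"
  define \<kappa> where "\<kappa> = (2 powr (- p - 1) / 12) powr (1 / q)"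
  define g where "g = \<kappa> / (\<beta> * A)"
  have pos: "\<beta> > 0" "\<kappa> > 0" "g > 0" using A by (auto simp: \<beta>_def \<kappa>_def g_def)
  have weak: "emeasure circle {z \<in> space circle. tsharp f z > ennreal s}
      \<le> ennreal (((\<beta> * A) / s) powr q) * (\<integral>\<^sup>+z. ennpowr (ennreal (norm (f z))) q \<partial>circle)"
    if "f \<in> borel_measurable circle" "s > 0" for f s
  proof -
    have "emeasure circle {z \<in> space circle. tsharp f z > ennreal (1400 * (s / 1400))}
      \<le> ennreal (70 * 2 powr q * (A / (s / 1400)) powr q) * (\<integral>\<^sup>+z. ennpowr (ennreal (norm (f z))) q \<partial>circle)"
      using that by (intro tsharp_weak[OF q(1) A TM_bound]) auto
    also have "70 * 2 powr q * (A / (s / 1400)) powr q = ((\<beta> * A) / s) powr q"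
    proof -
      have "((\<beta> * A) / s) powr q = (70 powr (1 / q)) powr q * (2 * (A / (s / 1400))) powr q"
      proof -
        have "(\<beta> * A) / s = 70 powr (1 / q) * (2 * (A / (s / 1400)))" by (simp add: \<beta>_def)
        then show ?thesis using that A by (simp only: powr_mult[symmetric])
      qed
      moreover have "(70 powr (1 / q)) powr q = 70" using q by (simp add: powr_powr)
      moreover have "(2 * (A / (s / 1400))) powr q = 2 powr q * (A / (s / 1400)) powr q"
        by (rule powr_mult)
      ultimately show ?thesis by (simp only: mult.assoc)
    qed
    finally show ?thesis by simp
  qed
  have eta: "12 * ((\<beta> * A) * g) powr q = 2 powr (- p - 1)"
    using pos A q by (simp add: g_def \<kappa>_def powr_powr)
  define M where "M = hlmax (\<lambda>u. ennpowr (ennreal (norm (f u))) q)"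
  have [measurable]: "M \<in> borel_measurable circle" unfolding M_def by measurable
  have "(\<integral>\<^sup>+z. ennpowr (tsharp f z) p \<partial>circle) \<le> ennreal (2 powr (2 * p + 1)) *
    (\<integral>\<^sup>+k. ennreal ((2 powr real_of_int k) powr p) * emeasure circle {z \<in> space circle. M z > ennreal ((g * 2 powr real_of_int k) powr q)} \<partial>count_space UNIV)"
  proof (rule good_lambda_Lp)
    fix l :: real assume l: "l > 0"
    define E where "E = {z \<in> space circle. tsharp f z > ennreal (2 * l) \<and> M z \<le> ennreal ((g * l) powr q)}"
    define E' where "E' = {z \<in> space circle. M z > ennreal ((g * l) powr q)}"
    have [measurable]: "E \<in> sets circle" "E' \<in> sets circle" by (auto simp: E_def E'_def)
    have "emeasure circle {z \<in> space circle. tsharp f z > ennreal (2 * l)} \<le> emeasure circle (E \<union> E')"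
      by (intro emeasure_mono) (auto simp: E_def E'_def)
    also have "\<dots> \<le> emeasure circle E + emeasure circle E'"
      by (rule emeasure_subadditive) auto
    also have "emeasure circle E \<le> ennreal (12 * ((\<beta> * A) * g) powr q) * emeasure circle {z \<in> space circle. tsharp f z > ennreal l}"
      unfolding E_def M_def using pos A l by (intro tsharp_good_lambda weak f) auto
    finally show "emeasure circle {z \<in> space circle. tsharp f z > ennreal (2 * l)}
      \<le> ennreal (2 powr (- p - 1)) * emeasure circle {z \<in> space circle. tsharp f z > ennreal l}
        + emeasure circle {z \<in> space circle. M z > ennreal ((g * l) powr q)}"
      by (simp add: eta E'_def add_right_mono)
  qed (use q in auto)
  also have "\<dots> \<le> ennreal (2 powr (2 * p + 1)) * (ennreal (Kmax q p * g powr (- p)) * (\<integral>\<^sup>+z. ennpowr (ennreal (norm (f z))) p \<partial>circle))"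
    unfolding M_def by (intro mult_left_mono hlmax_dyadic_sum q pos) auto
  also have "\<dots> = ennreal (2 powr (2 * p + 1) * (Kmax q p * g powr (- p))) * (\<integral>\<^sup>+z. ennpowr (ennreal (norm (f z))) p \<partial>circle)"
    using Kmax_pos[OF q(2)] by (simp add: ennreal_mult mult.assoc)
  also have "2 powr (2 * p + 1) * (Kmax q p * g powr (- p)) = Ksharp q p * A powr p"
  proof -
    have "g powr (- p) = (\<kappa> / \<beta>) powr (- p) * A powr p"
    proof -
      have g': "g = (\<kappa> / \<beta>) / A" by (simp add: g_def)
      have "g powr (- p) = (\<kappa> / \<beta>) powr (- p) / A powr (- p)"
        unfolding g' by (rule powr_divide)
      also have "\<dots> = (\<kappa> / \<beta>) powr (- p) * A powr p"
        using A powr_minus[of A p] by (simp only: divide_inverse inverse_inverse_eq)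
      finally show ?thesis .
    qed
    then show ?thesis by (simp add: Ksharp_def \<kappa>_def \<beta>_def)
  qed
  finally show ?thesis .
qed

text \<open>By \<open>TM_le_tsharp\<close> a majorant of \<open>TM\<close> for integrable
  \<open>f\<close>, and measurable by construction.\<close>

definition TU :: "(complex \<Rightarrow> complex) \<Rightarrow> complex \<Rightarrow> ennreal" where
  "TU f z = tsharp f z + 6 * hlmax (\<lambda>w. ennreal (norm (f w))) z"

lemma TU_measurable [measurable]:
  assumes [measurable]: "f \<in> borel_measurable circle" shows "TU f \<in> borel_measurable circle"
  unfolding TU_def[abs_def] by measurable

end

definition KU :: "real \<Rightarrow> real \<Rightarrow> real" where
  "KU q p = 2 powr p * (Ksharp q p + 6 powr p * (2 powr p * Kmax 1 p))"

lemma KU_pos: "1 \<le> q \<Longrightarrow> q < p \<Longrightarrow> KU q p > 0"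
  using Kmax_pos[of 1 p] Ksharp_pos[of q p] by (auto simp: KU_def intro!: mult_pos_pos add_pos_nonneg)

text \<open>As \<open>A \<ge> 1\<close>, the bound for the maximal function, which does not involve
  \<open>A\<close>, may be multiplied by \<open>A powr p\<close>.\<close>

lemma (in multiplier_family) TU_Lp:
  assumes q: "1 \<le> q" "q < p" and A: "1 \<le> A"
    and TM_bound: "\<And>f. nice f \<Longrightarrow> (\<integral>\<^sup>+z. ennpowr (TM f z) q \<partial>circle)
      \<le> ennreal (A powr q) * (\<integral>\<^sup>+z. ennpowr (ennreal (norm (f z))) q \<partial>circle)"
    and f: "integrable circle f"
  shows "(\<integral>\<^sup>+z. ennpowr (TU f z) p \<partial>circle)
    \<le> ennreal (KU q p * A powr p) * (\<integral>\<^sup>+z. ennpowr (ennreal (norm (f z))) p \<partial>circle)"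
proof -
  have [measurable]: "f \<in> borel_measurable circle" using f by auto
  have p: "1 < p" using q by simp
  define I where "I = (\<integral>\<^sup>+z. ennpowr (ennreal (norm (f z))) p \<partial>circle)"
  have "(\<integral>\<^sup>+z. ennpowr (TU f z) p \<partial>circle)
    \<le> (\<integral>\<^sup>+z. ennreal (2 powr p) * (ennpowr (tsharp f z) p + ennreal (6 powr p) * ennpowr (hlmax (\<lambda>w. ennreal (norm (f w))) z) p) \<partial>circle)"
  proof (rule nn_integral_mono)
    fix z
    have "ennpowr (6 * hlmax (\<lambda>w. ennreal (norm (f w))) z) p = ennreal (6 powr p) * ennpowr (hlmax (\<lambda>w. ennreal (norm (f w))) z) p"
      using ennpowr_ennreal[of 6 p] by (simp add: ennpowr_mult)
    then show "ennpowr (TU f z) p \<le> ennreal (2 powr p) * (ennpowr (tsharp f z) p + ennreal (6 powr p) * ennpowr (hlmax (\<lambda>w. ennreal (norm (f w))) z) p)"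
      unfolding TU_def using ennpowr_add_le[of p "tsharp f z"] p by (metis less_le_trans less_imp_le zero_less_one)
  qed
  also have "\<dots> = ennreal (2 powr p) * ((\<integral>\<^sup>+z. ennpowr (tsharp f z) p \<partial>circle) + ennreal (6 powr p) * (\<integral>\<^sup>+z. ennpowr (hlmax (\<lambda>w. ennreal (norm (f w))) z) p \<partial>circle))"
    by (simp add: nn_integral_cmult nn_integral_add)
  also have "\<dots> \<le> ennreal (2 powr p) * (ennreal (Ksharp q p * A powr p) * I + ennreal (6 powr p) * (ennreal (2 powr p * Kmax 1 p) * I))"
    unfolding I_def by (intro mult_left_mono add_mono tsharp_Lp[OF q A TM_bound f] hlmax_Lp p) auto
  also have "\<dots> \<le> ennreal (2 powr p) * (ennreal (Ksharp q p * A powr p) * I + ennreal (6 powr p) * (ennreal (2 powr p * Kmax 1 p * A powr p) * I))"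
    using Kmax_pos[OF p] A p
    by (intro mult_left_mono add_mono mult_right_mono ennreal_leI order_refl)
       (auto simp: ge_one_powr_ge_zero)
  also have "\<dots> = ennreal (2 powr p) * (ennreal (Ksharp q p * A powr p) + ennreal (6 powr p) * ennreal (2 powr p * Kmax 1 p * A powr p)) * I"
    by (simp add: distrib_right mult.assoc)
  also have "ennreal (2 powr p) * (ennreal (Ksharp q p * A powr p) + ennreal (6 powr p) * ennreal (2 powr p * Kmax 1 p * A powr p)) = ennreal (KU q p * A powr p)"
    using Kmax_pos[OF p] Ksharp_pos[OF q(2)] by (simp add: KU_def algebra_simps flip: ennreal_mult ennreal_plus)
  finally show ?thesis by (simp add: I_def)
qed

section \<open>Blaschke products\<close>

definition bmul :: "(nat \<Rightarrow> complex) \<Rightarrow> nat \<Rightarrow> complex \<Rightarrow> complex" where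
  "bmul a N w = (\<Prod>j=1..N. inverse (mobius (a j) w))"

lemma norm_mobius_circle: "norm a < 1 \<Longrightarrow> norm w = 1 \<Longrightarrow> norm (mobius a w) = 1"
  using norm_mobius_minus[of "-a" w] by simp

text \<open>Inversion preserves distances between points of modulus 1, and
  \<open>mobius_circle_diff\<close> with \<open>-a\<close> gives the Lipschitz constant.\<close>

lemma inverse_mobius_lipschitz:
  assumes a: "norm a < 1" and w: "norm w = 1" and z: "norm z = 1"
  shows "norm (inverse (mobius a w) - inverse (mobius a z)) \<le> 1 / (1 - norm a)\<^sup>2 * dist w z"
proof -
  have a': "norm (-a) < 1" using a by simp
  have nz: "mobius a w \<noteq> 0" "mobius a z \<noteq> 0"
    using norm_mobius_circle[OF a w] norm_mobius_circle[OF a z] by auto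
  have "inverse (mobius a w) - inverse (mobius a z) = - (inverse (mobius a w) * (mobius a w - mobius a z) * inverse (mobius a z))"
    by (rule inverse_diff_inverse[OF nz])
  then have "norm (inverse (mobius a w) - inverse (mobius a z)) = norm (mobius a w - mobius a z)"
    using norm_mobius_circle[OF a w] norm_mobius_circle[OF a z] by (simp add: norm_mult norm_inverse)
  also have "\<dots> = dist w z * (1 - (norm a)\<^sup>2) / (mscale (-a) w * mscale (-a) z)"
  proof -
    have "(norm a)\<^sup>2 \<le> 1" using a by (simp add: power_le_one)
    then have "norm (1 - complex_of_real ((norm a)\<^sup>2)) = 1 - (norm a)\<^sup>2"
      by (metis abs_of_nonneg diff_ge_0_iff_ge norm_of_real of_real_1 of_real_diff)
    then show ?thesis
      using mobius_circle_diff[OF a' w z] by (simp add: norm_mult norm_divide dist_norm mscale_def)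
  qed
  also have "\<dots> \<le> dist w z * 1 / ((1 - norm a) * (1 - norm a))"
    using mscale_ge[OF w, of "-a"] mscale_ge[OF z, of "-a"] a
    by (intro frac_le mult_mono mult_left_mono) (auto simp: power_le_one)
  finally show ?thesis by (simp add: power2_eq_square)
qed

lemma multiplier_family_bmul:
  assumes a: "\<And>n. 1 \<le> n \<Longrightarrow> norm (a n) < 1"
  shows "multiplier_family (bmul a)"
proof
  show "bmul a N \<in> borel_measurable circle" for N
    unfolding bmul_def by measurable
  show norm1: "norm (bmul a N z) = 1" if "norm z = 1" for N z
    unfolding bmul_def prod_norm[symmetric] norm_inverse
    using norm_mobius_circle[OF a that] by (intro prod.neutral) auto
  show "\<exists>L. \<forall>w z. norm w = 1 \<longrightarrow> norm z = 1 \<longrightarrow> norm (bmul a N w - bmul a N z) \<le> L * dist w z" for N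
  proof (induction N)
    case 0
    then show ?case by (intro exI[of _ 0]) (simp add: bmul_def)
  next
    case (Suc N)
    then obtain L where L: "\<And>w z. norm w = 1 \<Longrightarrow> norm z = 1 \<Longrightarrow> norm (bmul a N w - bmul a N z) \<le> L * dist w z"
      by blast
    define b where "b = a (Suc N)"
    have b: "norm b < 1" using a by (simp add: b_def)
    have step: "bmul a (Suc N) w = bmul a N w * inverse (mobius b w)" for w
      by (simp add: bmul_def b_def)
    show ?case
    proof (intro exI allI impI)
      fix w z :: complex assume w: "norm w = 1" and z: "norm z = 1"
      have "bmul a (Suc N) w - bmul a (Suc N) z
        = (bmul a N w - bmul a N z) * inverse (mobius b w) + bmul a N z * (inverse (mobius b w) - inverse (mobius b z))"
        by (simp add: step algebra_simps)
      also have "norm \<dots> \<le> norm (bmul a N w - bmul a N z) + norm (inverse (mobius b w) - inverse (mobius b z))"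
        using norm_triangle_ineq[of "(bmul a N w - bmul a N z) * inverse (mobius b w)" "bmul a N z * (inverse (mobius b w) - inverse (mobius b z))"]
          norm1[OF z, of N] norm_mobius_circle[OF b w] by (simp add: norm_mult norm_inverse)
      also have "\<dots> \<le> L * dist w z + 1 / (1 - norm b)\<^sup>2 * dist w z"
        using L[OF w z] inverse_mobius_lipschitz[OF b w z] by (rule add_mono)
      finally show "norm (bmul a (Suc N) w - bmul a (Suc N) z) \<le> (L + 1 / (1 - norm b)\<^sup>2) * dist w z"
        by (simp add: distrib_right)
    qed
  qed
qed

lemma MT_max_eq:
  assumes "multiplier_family (bmul a)"
  shows "MT_max a = multiplier_family.TM (bmul a)"
proof -
  interpret multiplier_family "bmul a" by fact
  show ?thesis
    by (intro ext) (simp add: MT_max_def TM_def PV_def MT_partial_def bmul_def cker_def)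
qed

section \<open>Change of variables by a Moebius transformation\<close>

text \<open>The modulus of the derivative of \<open>mobius (-b)\<close> on the circle, that is, its
  Jacobian for arc length.\<close>

definition jac :: "complex \<Rightarrow> complex \<Rightarrow> real" where
  "jac b u = (1 - (norm b)\<^sup>2) / (mscale b u)\<^sup>2"

lemma jac_measurable [measurable]: "jac b \<in> borel_measurable circle"
  unfolding jac_def[abs_def] by measurable

lemma one_minus_norm_sq_pos: "norm b < 1 \<Longrightarrow> 0 < 1 - (norm b)\<^sup>2" for b :: complex
  by (simp add: power_less_one_iff abs_square_less_1)

lemma jac_pos: "norm b < 1 \<Longrightarrow> norm u = 1 \<Longrightarrow> jac b u > 0"
  using one_minus_norm_sq_pos[of b] mscale_pos[of b u] by (simp add: jac_def)

lemma distr_circle_mobius: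
  assumes b: "norm b < 1"
  shows "distr (density circle (\<lambda>u. ennreal (jac b u))) circle (mobius (-b)) = circle"
proof (rule measure_eqI)
  note mobius_minus_measurable[OF b, measurable]
  fix A assume "A \<in> sets (distr (density circle (\<lambda>u. ennreal (jac b u))) circle (mobius (-b)))"
  then have [measurable]: "A \<in> sets circle" by simp
  have "emeasure circle A = (\<integral>\<^sup>+z. indicator A z \<partial>circle)" by simp
  also have "\<dots> = (\<integral>\<^sup>+z. indicator A (mobius (-b) z) * ennreal (jac b z) \<partial>circle)"
    unfolding jac_def by (rule nn_integral_circle_mobius[OF b]) simp
  also have "\<dots> = (\<integral>\<^sup>+z. indicator A (mobius (-b) z) \<partial>density circle (\<lambda>u. ennreal (jac b u)))"
    by (subst nn_integral_density) (auto simp: mult.commute)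
  also have "\<dots> = (\<integral>\<^sup>+z. indicator A z \<partial>distr (density circle (\<lambda>u. ennreal (jac b u))) circle (mobius (-b)))"
    by (rule nn_integral_distr[symmetric]) auto
  finally show "emeasure (distr (density circle (\<lambda>u. ennreal (jac b u))) circle (mobius (-b))) A = emeasure circle A"
    by simp
qed simp

lemma integral_circle_mobius:
  fixes h :: "complex \<Rightarrow> complex"
  assumes b: "norm b < 1" and [measurable]: "h \<in> borel_measurable circle"
  shows "(LINT z|circle. h z) = (LINT u|circle. jac b u *\<^sub>R h (mobius (-b) u))"
proof -
  note mobius_minus_measurable[OF b, measurable]
  have "(LINT z|circle. h z) = (LINT z|distr (density circle (\<lambda>u. ennreal (jac b u))) circle (mobius (-b)). h z)"
    by (simp add: distr_circle_mobius[OF b])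
  also have "\<dots> = (LINT u|density circle (\<lambda>u. ennreal (jac b u)). h (mobius (-b) u))"
    by (rule integral_distr) auto
  also have "\<dots> = (LINT u|circle. jac b u *\<^sub>R h (mobius (-b) u))"
    using jac_pos[OF b] by (intro integral_density) (auto simp: space_circle less_imp_le)
  finally show ?thesis .
qed

text \<open>For a function not known to be measurable the integral is a supremum over simple
  minorants, each of which can be transported; this yields one inequality. It is applied to powers
  of maximal operators.\<close>

lemma nn_integral_circle_mobius_le:
  assumes b: "norm b < 1"
  shows "(\<integral>\<^sup>+z. H z \<partial>circle) \<le> (\<integral>\<^sup>+u. H (mobius (-b) u) * ennreal (jac b u) \<partial>circle)"
  unfolding nn_integral_def[of circle H]
proof (rule SUP_least)
  fix g assume "g \<in> {g. simple_function circle g \<and> g \<le> H}"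
  then have g: "simple_function circle g" "g \<le> H" by auto
  have [measurable]: "g \<in> borel_measurable circle" using g by (auto intro: borel_measurable_simple_function)
  have "integral\<^sup>S circle g = (\<integral>\<^sup>+z. g z \<partial>circle)"
    using nn_integral_eq_simple_integral[OF g(1)] by simp
  also have "\<dots> = (\<integral>\<^sup>+u. g (mobius (-b) u) * ennreal (jac b u) \<partial>circle)"
    unfolding jac_def by (rule nn_integral_circle_mobius[OF b]) simp
  also have "\<dots> \<le> (\<integral>\<^sup>+u. H (mobius (-b) u) * ennreal (jac b u) \<partial>circle)"
    using g(2) by (intro nn_integral_mono mult_right_mono) (auto simp: le_fun_def)
  finally show "integral\<^sup>S circle g \<le> (\<integral>\<^sup>+u. H (mobius (-b) u) * ennreal (jac b u) \<partial>circle)" .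
qed

text \<open>The composition is a disc automorphism that vanishes at \<open>a\<close>, hence a
  unimodular multiple of \<open>mobius a\<close>; the calculation finds the factor.\<close>

lemma mobius_compose_mobius:
  assumes b: "norm b < 1" and a: "norm a < 1" and u: "norm u = 1"
  shows "mobius (mobius (-b) a) (mobius (-b) u) = (1 + b * cnj a) / (1 + cnj b * a) * mobius a u"
proof -
  have na: "1 + cnj b * a \<noteq> 0" "1 + b * cnj a \<noteq> 0"
  proof -
    have "norm (cnj b * a) < 1" using a b mult_strict_mono[of "norm b" 1 "norm a" 1] by (simp add: norm_mult)
    moreover from this have "norm (b * cnj a) < 1" by (simp add: norm_mult)
    ultimately show "1 + cnj b * a \<noteq> 0" "1 + b * cnj a \<noteq> 0"
      by (metis add_eq_0_iff norm_minus_cancel norm_one less_irrefl)+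
  qed
  have nu: "1 + cnj b * u \<noteq> 0" using mscale_pos[OF b u] by (auto simp: mscale_def)
  have nb: "1 - b * cnj b \<noteq> 0"
  proof -
    have "1 - b * cnj b = complex_of_real (1 - (norm b)\<^sup>2)" by (simp add: complex_norm_square del: of_real_power)
    then show ?thesis using one_minus_norm_sq_pos[OF b] by (metis of_real_eq_0_iff less_irrefl)
  qed
  have m1: "mobius (-b) u - mobius (-b) a = (u - a) * (1 - b * cnj b) / ((1 + cnj b * u) * (1 + cnj b * a))"
    using na nu by (simp add: mobius_minus diff_frac_eq) (simp add: algebra_simps)
  have m2: "1 - cnj (mobius (-b) a) * mobius (-b) u = (1 - b * cnj b) * (1 - cnj a * u) / ((1 + b * cnj a) * (1 + cnj b * u))"
  proof -
    have "cnj (mobius (-b) a) = (cnj a + cnj b) / (1 + b * cnj a)" by (simp add: mobius_minus)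
    then have "1 - cnj (mobius (-b) a) * mobius (-b) u
      = ((1 + b * cnj a) * (1 + cnj b * u) - (cnj a + cnj b) * (u + b)) / ((1 + b * cnj a) * (1 + cnj b * u))"
      using na nu by (simp add: mobius_minus diff_divide_distrib)
    also have "(1 + b * cnj a) * (1 + cnj b * u) - (cnj a + cnj b) * (u + b) = (1 - b * cnj b) * (1 - cnj a * u)"
      by (simp add: algebra_simps)
    finally show ?thesis .
  qed
  have "(n * k / (x * y)) / (k * d / (w * x)) = w / y * (n / d)"
    if "k \<noteq> 0" "x \<noteq> 0" "y \<noteq> 0" "w \<noteq> 0" for n k x y d w :: complex
    using that by (cases "d = 0") (auto simp: field_simps)
  from this[OF nb nu na] show ?thesis
    unfolding mobius_def[of "mobius (-b) a"] mobius_def[of a] m1 m2 .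
qed

text \<open>The factor depends on \<open>N\<close> but not on the point, so it leaves the moduli of
  the principal values unchanged.\<close>

lemma bmul_mobius:
  assumes b: "norm b < 1" and a: "\<And>n. 1 \<le> n \<Longrightarrow> norm (a n) < 1"
  shows "\<exists>e. norm e = 1 \<and> (\<forall>u. norm u = 1 \<longrightarrow> bmul (\<lambda>n. mobius (-b) (a n)) N (mobius (-b) u) = e * bmul a N u)"
proof (intro exI conjI allI impI)
  define c where "c j = (1 + b * cnj (a j)) / (1 + cnj b * a j)" for j
  show "norm (\<Prod>j=1..N. inverse (c j)) = 1"
    unfolding prod_norm[symmetric] norm_inverse
  proof (rule prod.neutral, rule ballI)
    fix j assume "j \<in> {1..N}"
    then have aj: "norm (a j) < 1" using a by simp
    have "cnj (1 + b * cnj (a j)) = 1 + cnj b * a j" by simp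
    then have "norm (1 + cnj b * a j) = norm (1 + b * cnj (a j))" by (metis complex_mod_cnj)
    moreover have "norm (b * cnj (a j)) < 1"
      using aj b mult_strict_mono[of "norm b" 1 "norm (a j)" 1] by (simp add: norm_mult)
    then have "1 + b * cnj (a j) \<noteq> 0"
      by (metis add_eq_0_iff norm_minus_cancel norm_one less_irrefl)
    ultimately show "inverse (norm (c j)) = 1" by (simp add: c_def norm_divide)
  qed
  show "bmul (\<lambda>n. mobius (-b) (a n)) N (mobius (-b) u) = (\<Prod>j=1..N. inverse (c j)) * bmul a N u" if u: "norm u = 1" for u
    unfolding bmul_def prod.distrib[symmetric]
  proof (rule prod.cong)
    fix j assume "j \<in> {1..N}"
    then have aj: "norm (a j) < 1" using a by simp
    show "inverse (mobius (mobius (-b) (a j)) (mobius (-b) u)) = inverse (c j) * inverse (mobius (a j) u)"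
      unfolding mobius_compose_mobius[OF b aj u] c_def by (rule inverse_mult_distrib)
  qed simp
qed

text \<open>By the two-point identity the difference of the images contributes the square roots of
  the derivative at both points. The numerator \<open>mobius (-b) u\<close> contains the conjugate
  of \<open>1 + cnj b * u\<close>, which cancels against the one in \<open>jac b u\<close>, so that
  only the holomorphic factors remain.\<close>

lemma kernel_mobius:
  assumes b: "norm b < 1" and u: "norm u = 1" and z: "norm z = 1"
  shows "cker (mobius (-b) z) (mobius (-b) u) * jac b u = (1 + cnj b * z) / (1 + cnj b * u) * cker z u"
proof (cases "u = z")
  case True
  have "mobius (-b) z \<noteq> 0" "z \<noteq> 0" using norm_mobius_minus[OF b z] z by auto
  then show ?thesis using True by (simp add: cker_def)
next
  case False
  define v where "v = 1 + cnj b * u"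
  define y where "y = 1 + cnj b * z"
  define k where "k = complex_of_real (1 - (norm b)\<^sup>2)"
  have v: "v \<noteq> 0" "cnj v \<noteq> 0" using mscale_pos[OF b u] by (auto simp: mscale_def v_def simp del: complex_cnj_add)
  have y: "y \<noteq> 0" using mscale_pos[OF b z] by (auto simp: mscale_def y_def)
  have k: "k \<noteq> 0" using one_minus_norm_sq_pos[OF b] unfolding k_def by (metis of_real_eq_0_iff less_irrefl)
  have u0: "u \<noteq> 0" using u by auto
  have m: "mobius (-b) u = u * cnj v / v"
    unfolding v_def by (rule mobius_minus_circle[OF u])
  have d: "mobius (-b) z - mobius (-b) u = (z - u) * k / (y * v)"
    using mobius_circle_diff[OF b z u] by (simp add: k_def y_def v_def)
  have j: "complex_of_real (jac b u) = k / (v * cnj v)"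
    unfolding jac_def mscale_def k_def v_def[symmetric] by (simp only: of_real_divide complex_norm_square)
  have "cker (mobius (-b) z) (mobius (-b) u) = mobius (-b) u / (mobius (-b) z - mobius (-b) u)"
    using v u0 by (intro cker_eq) (simp add: m)
  also have "\<dots> = u * cnj v * y / ((z - u) * k)"
    unfolding d unfolding m using v y by (simp add: field_simps)
  finally have ck: "cker (mobius (-b) z) (mobius (-b) u) = u * cnj v * y / ((z - u) * k)" .
  have "(u * c * y / (D * k)) * (k / (v * c)) = y / v * (u / D)" if "c \<noteq> 0" for c D
    using that k v by (simp add: mult.commute)
  from this[OF v(2), of "z - u"] show ?thesis
    unfolding ck j cker_eq[OF u0] v_def[symmetric] y_def[symmetric] .
qed

text \<open>A Moebius transformation does not preserve arcs centred at a point, but the discrepancy lies in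
  an annulus of width \<open>O(\<epsilon>\<^sup>2)\<close>.\<close>

lemma mobius_arc_discrepancy:
  assumes b: "norm b < 1" and u: "norm u = 1" and z: "norm z = 1"
  defines "C \<equiv> 2 / (1 - norm b)\<^sup>2"
  assumes e: "e > 0"
    and neq: "(dist (mobius (-b) u) (mobius (-b) z) > e * jac b z) \<noteq> (dist u z > e)"
  shows "e * (1 - C * e) \<le> dist u z" "dist u z \<le> e * (1 + C * e)"
proof -
  define d where "d = dist u z"
  define \<rho> where "\<rho> = 1 - norm b"
  have \<rho>: "0 < \<rho>" "\<rho> \<le> 1" using b by (auto simp: \<rho>_def)
  have d0: "d \<ge> 0" by (simp add: d_def)
  have su: "\<rho> \<le> mscale b u" "mscale b u \<le> 2" and sz: "\<rho> \<le> mscale b z" "mscale b z \<le> 2"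
    using mscale_ge[OF u] mscale_ge[OF z] mscale_le[OF b u] mscale_le[OF b z] by (auto simp: \<rho>_def)
  have sd: "\<bar>mscale b u - mscale b z\<bar> \<le> d"
    using mscale_diff[of b u z] b mult_right_mono[of "norm b" 1 "norm (u - z)"] by (simp add: d_def dist_norm)
  have k: "1 - (norm b)\<^sup>2 > 0" by (rule one_minus_norm_sq_pos[OF b])
  have "dist (mobius (-b) u) (mobius (-b) z) = d * (1 - (norm b)\<^sup>2) / (mscale b u * mscale b z)"
  proof -
    have "norm (1 - (complex_of_real (norm b))\<^sup>2) = 1 - (norm b)\<^sup>2"
      using k by (metis abs_of_pos norm_of_real of_real_1 of_real_diff of_real_power)
    then show ?thesis
      using mobius_circle_diff[OF b u z] by (simp add: dist_norm norm_mult norm_divide mscale_def d_def)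
  qed
  then have "dist (mobius (-b) u) (mobius (-b) z) > e * jac b z
    \<longleftrightarrow> e * ((1 - (norm b)\<^sup>2) / (mscale b z)\<^sup>2) < d * (1 - (norm b)\<^sup>2) / (mscale b u * mscale b z)"
    by (simp add: jac_def)
  also have "\<dots> \<longleftrightarrow> e * mscale b u < d * mscale b z"
  proof -
    define K s t where "K = 1 - (norm b)\<^sup>2" and "s = mscale b u" and "t = mscale b z"
    have pos: "K > 0" "s > 0" "t > 0" using k su sz \<rho> by (auto simp: K_def s_def t_def)
    have "e * (K / t\<^sup>2) = K / (s * t\<^sup>2) * (e * s)" "d * K / (s * t) = K / (s * t\<^sup>2) * (d * t)"
      using pos by (auto simp: power2_eq_square)
    then show ?thesis
      using pos unfolding K_def[symmetric] s_def[symmetric] t_def[symmetric]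
      by (simp only: mult_less_cancel_left_pos divide_pos_pos mult_pos_pos zero_less_power)
  qed
  \<comment> \<open>After cancelling positive factors the image condition compares
    \<open>e * mscale b u\<close> with \<open>d * mscale b z\<close>. The two scales differ by at
    most \<open>d\<close>, so the conditions can disagree only if \<open>d - e\<close> is of second
    order.\<close>
  finally have neq': "(e * mscale b u < d * mscale b z) \<noteq> (e < d)"
    using neq by (simp add: d_def)
  have C: "C = 2 / (\<rho> * \<rho>)" by (simp add: C_def \<rho>_def power2_eq_square)
  show "e * (1 - C * e) \<le> dist u z" "dist u z \<le> e * (1 + C * e)"
  proof -
    consider "e * mscale b u < d * mscale b z" "d \<le> e" | "d * mscale b z \<le> e * mscale b u" "e < d"
      using neq' by linarith
    then have "e * (1 - C * e) \<le> d \<and> d \<le> e * (1 + C * e)"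
    proof cases
      case 1
      have "d * mscale b z \<le> d * (mscale b u + d)" using sd d0 by (intro mult_left_mono) auto
      then have "(e - d) * mscale b u \<le> d * d" using 1 by (simp add: algebra_simps)
      also have "\<dots> \<le> e * e" using 1 d0 by (intro mult_mono) auto
      finally have "(e - d) * mscale b u \<le> e * e" .
      moreover have "(e - d) * \<rho> \<le> (e - d) * mscale b u" using su 1 by (intro mult_left_mono) auto
      ultimately have "e - d \<le> e * e / \<rho>" using \<rho> by (simp add: pos_le_divide_eq)
      also have "\<dots> \<le> e * e * C"
      proof -
        have "1 / \<rho> \<le> C"
        proof -
          have "\<rho> * \<rho> \<le> 2 * \<rho>" using \<rho> by (intro mult_right_mono) auto
          then show ?thesis using \<rho> by (simp add: C field_simps)
        qed
        then have "e * e * (1 / \<rho>) \<le> e * e * C" using e by (intro mult_left_mono) auto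
        then show ?thesis by simp
      qed
      finally have "e - d \<le> e * e * C" .
      moreover have "0 \<le> e * (C * e)" using e \<rho> by (simp add: C)
      ultimately show ?thesis using 1 by (simp add: algebra_simps)
    next
      case 2
      \<comment> \<open>A crude first bound for \<open>d\<close> makes the later right-hand side
        \<open>e * d\<close> quadratic in \<open>e\<close>.\<close>
      have "d * \<rho> \<le> d * mscale b z" using sz d0 by (intro mult_left_mono) auto
      also have "\<dots> \<le> e * 2" using 2 su e by (meson mult_left_mono less_imp_le order_trans)
      finally have d2: "d \<le> 2 * e / \<rho>" using \<rho> by (simp add: field_simps)
      have "e * mscale b u \<le> e * (mscale b z + d)" using sd e by (intro mult_left_mono) auto
      then have "(d - e) * mscale b z \<le> e * d" using 2 by (simp add: algebra_simps)
      moreover have "(d - e) * \<rho> \<le> (d - e) * mscale b z" using sz 2 by (intro mult_left_mono) auto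
      ultimately have "(d - e) * \<rho> \<le> e * d" by linarith
      also have "\<dots> \<le> e * (2 * e / \<rho>)" using d2 e by (intro mult_left_mono) auto
      finally have "d - e \<le> e * (2 * e / \<rho>) / \<rho>" using \<rho> by (simp add: pos_le_divide_eq)
      also have "\<dots> = e * (C * e)" using \<rho> by (simp add: C)
      finally have "d - e \<le> e * (C * e)" .
      moreover have "0 \<le> e * (C * e)" using e \<rho> by (simp add: C)
      ultimately show ?thesis using 2 by (simp add: algebra_simps)
    qed
    then show "e * (1 - C * e) \<le> dist u z" "dist u z \<le> e * (1 + C * e)" by (auto simp: d_def)
  qed
qed

text \<open>The function \<open>(f \<circ> \<psi>) \<psi>'\<^sup>1\<^sup>/\<^sup>2\<close> for \<open>\<psi> = mobius (-b)\<close>.\<close>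

definition pull :: "complex \<Rightarrow> (complex \<Rightarrow> complex) \<Rightarrow> complex \<Rightarrow> complex" where
  "pull b f u = complex_of_real (sqrt (1 - (norm b)\<^sup>2)) * f (mobius (-b) u) / (1 + cnj b * u)"

lemma pull_measurable:
  assumes b: "norm b < 1" and [measurable]: "f \<in> borel_measurable circle"
  shows "pull b f \<in> borel_measurable circle"
proof -
  note mobius_minus_measurable[OF b, measurable]
  show ?thesis unfolding pull_def[abs_def] by measurable
qed

lemma norm_pull:
  assumes "norm b < 1"
  shows "norm (pull b f u) = sqrt (1 - (norm b)\<^sup>2) / mscale b u * norm (f (mobius (-b) u))"
  using one_minus_norm_sq_pos[OF assms] by (simp add: pull_def norm_mult norm_divide mscale_def)

text \<open>With \<open>\<sigma>\<close> the square root of the Jacobian,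
  \<open>jac b u = \<sigma> powr 2\<close> splits into \<open>\<sigma> powr p\<close> and
  \<open>jac b u powr (1 - p / 2)\<close>: the first factor is absorbed into the function, the
  second is the weight. The value \<open>x\<close> is free so that it can be a modulus or the value
  of a maximal operator.\<close>

lemma powr_pull:
  assumes b: "norm b < 1" and u: "norm u = 1" and p: "p > 0"
  shows "ennpowr x p * ennreal (jac b u)
    = ennpowr (ennreal (sqrt (1 - (norm b)\<^sup>2) / mscale b u) * x) p * ennreal (jac b u powr (1 - p / 2))"
proof -
  define \<sigma> where "\<sigma> = sqrt (1 - (norm b)\<^sup>2) / mscale b u"
  have \<sigma>: "\<sigma> > 0" using one_minus_norm_sq_pos[OF b] mscale_pos[OF b u] by (simp add: \<sigma>_def)
  have j2: "jac b u = \<sigma> powr 2"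
    using \<sigma> one_minus_norm_sq_pos[OF b] by (simp add: jac_def \<sigma>_def power_divide)
  have "p + 2 * (1 - p / 2) = 2" by simp
  then have "\<sigma> powr p * jac b u powr (1 - p / 2) = jac b u"
    by (simp only: j2 powr_powr powr_add[symmetric])
  then have "ennreal (\<sigma> powr p) * ennreal (jac b u powr (1 - p / 2)) = ennreal (jac b u)"
    by (simp flip: ennreal_mult)
  moreover have "ennpowr (ennreal \<sigma> * x) p = ennreal (\<sigma> powr p) * ennpowr x p"
    using \<sigma> by (simp add: ennpowr_mult ennpowr_ennreal)
  ultimately show ?thesis
    unfolding \<sigma>_def[symmetric] by (simp add: mult_ac)
qed

lemma nn_integral_pull:
  assumes b: "norm b < 1" and p: "p > 0" and [measurable]: "f \<in> borel_measurable circle"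
  shows "(\<integral>\<^sup>+z. ennpowr (ennreal (norm (f z))) p \<partial>circle)
    = (\<integral>\<^sup>+u. ennpowr (ennreal (norm (pull b f u))) p * ennreal (jac b u powr (1 - p / 2)) \<partial>circle)"
proof -
  have "(\<integral>\<^sup>+z. ennpowr (ennreal (norm (f z))) p \<partial>circle)
    = (\<integral>\<^sup>+u. ennpowr (ennreal (norm (f (mobius (-b) u)))) p * ennreal (jac b u) \<partial>circle)"
    unfolding jac_def by (rule nn_integral_circle_mobius[OF b]) measurable
  also have "\<dots> = (\<integral>\<^sup>+u. ennpowr (ennreal (norm (pull b f u))) p * ennreal (jac b u powr (1 - p / 2)) \<partial>circle)"
  proof (rule nn_integral_cong)
    fix u assume "u \<in> space circle"
    then have u: "norm u = 1" by (simp add: space_circle)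
    have "ennreal (norm (pull b f u)) = ennreal (sqrt (1 - (norm b)\<^sup>2) / mscale b u) * ennreal (norm (f (mobius (-b) u)))"
      unfolding norm_pull[OF b] using one_minus_norm_sq_pos[OF b] mscale_pos[OF b u]
      by (intro ennreal_mult) auto
    then show "ennpowr (ennreal (norm (f (mobius (-b) u)))) p * ennreal (jac b u)
      = ennpowr (ennreal (norm (pull b f u))) p * ennreal (jac b u powr (1 - p / 2))"
      by (simp only: powr_pull[OF b u p])
  qed
  finally show ?thesis .
qed

lemma integrable_pull:
  assumes b: "norm b < 1" and f: "integrable circle f"
  shows "integrable circle (pull b f)"
proof (rule integrableI_bounded)
  have [measurable]: "f \<in> borel_measurable circle" using f by auto
  note mobius_minus_measurable[OF b, measurable] pull_measurable[OF b, measurable]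
  show "pull b f \<in> borel_measurable circle" by measurable
  \<comment> \<open>As \<open>mscale b u \<le> 2\<close>, the factor of \<open>pull\<close> is at
    most \<open>K\<close> times the Jacobian.\<close>
  define K where "K = 2 / sqrt (1 - (norm b)\<^sup>2)"
  have k: "1 - (norm b)\<^sup>2 > 0" by (rule one_minus_norm_sq_pos[OF b])
  have "(\<integral>\<^sup>+u. ennreal (norm (pull b f u)) \<partial>circle) \<le> (\<integral>\<^sup>+u. ennreal K * (ennreal (norm (f (mobius (-b) u))) * ennreal (jac b u)) \<partial>circle)"
  proof (rule nn_integral_mono)
    fix u assume "u \<in> space circle"
    then have u: "norm u = 1" by (simp add: space_circle)
    have s: "0 < mscale b u" "mscale b u \<le> 2" using mscale_pos[OF b u] mscale_le[OF b u] by auto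
    have "sqrt (1 - (norm b)\<^sup>2) / mscale b u \<le> K * jac b u"
    proof -
      have "K * jac b u = 2 * sqrt (1 - (norm b)\<^sup>2) / (mscale b u)\<^sup>2"
      proof -
        define t where "t = sqrt (1 - (norm b)\<^sup>2)"
        have "t > 0" "1 - (norm b)\<^sup>2 = t * t" using k by (auto simp: t_def)
        then show ?thesis unfolding K_def jac_def t_def[symmetric] by simp
      qed
      moreover have "sqrt (1 - (norm b)\<^sup>2) / mscale b u = mscale b u * sqrt (1 - (norm b)\<^sup>2) / (mscale b u)\<^sup>2"
        using s by (simp add: power2_eq_square)
      ultimately show ?thesis using s k by (auto intro!: divide_right_mono mult_right_mono)
    qed
    then have "norm (pull b f u) \<le> K * jac b u * norm (f (mobius (-b) u))"
      unfolding norm_pull[OF b] by (rule mult_right_mono) simp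
    then have "ennreal (norm (pull b f u)) \<le> ennreal (K * (norm (f (mobius (-b) u)) * jac b u))"
      by (intro ennreal_leI) (simp add: mult_ac)
    also have "\<dots> = ennreal K * (ennreal (norm (f (mobius (-b) u))) * ennreal (jac b u))"
    proof -
      have "K \<ge> 0" using k by (simp add: K_def)
      then show ?thesis using jac_pos[OF b u] by (simp add: ennreal_mult less_imp_le)
    qed
    finally show "ennreal (norm (pull b f u)) \<le> \<dots>" .
  qed
  also have "\<dots> = ennreal K * (\<integral>\<^sup>+u. ennreal (norm (f (mobius (-b) u))) * ennreal (jac b u) \<partial>circle)"
    by (rule nn_integral_cmult) measurable
  also have "(\<integral>\<^sup>+u. ennreal (norm (f (mobius (-b) u))) * ennreal (jac b u) \<partial>circle) = (\<integral>\<^sup>+z. ennreal (norm (f z)) \<partial>circle)"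
    unfolding jac_def by (rule nn_integral_circle_mobius[OF b, symmetric]) measurable
  also have "ennreal K * (\<integral>\<^sup>+z. ennreal (norm (f z)) \<partial>circle) < \<infinity>"
    using f by (simp add: integrable_iff_bounded ennreal_mult_less_top)
  finally show "(\<integral>\<^sup>+u. ennreal (norm (pull b f u)) \<partial>circle) < \<infinity>" .
qed

lemma norm_mobius_disc:
  assumes "norm b < 1" "norm a < 1"
  shows "norm (mobius b a) < 1"
  using Moebius_function_norm_lt_1[of b a 0] assms by (simp add: mobius_eq_Moebius_function)

text \<open>The image of the arc of radius epsilon about \<open>z\<close> is compared with the arc
  of radius \<open>\<epsilon> * jac b z\<close> about the image point. Where they disagree the
  kernel is at most \<open>2 / \<epsilon>\<close>, while the integral of \<open>norm (g u)\<close>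
  there is o(epsilon) for almost every \<open>z\<close> by \<open>AE_annulus_integral_small\<close>.
  So the truncated integrals differ by o(1) up to a fixed factor, and the principal values exist or
  fail together.\<close>

lemma TM_conformal:
  assumes b: "norm b < 1" and a: "\<And>n. 1 \<le> n \<Longrightarrow> norm (a n) < 1" and f: "integrable circle f"
  shows "AE z in circle. ennreal (sqrt (1 - (norm b)\<^sup>2) / mscale b z) * MT_max (\<lambda>n. mobius (-b) (a n)) f (mobius (-b) z)
    = MT_max a (pull b f) z"
proof -
  define a' where "a' n = mobius (-b) (a n)" for n
  have a': "norm (a' n) < 1" if "1 \<le> n" for n using a[OF that] b by (simp add: a'_def norm_mobius_disc)
  have mf: "multiplier_family (bmul a)" "multiplier_family (bmul a')"
    by (rule multiplier_family_bmul, erule a, rule multiplier_family_bmul, erule a')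
  interpret A: multiplier_family "bmul a" by fact
  interpret A': multiplier_family "bmul a'" by fact
  have [measurable]: "f \<in> borel_measurable circle" using f by auto
  note mobius_minus_measurable[OF b, measurable] pull_measurable[OF b, measurable]
  define g where "g = pull b f"
  have g: "integrable circle g" unfolding g_def by (rule integrable_pull[OF b f])
  have [measurable]: "g \<in> borel_measurable circle" using g by auto
  define \<psi> where "\<psi> = mobius (-b)"
  define k0 where "k0 = sqrt (1 - (norm b)\<^sup>2)"
  have k0: "k0 > 0" using one_minus_norm_sq_pos[OF b] by (simp add: k0_def)
  define C where "C = 2 / (1 - norm b)\<^sup>2"
  have C: "C > 0" using b by (simp add: C_def)
  have gfin: "(\<integral>\<^sup>+u. ennreal (norm (g u)) \<partial>circle) < \<infinity>"
    using g by (simp add: integrable_iff_bounded)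
  have gm: "(\<lambda>u. ennreal (norm (g u))) \<in> borel_measurable circle" by measurable
  have ann: "AE z in circle. \<forall>e>0. eventually (\<lambda>\<epsilon>.
    (\<integral>\<^sup>+u. ennreal (norm (g u)) * indicator {u. \<epsilon> * (1 - C * \<epsilon>) \<le> dist u z \<and> dist u z \<le> \<epsilon> * (1 + C * \<epsilon>)} u \<partial>circle)
      \<le> ennreal (e * \<epsilon>)) (at_right 0)"
    using AE_annulus_integral_small[OF gm gfin] by eventually_elim (use C in auto)
  show ?thesis
    using ann AE_space
  proof eventually_elim
    case (elim z)
    then have z: "norm z = 1" by (simp add: space_circle)
    have \<psi>z: "norm (\<psi> z) = 1" unfolding \<psi>_def by (rule norm_mobius_minus[OF b z])
    have PVeq: "norm (A'.PV N f (\<psi> z)) * (k0 / mscale b z) = norm (A.PV N g z)" for N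
    proof -
      obtain e0 where e0: "norm e0 = 1"
        and bm0: "\<forall>u. norm u = 1 \<longrightarrow> bmul (\<lambda>n. mobius (-b) (a n)) N (mobius (-b) u) = e0 * bmul a N u"
        using bmul_mobius[where a = a and N = N, OF b a] by blast
      have bm: "bmul a' N (\<psi> u) = e0 * bmul a N u" if "norm u = 1" for u
        using bm0[rule_format, OF that] unfolding a'_def \<psi>_def .
      \<comment> \<open>Everything that leaves the integral: the numerator from
        \<open>kernel_mobius\<close>, the unimodular constant of the Blaschke product and the
        normalisation of \<open>pull\<close>.\<close>
      define c where "c = (1 + cnj b * z) * e0 / k0"
      have nc: "norm c = mscale b z / k0"
        using e0 k0 by (simp add: c_def norm_mult norm_divide mscale_def)
      have c0: "c \<noteq> 0" using nc k0 mscale_pos[OF b z] by auto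
      define j where "j = jac b z"
      have j: "j > 0" unfolding j_def by (rule jac_pos[OF b z])
      define P where "P e = A'.S N (far (\<psi> z) e f) (\<psi> z)" for e
      define Q where "Q e = A.S N (far z e g) z" for e
      have diff: "eventually (\<lambda>\<epsilon>. norm (P (\<epsilon> * j) - c * Q \<epsilon>) < d) (at_right 0)" if d: "d > 0" for d
      proof -
        \<comment> \<open>Chosen so that
          \<open>norm c * (2 / \<epsilon>) * (d' * \<epsilon>)\<close> is
          \<open>d / 2\<close>.\<close>
        define d' where "d' = d / (4 * norm c)"
        have d': "d' > 0" using d c0 by (simp add: d'_def)
        have "eventually (\<lambda>\<epsilon>. (\<integral>\<^sup>+u. ennreal (norm (g u)) * indicator {u. \<epsilon> * (1 - C * \<epsilon>) \<le> dist u z \<and> dist u z \<le> \<epsilon> * (1 + C * \<epsilon>)} u \<partial>circle)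
          \<le> ennreal (d' * \<epsilon>)) (at_right 0)"
          using elim d' by blast
        moreover have "eventually (\<lambda>\<epsilon>. \<epsilon> < 1 / (2 * C)) (at_right 0)"
          using C by (intro order_tendstoD(2)[OF tendsto_ident_at]) auto
        moreover have "eventually (\<lambda>\<epsilon>::real. 0 < \<epsilon>) (at_right 0)"
          by (rule eventually_at_right_less)
        ultimately show ?thesis
        proof eventually_elim
          case (elim \<epsilon>)
          have \<epsilon>: "\<epsilon> > 0" "C * \<epsilon> < 1 / 2" using elim C by (auto simp: field_simps)
          define X where "X u \<longleftrightarrow> dist (\<psi> u) (\<psi> z) > \<epsilon> * j" for u
          define Y where "Y u \<longleftrightarrow> dist u z > \<epsilon>" for u
          have [measurable]: "Measurable.pred circle X" "Measurable.pred circle Y"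
            unfolding X_def Y_def \<psi>_def by measurable
          define h where "h u = g u * bmul a N u * cker z u" for u
          have [measurable]: "h \<in> borel_measurable circle" unfolding h_def by measurable
          have disc: "\<epsilon> * (1 - C * \<epsilon>) \<le> dist u z" "dist u z \<le> \<epsilon> * (1 + C * \<epsilon>)" if "norm u = 1" "X u \<noteq> Y u" for u
            using mobius_arc_discrepancy[OF b that(1) z \<epsilon>(1)] that(2) by (auto simp: C_def X_def Y_def \<psi>_def j_def)
          have half: "\<epsilon> / 2 \<le> \<epsilon> * (1 - C * \<epsilon>)"
          proof -
            have "\<epsilon> * (1 / 2) \<le> \<epsilon> * (1 - C * \<epsilon>)" using \<epsilon> by (intro mult_left_mono) auto
            then show ?thesis by simp
          qed
          have Xd: "dist u z \<ge> \<epsilon> / 2" if "norm u = 1" "X u \<or> Y u" for u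
          proof (cases "Y u")
            case True then show ?thesis using \<epsilon> by (simp add: Y_def)
          next
            case False
            then show ?thesis using disc(1)[OF that(1)] that(2) half by auto
          qed
          have hb: "norm (h u) \<le> 2 / \<epsilon> * norm (g u)" if u: "norm u = 1" "X u \<or> Y u" for u
          proof -
            have "1 / dist u z \<le> 1 / (\<epsilon> / 2)" using Xd[OF u] \<epsilon> by (intro divide_left_mono mult_pos_pos) auto
            then have "norm (g u) * (1 / dist u z) \<le> norm (g u) * (2 / \<epsilon>)" by (intro mult_left_mono) auto
            then show ?thesis using u by (simp add: h_def norm_mult A.norm_m norm_cker mult.commute)
          qed
          have int: "integrable circle (\<lambda>u. if Z u then h u else 0)" if [measurable]: "Measurable.pred circle Z" and Z: "\<And>u. Z u \<Longrightarrow> X u \<or> Y u" for Z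
          proof (rule Bochner_Integration.integrable_bound)
            show "integrable circle (\<lambda>u. (2 / \<epsilon>) *\<^sub>R g u)" using g by simp
            show "(\<lambda>u. if Z u then h u else 0) \<in> borel_measurable circle" by measurable
            show "AE u in circle. norm (if Z u then h u else 0) \<le> norm ((2 / \<epsilon>) *\<^sub>R g u)"
              using hb Z \<epsilon> by (intro AE_I2) (auto simp: space_circle)
          qed
          have iX: "integrable circle (\<lambda>u. if X u then h u else 0)" by (rule int) auto
          have iY: "integrable circle (\<lambda>u. if Y u then h u else 0)" by (rule int) auto
          have "P (\<epsilon> * j) = (LINT u|circle. jac b u *\<^sub>R (far (\<psi> z) (\<epsilon> * j) f (\<psi> u) * bmul a' N (\<psi> u) * cker (\<psi> z) (\<psi> u)))"
            unfolding P_def A'.S_def \<psi>_def by (rule integral_circle_mobius[OF b]) measurable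
          also have "\<dots> = (LINT u|circle. c * (if X u then h u else 0))"
          proof (rule Bochner_Integration.integral_cong)
            fix u assume "u \<in> space circle"
            then have u: "norm u = 1" by (simp add: space_circle)
            have km: "cker (\<psi> z) (\<psi> u) * jac b u = (1 + cnj b * z) / (1 + cnj b * u) * cker z u"
              unfolding \<psi>_def by (rule kernel_mobius[OF b u z])
            have "jac b u *\<^sub>R (f (\<psi> u) * bmul a' N (\<psi> u) * cker (\<psi> z) (\<psi> u)) = f (\<psi> u) * (e0 * bmul a N u) * (cker (\<psi> z) (\<psi> u) * jac b u)"
              by (simp add: bm[OF u] scaleR_conv_of_real mult_ac)
            also have "\<dots> = c * h u"
              unfolding km using k0 by (simp add: c_def h_def g_def pull_def k0_def[symmetric] \<psi>_def)
            finally show "jac b u *\<^sub>R (far (\<psi> z) (\<epsilon> * j) f (\<psi> u) * bmul a' N (\<psi> u) * cker (\<psi> z) (\<psi> u)) = c * (if X u then h u else 0)"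
              by (simp add: far_def X_def)
          qed simp
          also have "\<dots> = c * (LINT u|circle. (if X u then h u else 0))" by simp
          finally have PX: "P (\<epsilon> * j) = c * (LINT u|circle. (if X u then h u else 0))" .
          have QY: "Q \<epsilon> = (LINT u|circle. (if Y u then h u else 0))"
            unfolding Q_def A.S_def by (intro Bochner_Integration.integral_cong) (auto simp: far_def Y_def h_def)
          have "P (\<epsilon> * j) - c * Q \<epsilon> = c * (LINT u|circle. (if X u then h u else 0) - (if Y u then h u else 0))"
            unfolding PX QY using iX iY by (simp add: right_diff_distrib)
          then have "ennreal (norm (P (\<epsilon> * j) - c * Q \<epsilon>)) = ennreal (norm c) * ennreal (norm (LINT u|circle. (if X u then h u else 0) - (if Y u then h u else 0)))"
            by (simp add: norm_mult ennreal_mult)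
          also have "\<dots> \<le> ennreal (norm c) * (\<integral>\<^sup>+u. ennreal (norm ((if X u then h u else 0) - (if Y u then h u else 0))) \<partial>circle)"
            by (intro mult_left_mono norm_integral_le_nn_integral) simp
          also have "\<dots> \<le> ennreal (norm c) * (\<integral>\<^sup>+u. ennreal (2 / \<epsilon>) * (ennreal (norm (g u)) * indicator {u. \<epsilon> * (1 - C * \<epsilon>) \<le> dist u z \<and> dist u z \<le> \<epsilon> * (1 + C * \<epsilon>)} u) \<partial>circle)"
          proof (intro mult_left_mono nn_integral_mono)
            fix u assume "u \<in> space circle"
            then have u: "norm u = 1" by (simp add: space_circle)
            show "ennreal (norm ((if X u then h u else 0) - (if Y u then h u else 0)))
              \<le> ennreal (2 / \<epsilon>) * (ennreal (norm (g u)) * indicator {u. \<epsilon> * (1 - C * \<epsilon>) \<le> dist u z \<and> dist u z \<le> \<epsilon> * (1 + C * \<epsilon>)} u)"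
            proof (cases "X u = Y u")
              case False
              then have "norm ((if X u then h u else 0) - (if Y u then h u else 0)) = norm (h u)" by auto
              also have "\<dots> \<le> 2 / \<epsilon> * norm (g u)" using False by (intro hb u) auto
              finally have "ennreal (norm ((if X u then h u else 0) - (if Y u then h u else 0))) \<le> ennreal (2 / \<epsilon> * norm (g u))"
                by (rule ennreal_leI)
              also have "\<dots> = ennreal (2 / \<epsilon>) * ennreal (norm (g u))" using \<epsilon> by (intro ennreal_mult) auto
              finally show ?thesis using disc[OF u False] by simp
            qed simp
          qed simp
          also have "\<dots> = ennreal (norm c) * (ennreal (2 / \<epsilon>) * (\<integral>\<^sup>+u. ennreal (norm (g u)) * indicator {u. \<epsilon> * (1 - C * \<epsilon>) \<le> dist u z \<and> dist u z \<le> \<epsilon> * (1 + C * \<epsilon>)} u \<partial>circle))"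
            by (subst nn_integral_cmult) measurable
          also have "\<dots> \<le> ennreal (norm c) * (ennreal (2 / \<epsilon>) * ennreal (d' * \<epsilon>))"
            by (intro mult_left_mono elim) auto
          also have "\<dots> = ennreal (norm c * (2 / \<epsilon> * (d' * \<epsilon>)))"
            by (rule ennreal_mult3[symmetric]) (use \<epsilon> d' in auto)
          also have "norm c * (2 / \<epsilon> * (d' * \<epsilon>)) = d / 2"
            using \<epsilon> c0 by (simp add: d'_def)
          finally have "norm (P (\<epsilon> * j) - c * Q \<epsilon>) \<le> d / 2" using d by simp
          then show ?case using d by simp
        qed
      qed
      then have D0: "((\<lambda>\<epsilon>. P (\<epsilon> * j) - c * Q \<epsilon>) \<longlongrightarrow> 0) (at_right 0)"
        by (simp add: tendsto_iff dist_norm)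
      have scale1: "filterlim (\<lambda>\<epsilon>. \<epsilon> * j) (at_right 0) (at_right 0)" and scale2: "filterlim (\<lambda>\<epsilon>. \<epsilon> / j) (at_right 0) (at_right 0)"
        using j by (auto simp: filterlim_at eventually_at_right_field intro!: tendsto_eq_intros exI[of _ 1])
      have PQ: "(P \<longlongrightarrow> c * l) (at_right 0) \<longleftrightarrow> (Q \<longlongrightarrow> l) (at_right 0)" for l
      proof
        assume "(P \<longlongrightarrow> c * l) (at_right 0)"
        from filterlim_compose[OF this scale1] have "((\<lambda>\<epsilon>. P (\<epsilon> * j)) \<longlongrightarrow> c * l) (at_right 0)" .
        from tendsto_diff[OF this D0] have "((\<lambda>\<epsilon>. c * Q \<epsilon>) \<longlongrightarrow> c * l) (at_right 0)" by simp
        from tendsto_mult_left[OF this, of "inverse c"] show "(Q \<longlongrightarrow> l) (at_right 0)" using c0 by (simp add: mult.assoc[symmetric])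
      next
        assume "(Q \<longlongrightarrow> l) (at_right 0)"
        from tendsto_add[OF D0 tendsto_mult_left[OF this, of c]]
        have "((\<lambda>\<epsilon>. P (\<epsilon> * j)) \<longlongrightarrow> c * l) (at_right 0)" by simp
        from filterlim_compose[OF this scale2] show "(P \<longlongrightarrow> c * l) (at_right 0)" using j by simp
      qed
      show ?thesis
      proof (cases "A.has_pv N g z")
        case True
        then obtain l where l: "(Q \<longlongrightarrow> l) (at_right 0)" by (auto simp: A.has_pv_def Q_def[abs_def])
        then have "(P \<longlongrightarrow> c * l) (at_right 0)" using PQ by simp
        then have "A'.PV N f (\<psi> z) = c * l" by (intro A'.PV_tendsto) (simp_all add: P_def[abs_def])
        moreover have "A.PV N g z = l" using l by (intro A.PV_tendsto) (simp_all add: Q_def[abs_def])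
        ultimately show ?thesis using k0 mscale_pos[OF b z] by (simp add: norm_mult nc)
      next
        case False
        have "\<not> A'.has_pv N f (\<psi> z)"
        proof
          assume "A'.has_pv N f (\<psi> z)"
          then obtain l where "(P \<longlongrightarrow> l) (at_right 0)" by (auto simp: A'.has_pv_def P_def[abs_def])
          then have "(Q \<longlongrightarrow> l / c) (at_right 0)" using PQ[of "l / c"] c0 by simp
          then show False using False by (auto simp: A.has_pv_def Q_def[abs_def])
        qed
        then show ?thesis using False by (simp add: A'.PV_eq A.PV_eq)
      qed
    qed
    have "ennreal (k0 / mscale b z) * A'.TM f (\<psi> z) = (SUP N\<in>{1..}. ennreal (k0 / mscale b z) * ennreal (norm (A'.PV N f (\<psi> z))))"
      unfolding A'.TM_def by (rule SUP_mult_left_ennreal)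
    also have "\<dots> = A.TM g z"
      unfolding A.TM_def using k0 mscale_pos[OF b z]
      by (intro SUP_cong refl) (simp add: PVeq[symmetric] mult.commute flip: ennreal_mult)
    finally show ?case
      unfolding MT_max_eq[OF mf(1)] a'_def[symmetric] MT_max_eq[OF mf(2)] by (simp add: k0_def \<psi>_def g_def)
  qed
qed

section \<open>Operator norms\<close>

lemma Lp_space_iff:
  "0 < p \<Longrightarrow> f \<in> Lp_space p \<longleftrightarrow> f \<in> borel_measurable circle \<and> (\<integral>\<^sup>+z. ennpowr (ennreal (norm (f z))) p \<partial>circle) < \<infinity>"
  by (auto simp: Lp_space_def Lp_norm_def)

lemma op_norm_leI:
  assumes p: "0 < p"
    and bound: "\<And>f. f \<in> Lp_space p \<Longrightarrow> (\<integral>\<^sup>+z. ennpowr (T f z) p \<partial>circle)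
      \<le> ennpowr C p * (\<integral>\<^sup>+z. ennpowr (ennreal (norm (f z))) p \<partial>circle)"
  shows "op_norm p T \<le> C"
  unfolding op_norm_def
proof (rule Inf_lower, safe)
  fix f assume "f \<in> Lp_space p"
  from ennpowr_mono[OF _ bound[OF this], of "1 / p"] p
  show "Lp_norm p (T f) \<le> C * Lp_norm p (\<lambda>z. ennreal (norm (f z)))"
    by (simp add: Lp_norm_def ennpowr_mult ennpowr_ennpowr)
qed

text \<open>The strict inequality yields an admissible constant below \<open>C\<close> directly, so
  the question whether the infimum is attained, delicate because \<open>\<infinity> * 0 = 0\<close>,
  does not arise.\<close>

lemma op_norm_lessD:
  assumes p: "0 < p" and less: "op_norm p T < C" and f: "f \<in> Lp_space p"
  shows "(\<integral>\<^sup>+z. ennpowr (T f z) p \<partial>circle) \<le> ennpowr C p * (\<integral>\<^sup>+z. ennpowr (ennreal (norm (f z))) p \<partial>circle)"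
proof -
  obtain A where A: "A < C" "Lp_norm p (T f) \<le> A * Lp_norm p (\<lambda>z. ennreal (norm (f z)))"
    using less f unfolding op_norm_def Inf_less_iff by blast
  have "Lp_norm p (T f) \<le> C * Lp_norm p (\<lambda>z. ennreal (norm (f z)))"
    using A by (meson less_imp_le mult_right_mono order_trans zero_le)
  from ennpowr_mono[OF _ this, of p] p show ?thesis
    by (simp add: Lp_norm_def ennpowr_mult ennpowr_ennpowr)
qed

text \<open>The products involve indices from 1 on, and only for these are the points known to lie
  in the disc.\<close>

lemma MT_max_cong: "(\<And>n. 1 \<le> n \<Longrightarrow> a n = a' n) \<Longrightarrow> MT_max a = MT_max a'"
  unfolding MT_max_def MT_partial_def by (intro ext SUP_cong refl) (auto intro!: prod.cong arg_cong2[where f = pv_integral] ext)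

text \<open>After transport of the integral, \<open>TM_conformal\<close> identifies the integrand
  and \<open>powr_pull\<close> turns the Jacobian into the weight.\<close>

lemma nn_integral_MT_max_le:
  assumes b: "norm b < 1" and a: "\<And>n. 1 \<le> n \<Longrightarrow> norm (a n) < 1" and p: "1 \<le> p" and f: "f \<in> Lp_space p"
  shows "(\<integral>\<^sup>+z. ennpowr (MT_max (\<lambda>n. mobius (-b) (a n)) f z) p \<partial>circle)
    \<le> (\<integral>\<^sup>+z. ennpowr (MT_max a (pull b f) z) p * ennreal (jac b z powr (1 - p / 2)) \<partial>circle)"
proof -
  have p0: "0 < p" using p by simp
  have [measurable]: "f \<in> borel_measurable circle" using f p0 by (simp add: Lp_space_iff)
  have fi: "integrable circle f" using f p0 by (intro integrable_of_powr[OF _ p]) (auto simp: Lp_space_iff)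
  have conf: "AE z in circle. ennreal (sqrt (1 - (norm b)\<^sup>2) / mscale b z) * MT_max (\<lambda>n. mobius (-b) (a n)) f (mobius (-b) z)
    = MT_max a (pull b f) z"
    by (rule TM_conformal[OF b _ fi]) (rule a)
  have "(\<integral>\<^sup>+z. ennpowr (MT_max (\<lambda>n. mobius (-b) (a n)) f z) p \<partial>circle)
    \<le> (\<integral>\<^sup>+z. ennpowr (MT_max (\<lambda>n. mobius (-b) (a n)) f (mobius (-b) z)) p * ennreal (jac b z) \<partial>circle)"
    by (rule nn_integral_circle_mobius_le[OF b])
  also have "\<dots> \<le> (\<integral>\<^sup>+z. ennpowr (MT_max a (pull b f) z) p * ennreal (jac b z powr (1 - p / 2)) \<partial>circle)"
  proof (rule nn_integral_mono_AE)
    show "AE z in circle. ennpowr (MT_max (\<lambda>n. mobius (-b) (a n)) f (mobius (-b) z)) p * ennreal (jac b z)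
      \<le> ennpowr (MT_max a (pull b f) z) p * ennreal (jac b z powr (1 - p / 2))"
      using conf AE_space
    proof eventually_elim
      case (elim z)
      then have "norm z = 1" by (simp add: space_circle)
      from powr_pull[OF b this p0, of "MT_max (\<lambda>n. mobius (-b) (a n)) f (mobius (-b) z)"] elim
      show ?case by simp
    qed
  qed
  finally show ?thesis .
qed

text \<open>For \<open>p = 2\<close> the weight \<open>jac b z powr (1 - p / 2)\<close> is 1 and
  \<open>pull b\<close> preserves the norm.\<close>

lemma op_norm_2_mobius_le:
  assumes b: "norm b < 1" and a: "\<And>n. 1 \<le> n \<Longrightarrow> norm (a n) < 1"
  shows "op_norm 2 (MT_max (\<lambda>n. mobius (-b) (a n))) \<le> op_norm 2 (MT_max a)"
proof (rule dense_ge)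
  fix C assume C: "op_norm 2 (MT_max a) < C"
  show "op_norm 2 (MT_max (\<lambda>n. mobius (-b) (a n))) \<le> C"
  proof (rule op_norm_leI)
    fix f assume f: "f \<in> Lp_space 2"
    then have [measurable]: "f \<in> borel_measurable circle" by (simp add: Lp_space_iff)
    have jac1: "jac b z powr (1 - 2 / 2) = 1" if "z \<in> space circle" for z
      using jac_pos[OF b, of z] that by (simp add: space_circle)
    have eq: "(\<integral>\<^sup>+z. ennpowr (ennreal (norm (f z))) 2 \<partial>circle) = (\<integral>\<^sup>+z. ennpowr (ennreal (norm (pull b f z))) 2 \<partial>circle)"
      unfolding nn_integral_pull[OF b zero_less_numeral \<open>f \<in> borel_measurable circle\<close>]
      by (intro nn_integral_cong) (simp only: jac1, simp)
    then have "pull b f \<in> Lp_space 2"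
      using f pull_measurable[OF b, of f] by (simp add: Lp_space_iff)
    from op_norm_lessD[OF _ C this]
    have "(\<integral>\<^sup>+z. ennpowr (MT_max a (pull b f) z) 2 \<partial>circle) \<le> ennpowr C 2 * (\<integral>\<^sup>+z. ennpowr (ennreal (norm (f z))) 2 \<partial>circle)"
      by (simp add: eq)
    moreover have "(\<integral>\<^sup>+z. ennpowr (MT_max a (pull b f) z) 2 * ennreal (jac b z powr (1 - 2 / 2)) \<partial>circle)
      = (\<integral>\<^sup>+z. ennpowr (MT_max a (pull b f) z) 2 \<partial>circle)"
      by (intro nn_integral_cong) (simp only: jac1, simp)
    ultimately show "(\<integral>\<^sup>+z. ennpowr (MT_max (\<lambda>n. mobius (-b) (a n)) f z) 2 \<partial>circle)
      \<le> ennpowr C 2 * (\<integral>\<^sup>+z. ennpowr (ennreal (norm (f z))) 2 \<partial>circle)"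
      using nn_integral_MT_max_le[where a = a and p = 2, OF b a _ f] by simp
  qed simp
qed

lemma mobius_mobius_minus:
  assumes b: "norm b < 1" and z: "norm z < 1"
  shows "mobius b (mobius (-b) z) = z"
proof -
  have "norm (cnj b * z) < 1" using b z mult_strict_mono[of "norm b" 1 "norm z" 1] by (simp add: norm_mult)
  then have nz: "1 + cnj b * z \<noteq> 0" by (metis add_eq_0_iff norm_minus_cancel norm_one less_irrefl)
  have nb: "1 - b * cnj b \<noteq> 0"
  proof -
    have "1 - b * cnj b = complex_of_real (1 - (norm b)\<^sup>2)" by (simp add: complex_norm_square del: of_real_power)
    then show ?thesis using one_minus_norm_sq_pos[OF b] by (metis of_real_eq_0_iff less_irrefl)
  qed
  define v where "v = 1 + cnj b * z"
  have v: "v \<noteq> 0" using nz by (simp add: v_def)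
  have n: "(z + b) / v - b = z * (1 - b * cnj b) / v"
  proof -
    have "(z + b) - b * v = z * (1 - b * cnj b)" by (simp add: v_def algebra_simps)
    moreover have "(z + b) / v - b = ((z + b) - b * v) / v" using v by (simp add: diff_divide_distrib)
    ultimately show ?thesis by (simp only:)
  qed
  have d: "1 - cnj b * ((z + b) / v) = (1 - b * cnj b) / v"
  proof -
    have "v - cnj b * (z + b) = 1 - b * cnj b" by (simp add: v_def algebra_simps)
    moreover have "1 - cnj b * ((z + b) / v) = (v - cnj b * (z + b)) / v" using v by (simp add: diff_divide_distrib)
    ultimately show ?thesis by (simp only:)
  qed
  show ?thesis
    unfolding mobius_minus v_def[symmetric] unfolding mobius_def n d using v nb by simp
qed

text \<open>The reverse inequality is the same one for \<open>-b\<close> and the image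
  points.\<close>

lemma op_norm_2_mobius:
  assumes b: "norm b < 1" and a: "\<And>n. 1 \<le> n \<Longrightarrow> norm (a n) < 1"
  shows "op_norm 2 (MT_max a) = op_norm 2 (MT_max (\<lambda>n. mobius (-b) (a n)))"
proof (rule antisym)
  have "op_norm 2 (MT_max (\<lambda>n. mobius (- (- b)) (mobius (-b) (a n)))) \<le> op_norm 2 (MT_max (\<lambda>n. mobius (-b) (a n)))"
    using b a by (intro op_norm_2_mobius_le) (auto intro: norm_mobius_disc)
  moreover have "MT_max (\<lambda>n. mobius (- (- b)) (mobius (-b) (a n))) = MT_max a"
    using b a by (intro MT_max_cong) (simp add: mobius_mobius_minus)
  ultimately show "op_norm 2 (MT_max a) \<le> op_norm 2 (MT_max (\<lambda>n. mobius (-b) (a n)))" by simp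
qed (rule op_norm_2_mobius_le[OF b a])

section \<open>A lower bound for the norm\<close>

text \<open>The kernel is -1/2 plus an imaginary cotangent: it and its conjugate add up to
  -1.\<close>

lemma Re_cker: "norm w = 1 \<Longrightarrow> norm z = 1 \<Longrightarrow> w \<noteq> z \<Longrightarrow> Re (cker z w) = - 1 / 2"
proof -
  assume w: "norm w = 1" and z: "norm z = 1" and wz: "w \<noteq> z"
  have nz: "w \<noteq> 0" "z \<noteq> 0" using w z by auto
  have "cnj (cker z w) = 1 / (w / z - 1)"
    using w z by (simp add: cker_def cnj_eq_inverse_circle)
  also have "\<dots> = z / (w - z)" using nz wz by (simp add: field_simps)
  finally have c: "cnj (cker z w) = z / (w - z)" .
  have "cker z w + cnj (cker z w) = -1"
  proof -
    have "w / (z - w) - z / (z - w) = (w - z) / (z - w)" by (rule diff_divide_distrib[symmetric])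
    also have "\<dots> = - ((z - w) / (z - w))" by (metis minus_diff_eq minus_divide_left)
    also have "\<dots> = -1" using wz by simp
    finally have 1: "w / (z - w) - z / (z - w) = -1" .
    have "z / (w - z) = - (z / (z - w))" by (metis minus_diff_eq minus_divide_right)
    with 1 have "w / (z - w) + z / (w - z) = -1" by (simp only: diff_conv_add_uminus)
    then show ?thesis by (subst c, subst cker_eq[OF nz(1)])
  qed
  then have "Re (cker z w + cnj (cker z w)) = -1" by simp
  then show ?thesis by simp
qed

lemma emeasure_half_circle:
  "emeasure circle {w \<in> space circle. Im w > 0} = ennreal pi"
  "emeasure circle {w \<in> space circle. Im w < 0} = ennreal pi"
proof -
  have [measurable]: "{w \<in> space circle. Im w > 0} \<in> sets circle" "{w \<in> space circle. Im w < 0} \<in> sets circle"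
    by measurable
  have "emeasure circle {w \<in> space circle. Im w > 0} = (\<integral>\<^sup>+y\<in>{-pi..pi}. indicator {w \<in> space circle. Im w > 0} (cis y) \<partial>lborel)"
    by (subst nn_integral_circle'[symmetric]) auto
  also have "\<dots> = (\<integral>\<^sup>+y. indicator {0<..<pi} y \<partial>lborel)"
  proof (rule nn_integral_cong)
    fix y :: real
    have "sin y > 0 \<longleftrightarrow> 0 < y \<and> y < pi" if "y \<in> {-pi..pi}"
    proof
      assume "sin y > 0"
      then show "0 < y \<and> y < pi"
        using that sin_ge_zero[of "-y"] by (cases "y = pi"; cases "y \<le> 0") auto
    qed (auto intro: sin_gt_zero)
    then show "indicator {w \<in> space circle. Im w > 0} (cis y) * indicator {-pi..pi} y = (indicator {0<..<pi} y :: ennreal)"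
      by (auto simp: indicator_def space_circle)
  qed
  finally show "emeasure circle {w \<in> space circle. Im w > 0} = ennreal pi" by simp
  have "emeasure circle {w \<in> space circle. Im w < 0} = (\<integral>\<^sup>+w. indicator {w \<in> space circle. Im w < 0} w \<partial>circle)" by simp
  also have "\<dots> = (\<integral>\<^sup>+w. indicator {w \<in> space circle. Im w < 0} (cnj w) \<partial>circle)"
    by (rule nn_integral_circle_cnj) simp
  also have "\<dots> = (\<integral>\<^sup>+w. indicator {w \<in> space circle. Im w > 0} w \<partial>circle)"
    by (intro nn_integral_cong) (auto simp: indicator_def space_circle)
  finally show "emeasure circle {w \<in> space circle. Im w < 0} = ennreal pi"
    using \<open>emeasure circle {w \<in> space circle. Im w > 0} = ennreal pi\<close> by simp
qed

text \<open>The test function cancels the first multiplier on the upper half circle, so by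
  \<open>Re_cker\<close> the operator with \<open>N = 1\<close> has real part
  \<open>- pi / 2\<close> at every point of the lower half circle. As \<open>pi / 2 > 1\<close> and
  the half circles have equal length, the norm cannot be less than 1.\<close>

lemma op_norm_MT_max_ge_1:
  assumes a: "\<And>n. 1 \<le> n \<Longrightarrow> norm (a n) < 1" and q: "1 < q"
  shows "1 \<le> op_norm q (MT_max a)"
proof (rule ccontr)
  assume "\<not> ?thesis"
  then have less: "op_norm q (MT_max a) < 1" by (simp add: not_le)
  interpret multiplier_family "bmul a" by (rule multiplier_family_bmul[OF a])
  define U where "U = {w \<in> space circle. Im w > 0}"
  define J where "J = {w \<in> space circle. Im w < 0}"
  have [measurable]: "U \<in> sets circle" "J \<in> sets circle" unfolding U_def J_def by measurable
  define f where "f w = (if Im w > 0 then mobius (a 1) w else 0)" for w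
  have [measurable]: "f \<in> borel_measurable circle" unfolding f_def by measurable
  have nf: "norm (f w) = indicator U w" if "w \<in> space circle" for w
    using that norm_mobius_circle[OF a[OF order_refl], of w] by (auto simp: f_def U_def indicator_def space_circle)
  have If: "(\<integral>\<^sup>+w. ennpowr (ennreal (norm (f w))) q \<partial>circle) = ennreal pi"
  proof -
    have "(\<integral>\<^sup>+w. ennpowr (ennreal (norm (f w))) q \<partial>circle) = (\<integral>\<^sup>+w. indicator U w \<partial>circle)"
      by (intro nn_integral_cong) (auto simp: nf indicator_def ennpowr_ennreal)
    then show ?thesis using emeasure_half_circle by (simp add: U_def)
  qed
  have f: "f \<in> Lp_space q" using q by (simp add: Lp_space_iff If)
  have fi: "integrable circle f"
    by (rule circle.integrable_const_bound[where B = 1]) (auto intro!: AE_I2 simp: nf)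
  have lower: "ennreal (pi / 2) \<le> MT_max a f z" if z: "z \<in> J" for z
  proof -
    have z1: "norm z = 1" "Im z < 0" using z by (auto simp: J_def space_circle)
    have away: "f w = 0" if "dist w z \<le> - Im z / 2" for w
    proof -
      have "\<bar>Im w - Im z\<bar> \<le> dist w z" using abs_Im_le_cmod[of "w - z"] by (simp add: dist_norm)
      then show ?thesis using that z1 by (auto simp: f_def)
    qed
    have zero: "((\<lambda>e. S 1 (far z e (\<lambda>_. 0)) z) \<longlongrightarrow> 0) (at_right 0)"
      by (simp add: S_def far_def)
    have "PV 1 (\<lambda>w. 0 + f w) z = PV 1 (\<lambda>_. 0) z + S 1 f z"
      using z1 away zero fi by (intro has_pv_add_far(2)[where r = "- Im z / 2"]) (auto simp: has_pv_def)
    also have "PV 1 (\<lambda>_. 0) z = 0" using PV_tendsto(1)[OF _ zero] by simp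
    finally have PS: "PV 1 f z = S 1 f z" by simp
    have int: "integrable circle (\<lambda>w. f w * bmul a 1 w * cker z w)"
      using z1 away by (intro S_integrable[OF fi, where r = "- Im z / 2"]) auto
    have "Re (S 1 f z) = (LINT w|circle. Re (f w * bmul a 1 w * cker z w))"
      unfolding S_def by (rule integral_Re[OF int, symmetric])
    also have "\<dots> = (LINT w|circle. indicator U w * (- 1 / 2))"
    proof (rule Bochner_Integration.integral_cong)
      fix w assume w: "w \<in> space circle"
      then have w1: "norm w = 1" by (simp add: space_circle)
      have "mobius (a 1) w \<noteq> 0" using norm_mobius_circle[OF a[OF order_refl] w1] by auto
      show "Re (f w * bmul a 1 w * cker z w) = indicator U w * (- 1 / 2)"
      proof (cases "Im w > 0")
        case True
        have "f w * bmul a 1 w = 1" using True \<open>mobius (a 1) w \<noteq> 0\<close> by (simp add: f_def bmul_def)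
        moreover have "w \<noteq> z" using True z1 by auto
        ultimately show ?thesis
          using Re_cker[OF w1 z1(1)] True w by (simp add: U_def)
      next
        case False
        then show ?thesis by (simp add: f_def U_def)
      qed
    qed simp
    also have "\<dots> = - (pi / 2)"
      using emeasure_half_circle by (simp add: measure_def U_def)
    finally have "Re (S 1 f z) = - (pi / 2)" .
    then have "pi / 2 \<le> norm (PV 1 f z)"
      unfolding PS using abs_Re_le_cmod[of "S 1 f z"] by simp
    then have "ennreal (pi / 2) \<le> ennreal (norm (PV 1 f z))" by (rule ennreal_leI)
    also have "\<dots> \<le> TM f z" unfolding TM_def by (rule SUP_upper) simp
    finally show ?thesis by (simp add: MT_max_eq[OF multiplier_family_axioms])
  qed
  have "ennreal ((pi / 2) powr q * pi) = (\<integral>\<^sup>+z. ennpowr (ennreal (pi / 2)) q * indicator J z \<partial>circle)"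
    using emeasure_half_circle by (simp add: nn_integral_cmult ennpowr_ennreal J_def ennreal_mult)
  also have "\<dots> \<le> (\<integral>\<^sup>+z. ennpowr (MT_max a f z) q \<partial>circle)"
    using q lower by (intro nn_integral_mono) (auto simp: indicator_def intro!: ennpowr_mono)
  also have "\<dots> \<le> ennpowr 1 q * ennreal pi"
    using op_norm_lessD[OF _ less f] q by (simp add: If)
  also have "\<dots> = ennreal pi" using ennpowr_ennreal[of 1 q] by simp
  finally have "(pi / 2) powr q * pi \<le> pi" by simp
  moreover have "1 < (pi / 2) powr q"
    using q pi_gt3 by (intro gr_one_powr) auto
  ultimately show False by simp
qed

section \<open>Power weights\<close>

text \<open>The bound is uniform in \<open>b\<close>. If \<open>norm b > 1 / 2\<close>, two points
  with \<open>mscale b \<le> t\<close> are within \<open>4 * t\<close>, so the set lies in one arc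
  and 28 = 7 * 4. If \<open>norm b \<le> 1 / 2\<close>, then \<open>mscale b \<ge> 1 / 2\<close>, so
  either the set is empty or \<open>28 * t\<close> exceeds the total length.\<close>

lemma emeasure_mscale_le:
  assumes b: "norm b < 1" and t: "t > 0"
  shows "emeasure circle {u \<in> space circle. mscale b u \<le> t} \<le> ennreal (28 * t)"
proof (cases "norm b \<le> 1 / 2")
  case True
  show ?thesis
  proof (cases "t < 1 / 2")
    case True
    have "\<not> mscale b u \<le> t" if "u \<in> space circle" for u
      using mscale_ge[of u b] True \<open>norm b \<le> 1 / 2\<close> that by (simp add: space_circle)
    then have "{u \<in> space circle. mscale b u \<le> t} = {}" by blast
    then show ?thesis by (simp only: emeasure_empty zero_le)
  next
    case False
    then have "2 * pi \<le> 28 * t" using pi_less_4 by simp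
    then show ?thesis using emeasure_circle_le order_trans ennreal_leI by blast
  qed
next
  case False
  show ?thesis
  proof (cases "{u \<in> space circle. mscale b u \<le> t} = {}")
    case nonempty: False
    then obtain v where v: "v \<in> space circle" "mscale b v \<le> t" by auto
    have "{u \<in> space circle. mscale b u \<le> t} \<subseteq> carc v (4 * t)"
    proof
      fix u assume u: "u \<in> {u \<in> space circle. mscale b u \<le> t}"
      have "norm (cnj b * (u - v)) = norm ((1 + cnj b * u) - (1 + cnj b * v))" by (simp add: algebra_simps)
      also have "\<dots> \<le> mscale b u + mscale b v" unfolding mscale_def by (rule norm_triangle_ineq4)
      also have "\<dots> \<le> 2 * t" using u v by auto
      finally have "norm b * dist u v \<le> 2 * t" by (simp add: norm_mult dist_norm)
      moreover have "1 / 2 * dist u v \<le> norm b * dist u v" using False by (intro mult_right_mono) auto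
      ultimately show "u \<in> carc v (4 * t)" using u by (simp add: carc_eq)
    qed
    then have "emeasure circle {u \<in> space circle. mscale b u \<le> t} \<le> emeasure circle (carc v (4 * t))"
      by (intro emeasure_mono) auto
    also have "\<dots> \<le> ennreal (7 * (4 * t))" using v t by (intro emeasure_carc_le) (auto simp: space_circle)
    finally show ?thesis by simp
  next
    case True
    then show ?thesis by (simp only: emeasure_empty zero_le)
  qed
qed

definition KS :: "real \<Rightarrow> real" where
  "KS \<gamma> = 28 * 2 powr \<gamma> / (1 - 2 powr (\<gamma> - 1)) + 56 / (1 - 2 powr (- \<gamma>))"

lemma KS_pos: "0 < \<gamma> \<Longrightarrow> \<gamma> < 1 \<Longrightarrow> KS \<gamma> > 0"
  using powr_less_mono[of "\<gamma> - 1" 0 2] powr_less_mono[of "- \<gamma>" 0 2] by (auto simp: KS_def intro!: add_pos_pos)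

text \<open>The integral is split at \<open>mscale b u = S\<close>. Below, the integrand is a
  multiple of \<open>mscale b u powr (- \<gamma>)\<close>, whose dyadic sum converges as
  \<open>\<gamma> < 1\<close>; above, it is \<open>mscale b u powr (- \<gamma> - 1)\<close>, whose
  sum converges as \<open>\<gamma> > 0\<close>. The summands of \<open>KS\<close> are these two
  series.\<close>

lemma mscale_kernel_integral:
  assumes b: "norm b < 1" and \<gamma>: "0 < \<gamma>" "\<gamma> < 1" and S: "S > 0"
  shows "(\<integral>\<^sup>+u. ennreal (mscale b u powr (- \<gamma>) / max S (mscale b u)) \<partial>circle) \<le> ennreal (KS \<gamma> * S powr (- \<gamma>))"
proof -
  define L where "L t = {u \<in> space circle. mscale b u \<le> t}" for t
  have [measurable]: "L t \<in> sets circle" for t unfolding L_def by measurable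
  define A where "A j = ((1 / 2) ^ Suc j * S) powr (- \<gamma>) / S" for j :: nat
  define B where "B j = (2 ^ j * S) powr (- \<gamma> - 1)" for j :: nat
  have pos: "A j \<ge> 0" "B j \<ge> 0" for j using S by (auto simp: A_def B_def)
  define x where "x = (2::real) powr (\<gamma> - 1)"
  define y where "y = (2::real) powr (- \<gamma>)"
  have xy: "0 \<le> x" "x < 1" "0 \<le> y" "y < 1"
    using \<gamma> powr_less_mono[of "\<gamma> - 1" 0 2] powr_less_mono[of "- \<gamma>" 0 2] by (auto simp: x_def y_def)
  have "(\<integral>\<^sup>+u. ennreal (mscale b u powr (- \<gamma>) / max S (mscale b u)) \<partial>circle)
    \<le> (\<integral>\<^sup>+u. (\<Sum>j. ennreal (A j) * indicator (L ((1 / 2) ^ j * S)) u) + (\<Sum>j. ennreal (B j) * indicator (L (2 ^ Suc j * S)) u) \<partial>circle)"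
  proof (rule nn_integral_mono)
    fix u assume u: "u \<in> space circle"
    define s where "s = mscale b u"
    have s: "s > 0" using mscale_pos[OF b] u by (simp add: s_def space_circle)
    show "ennreal (mscale b u powr (- \<gamma>) / max S (mscale b u))
      \<le> (\<Sum>j. ennreal (A j) * indicator (L ((1 / 2) ^ j * S)) u) + (\<Sum>j. ennreal (B j) * indicator (L (2 ^ Suc j * S)) u)"
    proof (cases "s \<le> S")
      case True
      have "\<exists>j::nat. (1 / 2) ^ Suc j * S < s \<and> s \<le> (1 / 2) ^ j * S"
      proof -
        have "s / 2 < S" using True s by simp
        then obtain j :: nat where j: "2 ^ j * (s / 2) < S" "S \<le> 2 ^ Suc j * (s / 2)"
          using exists_dyadic_scale[of "s / 2" S] s by auto
        have "(1 / 2) ^ j * S \<le> s" using j(2) by (simp add: power_divide field_simps)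
        moreover have "s < (1 / 2) ^ j * S * 2" using j(1) by (simp add: power_divide field_simps)
        ultimately show ?thesis
        proof (cases "s \<le> (1 / 2) ^ j * S")
          case True
          then have "s = (1 / 2) ^ j * S" using \<open>(1 / 2) ^ j * S \<le> s\<close> by simp
          then show ?thesis using S by (intro exI[of _ j]) (auto simp: power_divide field_simps)
        next
          case False
          show ?thesis
          proof (cases j)
            case 0 then show ?thesis using False \<open>s \<le> S\<close> by simp
          next
            case (Suc i)
            then show ?thesis using False \<open>s < (1 / 2) ^ j * S * 2\<close> by (intro exI[of _ i]) auto
          qed
        qed
      qed
      then obtain j where j: "(1 / 2) ^ Suc j * S < s" "s \<le> (1 / 2) ^ j * S" by blast
      have "s powr (- \<gamma>) \<le> ((1 / 2) ^ Suc j * S) powr (- \<gamma>)"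
        using j S \<gamma> s by (intro powr_mono2') auto
      then have "s powr (- \<gamma>) / max S s \<le> A j"
        unfolding A_def using True S by (simp add: max_def divide_right_mono)
      then have "ennreal (s powr (- \<gamma>) / max S s) \<le> ennreal (A j) * indicator (L ((1 / 2) ^ j * S)) u"
        using j u by (simp add: L_def s_def ennreal_leI)
      also have "\<dots> \<le> (\<Sum>j. ennreal (A j) * indicator (L ((1 / 2) ^ j * S)) u)"
        by (rule ennreal_le_suminf)
      finally show ?thesis unfolding s_def by (rule order_trans) simp
    next
      case False
      then obtain j :: nat where j: "2 ^ j * S < s" "s \<le> 2 ^ Suc j * S"
        using exists_dyadic_scale[OF S, of s] by auto
      have "s powr (- \<gamma>) / max S s = s powr (- \<gamma> - 1)"
        using False s by (simp add: max_def powr_diff)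
      also have "\<dots> \<le> B j"
        unfolding B_def using j S \<gamma> s by (intro powr_mono2') auto
      finally have "ennreal (s powr (- \<gamma>) / max S s) \<le> ennreal (B j) * indicator (L (2 ^ Suc j * S)) u"
        using j u by (simp add: L_def s_def ennreal_leI)
      also have "\<dots> \<le> (\<Sum>j. ennreal (B j) * indicator (L (2 ^ Suc j * S)) u)"
        by (rule ennreal_le_suminf)
      finally show ?thesis unfolding s_def by (rule order_trans) simp
    qed
  qed
  also have "\<dots> = (\<Sum>j. ennreal (A j) * emeasure circle (L ((1 / 2) ^ j * S))) + (\<Sum>j. ennreal (B j) * emeasure circle (L (2 ^ Suc j * S)))"
    by (simp add: nn_integral_add nn_integral_suminf nn_integral_cmult)
  also have "\<dots> \<le> (\<Sum>j. ennreal (A j) * ennreal (28 * ((1 / 2) ^ j * S))) + (\<Sum>j. ennreal (B j) * ennreal (28 * (2 ^ Suc j * S)))"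
    unfolding L_def using S by (intro add_mono suminf_le mult_left_mono emeasure_mscale_le b) auto
  also have "(\<Sum>j. ennreal (A j) * ennreal (28 * ((1 / 2) ^ j * S))) = (\<Sum>j. ennreal ((28 * 2 powr \<gamma> * S powr (- \<gamma>)) * x ^ j) * 1)"
  proof (intro suminf_cong)
    fix j :: nat
    have "A j * (28 * ((1 / 2) ^ j * S)) = (28 * 2 powr \<gamma> * S powr (- \<gamma>)) * x ^ j"
    proof -
      have h: "(1 / 2 :: real) ^ n = 2 powr (- real n)" for n
      proof -
        have "(2::real) powr (- real n) = inverse (2 ^ n)"
          by (subst powr_minus, subst powr_realpow) auto
        then show ?thesis by (simp add: power_one_over inverse_eq_divide)
      qed
      have "((1 / 2) ^ Suc j * S) powr (- \<gamma>) = 2 powr (\<gamma> * real (Suc j)) * S powr (- \<gamma>)"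
        unfolding h by (simp add: powr_mult powr_powr algebra_simps)
      moreover have "x ^ j = 2 powr (\<gamma> * real j) * (1 / 2) ^ j"
        unfolding h by (simp add: x_def powr_powr algebra_simps flip: powr_realpow powr_add)
      moreover have "2 powr (\<gamma> * real (Suc j)) = 2 powr \<gamma> * 2 powr (\<gamma> * real j)"
        by (simp add: algebra_simps flip: powr_add)
      ultimately show ?thesis using S by (simp add: A_def)
    qed
    note e = this
    have "ennreal (A j) * ennreal (28 * ((1 / 2) ^ j * S)) = ennreal (A j * (28 * ((1 / 2) ^ j * S)))"
      by (rule ennreal_mult[symmetric]) (use pos S in auto)
    then show "ennreal (A j) * ennreal (28 * ((1 / 2) ^ j * S)) = ennreal ((28 * 2 powr \<gamma> * S powr (- \<gamma>)) * x ^ j) * 1"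
      unfolding e by simp
  qed
  also have "\<dots> = ennreal ((28 * 2 powr \<gamma> * S powr (- \<gamma>)) / (1 - x)) * 1"
    using xy by (intro suminf_geometric_ennreal) auto
  also have "(\<Sum>j. ennreal (B j) * ennreal (28 * (2 ^ Suc j * S))) = (\<Sum>j. ennreal ((56 * S powr (- \<gamma>)) * y ^ j) * 1)"
  proof (intro suminf_cong)
    fix j :: nat
    have "B j * (28 * (2 ^ Suc j * S)) = (56 * S powr (- \<gamma>)) * y ^ j"
    proof -
      have t: "2 ^ j * S > 0" using S by simp
      have "B j = (2 ^ j * S) powr (- \<gamma>) / (2 ^ j * S)" unfolding B_def using t by (simp add: powr_diff)
      then have "B j * (28 * (2 ^ Suc j * S)) = 56 * (2 ^ j * S) powr (- \<gamma>)" using t by simp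
      also have "(2 ^ j * S) powr (- \<gamma>) = (2 ^ j) powr (- \<gamma>) * S powr (- \<gamma>)" using S by (simp add: powr_mult)
      also have "(2 ^ j) powr (- \<gamma>) = y ^ j"
        by (simp add: y_def powr_powr mult.commute flip: powr_realpow)
      finally show ?thesis by simp
    qed
    note e = this
    have "ennreal (B j) * ennreal (28 * (2 ^ Suc j * S)) = ennreal (B j * (28 * (2 ^ Suc j * S)))"
      by (rule ennreal_mult[symmetric]) (use pos S in auto)
    then show "ennreal (B j) * ennreal (28 * (2 ^ Suc j * S)) = ennreal ((56 * S powr (- \<gamma>)) * y ^ j) * 1"
      unfolding e by simp
  qed
  also have "\<dots> = ennreal ((56 * S powr (- \<gamma>)) / (1 - y)) * 1"
    using xy by (intro suminf_geometric_ennreal) auto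
  also have "ennreal ((28 * 2 powr \<gamma> * S powr (- \<gamma>)) / (1 - x)) * 1 + ennreal ((56 * S powr (- \<gamma>)) / (1 - y)) * 1 = ennreal (KS \<gamma> * S powr (- \<gamma>))"
    using xy by (simp add: KS_def x_def[symmetric] y_def[symmetric] distrib_right flip: ennreal_plus)
  finally show ?thesis .
qed

definition Kschur :: "real \<Rightarrow> real" where
  "Kschur p = 2 powr p * KS (p / (p + 1)) powr (p - 1) * KS (2 / (p + 1))"

lemma Kschur_pos: "1 < p \<Longrightarrow> Kschur p > 0"
  using KS_pos[of "p / (p + 1)"] KS_pos[of "2 / (p + 1)"] by (auto simp: Kschur_def)

text \<open>The kernel is homogeneous of degree -1 in \<open>mscale b\<close>, and
  \<open>p - 2\<close> lies strictly between -1 and \<open>p - 1\<close>, the range in which such an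
  operator is bounded with a power weight. The proof is Schur's test with the function
  \<open>mscale b u powr (- \<beta>)\<close>.\<close>

lemma mscale_schur:
  assumes b: "norm b < 1" and p: "1 < p" and [measurable]: "F \<in> borel_measurable circle"
  shows "(\<integral>\<^sup>+z. ennpowr (\<integral>\<^sup>+u. F u * ennreal (1 / max (mscale b z) (mscale b u)) \<partial>circle) p * ennreal (mscale b z powr (p - 2)) \<partial>circle)
    \<le> ennreal (Kschur p) * (\<integral>\<^sup>+u. ennpowr (F u) p * ennreal (mscale b u powr (p - 2)) \<partial>circle)"
proof -
  define s where "s = mscale b"
  have s: "s u > 0" if "u \<in> space circle" for u
    using mscale_pos[OF b] that by (simp add: s_def space_circle)
  have [measurable]: "s \<in> borel_measurable circle" by (simp add: s_def)
  \<comment> \<open>The two identities \<open>ex\<close> below are the same equation,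
    \<open>\<gamma> = \<beta> * (p - 1) - (p - 2)\<close>; this solution has both exponents strictly
    between 0 and 1 for every \<open>p > 1\<close>.\<close>
  define \<beta> where "\<beta> = p / (p + 1)"
  define \<gamma> where "\<gamma> = 2 / (p + 1)"
  have \<beta>: "0 < \<beta>" "\<beta> < 1" and \<gamma>: "0 < \<gamma>" "\<gamma> < 1" using p by (auto simp: \<beta>_def \<gamma>_def)
  have ex: "p - 2 - \<beta> * (p - 1) = - \<gamma>" "\<beta> * p - \<beta> - \<gamma> = p - 2"
  proof -
    define i where "i = 1 / (p + 1)"
    have e: "\<beta> = 1 - i" "\<gamma> = 2 * i" "i * p = 1 - i"
      using p by (auto simp: \<beta>_def \<gamma>_def i_def field_simps)
    show "p - 2 - \<beta> * (p - 1) = - \<gamma>" "\<beta> * p - \<beta> - \<gamma> = p - 2"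
      unfolding e(1,2) using e(3) by (simp_all add: algebra_simps)
  qed
  define c where "c = 2 powr p * KS \<beta> powr (p - 1)"
  have c: "c \<ge> 0" by (simp add: c_def)
  have sint: "(\<integral>\<^sup>+u. ennreal (s u powr (- \<delta>) / max (s z) (s u)) \<partial>circle) \<le> ennreal (KS \<delta> * s z powr (- \<delta>))"
    if "0 < \<delta>" "\<delta> < 1" "z \<in> space circle" for \<delta> z
    using mscale_kernel_integral[OF b that(1,2) s[OF that(3)]] by (simp add: s_def)
  define k where "k z u = ennreal (s u powr (- \<beta>) / max (s z) (s u))" for z u
  have [measurable]: "(\<lambda>(z, u). k z u) \<in> borel_measurable (circle \<Otimes>\<^sub>M circle)"
    unfolding k_def by measurable
  interpret P: pair_sigma_finite circle circle ..
  have ptw: "ennpowr (\<integral>\<^sup>+u. F u * ennreal (1 / max (s z) (s u)) \<partial>circle) p * ennreal (s z powr (p - 2))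
    \<le> (\<integral>\<^sup>+u. ennreal c * (ennpowr (F u) p * ennreal (s u powr (\<beta> * p - \<beta>)) * ennreal (s z powr (- \<gamma>) / max (s u) (s z))) \<partial>circle)"
    if z: "z \<in> space circle" for z
  proof -
    define h where "h u = F u * ennreal (s u powr \<beta>)" for u
    have [measurable]: "h \<in> borel_measurable circle" unfolding h_def by measurable
    have [measurable]: "k z \<in> borel_measurable circle" unfolding k_def by measurable
    have "(\<integral>\<^sup>+u. F u * ennreal (1 / max (s z) (s u)) \<partial>circle) = (\<integral>\<^sup>+u. h u * k z u \<partial>circle)"
    proof (rule nn_integral_cong)
      fix u assume u: "u \<in> space circle"
      have "ennreal (s u powr \<beta>) * k z u = ennreal (s u powr \<beta> * (s u powr (- \<beta>) / max (s z) (s u)))"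
        unfolding k_def using s[OF u] s[OF z] by (intro ennreal_mult[symmetric]) auto
      also have "s u powr \<beta> * (s u powr (- \<beta>) / max (s z) (s u)) = 1 / max (s z) (s u)"
        using s[OF u] by (simp add: powr_minus)
      finally show "F u * ennreal (1 / max (s z) (s u)) = h u * k z u" by (simp add: h_def mult.assoc)
    qed
    then have "ennpowr (\<integral>\<^sup>+u. F u * ennreal (1 / max (s z) (s u)) \<partial>circle) p = ennpowr (\<integral>\<^sup>+u. h u * k z u \<partial>circle) p"
      by simp
    also have "\<dots> \<le> ennreal (2 powr p * (KS \<beta> * s z powr (- \<beta>)) powr (p - 1)) * (\<integral>\<^sup>+u. ennpowr (h u) p * k z u \<partial>circle)"
      using p KS_pos[OF \<beta>] sint[OF \<beta> z] by (intro nn_integral_ennpowr_le) (auto simp: k_def)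
    finally have "ennpowr (\<integral>\<^sup>+u. F u * ennreal (1 / max (s z) (s u)) \<partial>circle) p * ennreal (s z powr (p - 2))
      \<le> ennreal (2 powr p * (KS \<beta> * s z powr (- \<beta>)) powr (p - 1)) * (\<integral>\<^sup>+u. ennpowr (h u) p * k z u \<partial>circle) * ennreal (s z powr (p - 2))"
      by (rule mult_right_mono) simp
    also have "\<dots> = ennreal (2 powr p * (KS \<beta> * s z powr (- \<beta>)) powr (p - 1) * s z powr (p - 2)) * (\<integral>\<^sup>+u. ennpowr (h u) p * k z u \<partial>circle)"
      by (simp add: ennreal_mult mult_ac)
    also have "2 powr p * (KS \<beta> * s z powr (- \<beta>)) powr (p - 1) * s z powr (p - 2) = c * s z powr (- \<gamma>)"
    proof -
      have "(KS \<beta> * s z powr (- \<beta>)) powr (p - 1) = KS \<beta> powr (p - 1) * s z powr (- \<beta> * (p - 1))"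
        by (simp add: powr_mult powr_powr)
      moreover have "s z powr (- \<beta> * (p - 1)) * s z powr (p - 2) = s z powr (- \<gamma>)"
        unfolding powr_add[symmetric] ex(1)[symmetric] by (simp add: algebra_simps)
      ultimately show ?thesis by (simp add: c_def mult.assoc)
    qed
    also have "ennreal (c * s z powr (- \<gamma>)) * (\<integral>\<^sup>+u. ennpowr (h u) p * k z u \<partial>circle)
      = (\<integral>\<^sup>+u. ennreal (c * s z powr (- \<gamma>)) * (ennpowr (h u) p * k z u) \<partial>circle)"
      by (rule nn_integral_cmult[symmetric]) measurable
    also have "\<dots> = (\<integral>\<^sup>+u. ennreal c * (ennpowr (F u) p * ennreal (s u powr (\<beta> * p - \<beta>)) * ennreal (s z powr (- \<gamma>) / max (s u) (s z))) \<partial>circle)"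
    proof (rule nn_integral_cong)
      fix u assume u: "u \<in> space circle"
      have hp: "ennpowr (h u) p = ennpowr (F u) p * ennreal (s u powr (\<beta> * p))"
        by (simp add: h_def ennpowr_mult ennpowr_ennreal powr_powr)
      have "ennreal (c * s z powr (- \<gamma>)) * (ennreal (s u powr (\<beta> * p)) * k z u)
        = ennreal (c * s z powr (- \<gamma>) * (s u powr (\<beta> * p) * (s u powr (- \<beta>) / max (s z) (s u))))"
        unfolding k_def using c s[OF u] s[OF z] by (intro ennreal_mult3[symmetric]) (auto simp: le_max_iff_disj)
      also have "c * s z powr (- \<gamma>) * (s u powr (\<beta> * p) * (s u powr (- \<beta>) / max (s z) (s u)))
        = c * (s u powr (\<beta> * p - \<beta>) * (s z powr (- \<gamma>) / max (s u) (s z)))"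
        using s[OF u] by (simp add: powr_diff powr_minus max.commute divide_inverse mult_ac)
      also have "ennreal \<dots> = ennreal c * (ennreal (s u powr (\<beta> * p - \<beta>)) * ennreal (s z powr (- \<gamma>) / max (s u) (s z)))"
        using c s[OF u] s[OF z] by (subst ennreal_mult, simp, simp add: less_max_iff_disj less_imp_le, subst ennreal_mult) (auto simp: le_max_iff_disj)
      finally have e: "ennreal (c * s z powr (- \<gamma>)) * (ennreal (s u powr (\<beta> * p)) * k z u)
        = ennreal c * (ennreal (s u powr (\<beta> * p - \<beta>)) * ennreal (s z powr (- \<gamma>) / max (s u) (s z)))" .
      have "ennreal (c * s z powr (- \<gamma>)) * (ennpowr (h u) p * k z u)
        = ennpowr (F u) p * (ennreal (c * s z powr (- \<gamma>)) * (ennreal (s u powr (\<beta> * p)) * k z u))"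
        unfolding hp by (simp only: mult_ac)
      also have "\<dots> = ennreal c * (ennpowr (F u) p * ennreal (s u powr (\<beta> * p - \<beta>)) * ennreal (s z powr (- \<gamma>) / max (s u) (s z)))"
        unfolding e by (simp only: mult_ac)
      finally show "ennreal (c * s z powr (- \<gamma>)) * (ennpowr (h u) p * k z u) = \<dots>" .
    qed
    finally show ?thesis .
  qed
  have "(\<integral>\<^sup>+z. ennpowr (\<integral>\<^sup>+u. F u * ennreal (1 / max (s z) (s u)) \<partial>circle) p * ennreal (s z powr (p - 2)) \<partial>circle)
    \<le> (\<integral>\<^sup>+z. (\<integral>\<^sup>+u. ennreal c * (ennpowr (F u) p * ennreal (s u powr (\<beta> * p - \<beta>)) * ennreal (s z powr (- \<gamma>) / max (s u) (s z))) \<partial>circle) \<partial>circle)"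
    by (rule nn_integral_mono) (rule ptw)
  also have "\<dots> = (\<integral>\<^sup>+u. (\<integral>\<^sup>+z. ennreal c * (ennpowr (F u) p * ennreal (s u powr (\<beta> * p - \<beta>)) * ennreal (s z powr (- \<gamma>) / max (s u) (s z))) \<partial>circle) \<partial>circle)"
    by (rule P.Fubini') measurable
  also have "\<dots> \<le> (\<integral>\<^sup>+u. ennreal (Kschur p) * (ennpowr (F u) p * ennreal (s u powr (p - 2))) \<partial>circle)"
  proof (rule nn_integral_mono)
    fix u assume u: "u \<in> space circle"
    have "(\<integral>\<^sup>+z. ennreal c * (ennpowr (F u) p * ennreal (s u powr (\<beta> * p - \<beta>)) * ennreal (s z powr (- \<gamma>) / max (s u) (s z))) \<partial>circle)
      = ennreal c * (ennpowr (F u) p * ennreal (s u powr (\<beta> * p - \<beta>)) * (\<integral>\<^sup>+z. ennreal (s z powr (- \<gamma>) / max (s u) (s z)) \<partial>circle))"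
      by (simp add: nn_integral_cmult)
    also have "\<dots> \<le> ennreal c * (ennpowr (F u) p * ennreal (s u powr (\<beta> * p - \<beta>)) * ennreal (KS \<gamma> * s u powr (- \<gamma>)))"
      by (intro mult_left_mono sint \<gamma> u) auto
    also have "\<dots> = ennpowr (F u) p * (ennreal c * (ennreal (s u powr (\<beta> * p - \<beta>)) * ennreal (KS \<gamma> * s u powr (- \<gamma>))))"
      by (simp only: mult_ac)
    also have "ennreal c * (ennreal (s u powr (\<beta> * p - \<beta>)) * ennreal (KS \<gamma> * s u powr (- \<gamma>))) = ennreal (c * (s u powr (\<beta> * p - \<beta>) * (KS \<gamma> * s u powr (- \<gamma>))))"
      using c KS_pos[OF \<gamma>] by (simp add: ennreal_mult)
    also have "c * (s u powr (\<beta> * p - \<beta>) * (KS \<gamma> * s u powr (- \<gamma>))) = Kschur p * s u powr (p - 2)"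
    proof -
      have "s u powr (\<beta> * p - \<beta>) * s u powr (- \<gamma>) = s u powr (p - 2)"
        unfolding powr_add[symmetric] ex(2)[symmetric] by simp
      moreover have "Kschur p = c * KS \<gamma>" by (simp add: Kschur_def c_def \<beta>_def \<gamma>_def)
      moreover have "c * (x * (K * y)) = c * K * (x * y)" for x y K :: real by (simp only: mult_ac)
      ultimately show ?thesis by (simp only:)
    qed
    also have "ennpowr (F u) p * ennreal (Kschur p * s u powr (p - 2)) = ennreal (Kschur p) * (ennpowr (F u) p * ennreal (s u powr (p - 2)))"
      using Kschur_pos[OF p] by (simp add: ennreal_mult mult_ac)
    finally show "(\<integral>\<^sup>+z. ennreal c * (ennpowr (F u) p * ennreal (s u powr (\<beta> * p - \<beta>)) * ennreal (s z powr (- \<gamma>) / max (s u) (s z))) \<partial>circle)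
      \<le> ennreal (Kschur p) * (ennpowr (F u) p * ennreal (s u powr (p - 2)))" by simp
  qed
  also have "\<dots> = ennreal (Kschur p) * (\<integral>\<^sup>+u. ennpowr (F u) p * ennreal (s u powr (p - 2)) \<partial>circle)"
    by (rule nn_integral_cmult) measurable
  finally show ?thesis by (simp add: s_def)
qed

text \<open>The 3 counts neighbouring shells, and \<open>2 powr (2 * \<bar>p - 2\<bar>)\<close>
  bounds the variation of the weight over them, used once in each direction.\<close>

definition KW :: "real \<Rightarrow> real \<Rightarrow> real" where
  "KW q p = 2 powr p * (3 * (2 powr (2 * \<bar>p - 2\<bar>))\<^sup>2 * KU q p + 2 powr p * Kschur p)"

lemma KW_pos: "1 \<le> q \<Longrightarrow> q < p \<Longrightarrow> KW q p > 0"
  using KU_pos[of q p] Kschur_pos[of p] by (auto simp: KW_def intro!: mult_pos_pos add_pos_pos)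

text \<open>The weight is essentially constant on the shells \<open>2\<^sup>k \<le> mscale b < 2\<^sup>k\<^sup>+\<^sup>1\<close>, and the interaction of
  distant shells involves no singularity of the kernel.\<close>

lemma (in multiplier_family) TM_weighted:
  assumes b: "norm b < 1" and q: "1 \<le> q" "q < p" and A: "1 \<le> A"
    and TM_bound: "\<And>f. nice f \<Longrightarrow> (\<integral>\<^sup>+z. ennpowr (TM f z) q \<partial>circle)
      \<le> ennreal (A powr q) * (\<integral>\<^sup>+z. ennpowr (ennreal (norm (f z))) q \<partial>circle)"
    and g: "integrable circle g" and c: "c \<ge> 0"
  shows "(\<integral>\<^sup>+z. ennpowr (TM g z) p * ennreal (c * mscale b z powr (p - 2)) \<partial>circle)
    \<le> ennreal (KW q p * A powr p) * (\<integral>\<^sup>+z. ennpowr (ennreal (norm (g z))) p * ennreal (c * mscale b z powr (p - 2)) \<partial>circle)"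
proof -
  have p: "1 < p" using q by simp
  have [measurable]: "g \<in> borel_measurable circle" using g by auto
  define s where "s = mscale b"
  have s: "0 < s u" "1 - norm b \<le> s u" "s u \<le> 2" if "u \<in> space circle" for u
    using mscale_pos[OF b] mscale_ge[of u b] mscale_le[OF b] that by (auto simp: s_def space_circle)
  have [measurable]: "s \<in> borel_measurable circle" by (simp add: s_def)
  define w where "w u = ennreal (s u powr (p - 2))" for u
  have [measurable]: "w \<in> borel_measurable circle" unfolding w_def by measurable
  define shell where "shell u = \<lfloor>log 2 (s u)\<rfloor>" for u
  have shell_measurable [measurable]: "shell \<in> measurable circle (count_space UNIV)" unfolding shell_def by measurable
  \<comment> \<open>Finite because \<open>mscale b\<close> lies between \<open>1 - norm b\<close>
    and 2. The number of shells depends on \<open>b\<close>, but each point meets at most three of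
    the pieces \<open>gl k\<close>, so it does not enter the constant.\<close>
  define K where "K = {\<lfloor>log 2 (1 - norm b)\<rfloor>..1}"
  have shellK: "shell u \<in> K" if u: "u \<in> space circle" for u
  proof -
    have "log 2 (1 - norm b) \<le> log 2 (s u)" "log 2 (s u) \<le> log 2 2"
      using s[OF u] b by (auto simp del: log_eq_one)
    then have "\<lfloor>log 2 (1 - norm b)\<rfloor> \<le> shell u" "shell u \<le> \<lfloor>log 2 2\<rfloor>"
      unfolding shell_def by (auto intro: floor_mono)
    then show ?thesis by (simp add: K_def)
  qed
  have shell_bounds: "2 powr real_of_int (shell u) \<le> s u" "s u < 2 powr (real_of_int (shell u) + 1)" if u: "u \<in> space circle" for u
  proof -
    have "real_of_int (shell u) \<le> log 2 (s u)" "log 2 (s u) < real_of_int (shell u) + 1"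
      unfolding shell_def by linarith+
    then show "2 powr real_of_int (shell u) \<le> s u" "s u < 2 powr (real_of_int (shell u) + 1)"
      using s[OF u] by (auto simp: le_log_iff log_less_iff)
  qed
  \<comment> \<open>For a point in shell \<open>k\<close> or a neighbouring one,
    \<open>log 2 (s u)\<close> is within 2 of \<open>k\<close>, so the weight is within this factor
    of \<open>W k\<close>.\<close>
  define E where "E = 2 powr (2 * \<bar>p - 2\<bar>)"
  define W where "W k = 2 powr (real_of_int k * (p - 2))" for k :: int
  have E: "E > 0" and W: "W k > 0" for k by (auto simp: E_def W_def)
  have compare: "s u powr (p - 2) \<le> E * W k" "W k \<le> E * s u powr (p - 2)" if u: "u \<in> space circle" and k: "\<bar>shell u - k\<bar> \<le> 1" for u k
  proof -
    define l where "l = log 2 (s u)"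
    have "s u powr (p - 2) = (2 powr l) powr (p - 2)" using s[OF u] by (simp add: l_def)
    then have sl: "s u powr (p - 2) = 2 powr (l * (p - 2))" by (simp add: powr_powr)
    have "\<bar>l - real_of_int k\<bar> \<le> 2" using k unfolding l_def shell_def by linarith
    then have "\<bar>(l - real_of_int k) * (p - 2)\<bar> \<le> 2 * \<bar>p - 2\<bar>"
      unfolding abs_mult by (rule mult_right_mono) simp
    then have "l * (p - 2) \<le> 2 * \<bar>p - 2\<bar> + real_of_int k * (p - 2)" "real_of_int k * (p - 2) \<le> 2 * \<bar>p - 2\<bar> + l * (p - 2)"
      by (auto simp: algebra_simps abs_le_iff)
    then show "s u powr (p - 2) \<le> E * W k" "W k \<le> E * s u powr (p - 2)"
      unfolding sl E_def W_def powr_add[symmetric] by (auto intro: powr_mono)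
  qed
  \<comment> \<open>The piece \<open>gl k\<close> carries the singularity but sees an almost
    constant weight; \<open>go k\<close> is supported away from shell \<open>k\<close>.\<close>
  define gl where "gl k u = (if \<bar>shell u - k\<bar> \<le> 1 then g u else 0)" for k u
  define go where "go k u = (if \<bar>shell u - k\<bar> > 1 then g u else 0)" for k u
  have gsum: "(\<lambda>u. gl k u + go k u) = g" for k by (auto simp: gl_def go_def)
  have int: "integrable circle (gl k)" "integrable circle (go k)" for k
  proof -
    have [measurable]: "Measurable.pred circle (\<lambda>u. \<bar>shell u - k\<bar> \<le> 1)" "Measurable.pred circle (\<lambda>u. \<bar>shell u - k\<bar> > 1)"
      by (rule measurable_compose[OF shell_measurable], simp)+
    show "integrable circle (gl k)" unfolding gl_def by (rule integrable_restrict_circle[OF g]) measurable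
    show "integrable circle (go k)" unfolding go_def by (rule integrable_restrict_circle[OF g]) measurable
  qed
  have [measurable]: "gl k \<in> borel_measurable circle" for k using int by auto
  \<comment> \<open>Points in shells at least two apart differ in \<open>s\<close> by more than a
    factor 2, and \<open>s\<close> has Lipschitz constant at most 1.\<close>
  have off: "max (s z) (s u) / 2 \<le> dist u z" if z: "z \<in> space circle" and u: "u \<in> space circle" and k: "\<bar>shell u - shell z\<bar> > 1" for z u
  proof -
    have d: "\<bar>s u - s z\<bar> \<le> dist u z"
      using mscale_diff[of b u z] b mult_right_mono[of "norm b" 1 "dist u z"] by (simp add: s_def dist_norm)
    have half: "s x < s y / 2" if "x \<in> space circle" "y \<in> space circle" "shell x + 2 \<le> shell y" for x y
    proof -
      have "real_of_int (shell x) + 1 + 1 \<le> real_of_int (shell y)" using that(3) by linarith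
      then have "2 powr (real_of_int (shell x) + 1 + 1) \<le> 2 powr real_of_int (shell y)" by (intro powr_mono) auto
      moreover have "(2::real) powr (real_of_int (shell x) + 1 + 1) = 2 * 2 powr (real_of_int (shell x) + 1)"
        by (simp add: powr_add)
      ultimately have "2 * 2 powr (real_of_int (shell x) + 1) \<le> 2 powr real_of_int (shell y)" by (simp only:)
      then show ?thesis using shell_bounds[OF that(1)] shell_bounds[OF that(2)] by linarith
    qed
    consider "shell u + 2 \<le> shell z" | "shell z + 2 \<le> shell u" using k by linarith
    then show ?thesis
    proof cases
      case 1
      then show ?thesis using half[OF u z 1] d s[OF u] by (auto simp: max_def)
    next
      case 2
      then show ?thesis using half[OF z u 2] d s[OF z] by (auto simp: max_def)
    qed
  qed
  define H where "H z = (\<integral>\<^sup>+u. ennreal (norm (g u)) * ennreal (1 / max (s z) (s u)) \<partial>circle)" for z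
  have [measurable]: "H \<in> borel_measurable circle" unfolding H_def by measurable
  have TM_le: "TM g z \<le> TU (gl (shell z)) z + 2 * H z" if z: "z \<in> space circle" for z
    unfolding TM_def
  proof (rule SUP_least)
    fix N :: nat assume N: "N \<in> {1..}"
    have "norm (PV N (\<lambda>u. gl (shell z) u + go (shell z) u) z) \<le> norm (PV N (gl (shell z)) z) + norm (S N (go (shell z)) z)"
    proof (rule norm_PV_add_far[OF int])
      show "s z / 4 > 0" using s[OF z] by simp
      fix u assume u: "u \<in> space circle" "dist u z \<le> s z / 4"
      have "\<not> \<bar>shell u - shell z\<bar> > 1"
        using off[OF z u(1)] u(2) s[OF z] by (auto simp: max_def split: if_splits)
      then show "go (shell z) u = 0" by (simp add: go_def)
    qed
    then have "ennreal (norm (PV N g z)) \<le> ennreal (norm (PV N (gl (shell z)) z)) + ennreal (norm (S N (go (shell z)) z))"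
      unfolding gsum by (simp flip: ennreal_plus)
    also have "ennreal (norm (PV N (gl (shell z)) z)) \<le> TM (gl (shell z)) z"
      unfolding TM_def using N by (rule SUP_upper)
    also have "\<dots> \<le> TU (gl (shell z)) z"
      unfolding TU_def by (rule TM_le_tsharp[OF int(1) z])
    also have "ennreal (norm (S N (go (shell z)) z)) \<le> (\<integral>\<^sup>+u. ennreal (norm (go (shell z) u)) * ennreal (1 / dist u z) \<partial>circle)"
      by (rule norm_S_le)
    also have "\<dots> \<le> (\<integral>\<^sup>+u. 2 * (ennreal (norm (g u)) * ennreal (1 / max (s z) (s u))) \<partial>circle)"
    proof (rule nn_integral_mono)
      fix u assume u: "u \<in> space circle"
      show "ennreal (norm (go (shell z) u)) * ennreal (1 / dist u z) \<le> 2 * (ennreal (norm (g u)) * ennreal (1 / max (s z) (s u)))"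
      proof (cases "\<bar>shell u - shell z\<bar> > 1")
        case True
        define M where "M = max (s z) (s u)"
        have M: "M > 0" using s[OF u] by (simp add: M_def less_max_iff_disj)
        have "1 / dist u z \<le> 1 / (M / 2)"
          using off[OF z u True] M by (intro divide_left_mono mult_pos_pos) (auto simp: M_def)
        then have "ennreal (1 / dist u z) \<le> ennreal (2 * (1 / M))" by (intro ennreal_leI) simp
        also have "\<dots> = 2 * ennreal (1 / M)" using M by (subst ennreal_mult) auto
        finally have "ennreal (norm (g u)) * ennreal (1 / dist u z) \<le> ennreal (norm (g u)) * (2 * ennreal (1 / M))"
          by (rule mult_left_mono) simp
        then show ?thesis using True by (simp add: go_def M_def mult_ac)
      qed (simp add: go_def)
    qed
    also have "\<dots> = 2 * H z" unfolding H_def by (rule nn_integral_cmult) measurable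
    finally show "ennreal (norm (PV N g z)) \<le> TU (gl (shell z)) z + 2 * H z"
      by (simp add: add_mono)
  qed
  \<comment> \<open>A measurable majorant: summing over all shells instead of selecting the one
    containing \<open>z\<close> allows each \<open>gl k\<close> to be integrated over the whole
    circle.\<close>
  define M where "M z = ennreal (2 powr p) * ((\<Sum>k\<in>K. ennpowr (TU (gl k) z) p * ennreal (E * W k)) + ennreal (2 powr p) * (ennpowr (H z) p * w z))" for z
  have [measurable]: "M \<in> borel_measurable circle" unfolding M_def by measurable
  have TM_M: "ennpowr (TM g z) p * w z \<le> M z" if z: "z \<in> space circle" for z
  proof -
    have "ennpowr (TM g z) p \<le> ennpowr (TU (gl (shell z)) z + 2 * H z) p"
      using p by (intro ennpowr_mono TM_le z) auto
    also have "\<dots> \<le> ennreal (2 powr p) * (ennpowr (TU (gl (shell z)) z) p + ennpowr (2 * H z) p)"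
      using p by (intro ennpowr_add_le) auto
    also have "ennpowr (2 * H z) p = ennreal (2 powr p) * ennpowr (H z) p"
      using ennpowr_ennreal[of 2 p] by (simp add: ennpowr_mult)
    finally have "ennpowr (TM g z) p * w z \<le> ennreal (2 powr p) * (ennpowr (TU (gl (shell z)) z) p + ennreal (2 powr p) * ennpowr (H z) p) * w z"
      by (rule mult_right_mono) simp
    also have "\<dots> = ennreal (2 powr p) * (ennpowr (TU (gl (shell z)) z) p * w z + ennreal (2 powr p) * (ennpowr (H z) p * w z))"
      by (simp add: distrib_right distrib_left mult.assoc)
    also have "\<dots> \<le> M z"
      unfolding M_def
    proof (intro mult_left_mono add_right_mono)
      have "ennpowr (TU (gl (shell z)) z) p * w z \<le> ennpowr (TU (gl (shell z)) z) p * ennreal (E * W (shell z))"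
        unfolding w_def using compare(1)[OF z, of "shell z"] by (intro mult_left_mono ennreal_leI) auto
      also have "\<dots> \<le> (\<Sum>k\<in>K. ennpowr (TU (gl k) z) p * ennreal (E * W k))"
        using shellK[OF z] by (intro member_le_sum) (auto simp: K_def)
      finally show "ennpowr (TU (gl (shell z)) z) p * w z \<le> (\<Sum>k\<in>K. ennpowr (TU (gl k) z) p * ennreal (E * W k))" .
    qed auto
    finally show ?thesis .
  qed
  define I where "I = (\<integral>\<^sup>+z. ennpowr (ennreal (norm (g z))) p * w z \<partial>circle)"
  have "(\<integral>\<^sup>+z. M z \<partial>circle) = ennreal (2 powr p) * ((\<Sum>k\<in>K. (\<integral>\<^sup>+z. ennpowr (TU (gl k) z) p \<partial>circle) * ennreal (E * W k)) + ennreal (2 powr p) * (\<integral>\<^sup>+z. ennpowr (H z) p * w z \<partial>circle))"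
    unfolding M_def by (simp add: nn_integral_cmult nn_integral_add nn_integral_sum nn_integral_multc)
  also have "(\<integral>\<^sup>+z. ennpowr (H z) p * w z \<partial>circle) \<le> ennreal (Kschur p) * I"
    using mscale_schur[OF b p, of "\<lambda>u. ennreal (norm (g u))"] by (simp add: H_def w_def I_def s_def)
  also have "(\<Sum>k\<in>K. (\<integral>\<^sup>+z. ennpowr (TU (gl k) z) p \<partial>circle) * ennreal (E * W k)) \<le> ennreal (3 * E\<^sup>2 * (KU q p * A powr p)) * I"
  proof -
    have "(\<integral>\<^sup>+z. ennpowr (TU (gl k) z) p \<partial>circle) * ennreal (E * W k)
      \<le> (\<integral>\<^sup>+u. ennreal (KU q p * A powr p * E\<^sup>2) * (ennpowr (ennreal (norm (gl k u))) p * w u) \<partial>circle)" for k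
    proof -
      have "(\<integral>\<^sup>+z. ennpowr (TU (gl k) z) p \<partial>circle) * ennreal (E * W k)
        \<le> ennreal (KU q p * A powr p) * (\<integral>\<^sup>+u. ennpowr (ennreal (norm (gl k u))) p \<partial>circle) * ennreal (E * W k)"
        by (intro mult_right_mono TU_Lp[OF q A TM_bound int(1)]) auto
      also have "\<dots> = (\<integral>\<^sup>+u. ennreal (KU q p * A powr p) * (ennpowr (ennreal (norm (gl k u))) p * ennreal (E * W k)) \<partial>circle)"
        by (simp add: nn_integral_cmult nn_integral_multc mult.assoc)
      also have "\<dots> \<le> (\<integral>\<^sup>+u. ennreal (KU q p * A powr p * E\<^sup>2) * (ennpowr (ennreal (norm (gl k u))) p * w u) \<partial>circle)"
      proof (rule nn_integral_mono)
        fix u assume u: "u \<in> space circle"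
        show "ennreal (KU q p * A powr p) * (ennpowr (ennreal (norm (gl k u))) p * ennreal (E * W k))
          \<le> ennreal (KU q p * A powr p * E\<^sup>2) * (ennpowr (ennreal (norm (gl k u))) p * w u)"
        proof (cases "\<bar>shell u - k\<bar> \<le> 1")
          case True
          have "E * W k \<le> E\<^sup>2 * s u powr (p - 2)"
            using compare(2)[OF u True] E by (simp add: power2_eq_square mult.assoc)
          then have "ennreal (E * W k) \<le> ennreal (E\<^sup>2) * w u"
            unfolding w_def using E by (subst ennreal_mult[symmetric]) (auto intro: ennreal_leI)
          then have "ennreal (KU q p * A powr p) * (ennpowr (ennreal (norm (gl k u))) p * ennreal (E * W k))
            \<le> ennreal (KU q p * A powr p) * (ennpowr (ennreal (norm (gl k u))) p * (ennreal (E\<^sup>2) * w u))"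
            by (intro mult_left_mono) auto
          also have "\<dots> = ennreal (KU q p * A powr p) * ennreal (E\<^sup>2) * (ennpowr (ennreal (norm (gl k u))) p * w u)"
            by (simp only: mult_ac)
          also have "ennreal (KU q p * A powr p) * ennreal (E\<^sup>2) = ennreal (KU q p * A powr p * E\<^sup>2)"
            using KU_pos[OF q] by (intro ennreal_mult[symmetric]) auto
          finally show ?thesis .
        qed (simp add: gl_def)
      qed
      finally show ?thesis .
    qed
    then have "(\<Sum>k\<in>K. (\<integral>\<^sup>+z. ennpowr (TU (gl k) z) p \<partial>circle) * ennreal (E * W k))
      \<le> (\<Sum>k\<in>K. (\<integral>\<^sup>+u. ennreal (KU q p * A powr p * E\<^sup>2) * (ennpowr (ennreal (norm (gl k u))) p * w u) \<partial>circle))"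
      by (intro sum_mono)
    also have "\<dots> = (\<integral>\<^sup>+u. (\<Sum>k\<in>K. ennreal (KU q p * A powr p * E\<^sup>2) * (ennpowr (ennreal (norm (gl k u))) p * w u)) \<partial>circle)"
      by (rule nn_integral_sum[symmetric]) measurable
    also have "\<dots> \<le> (\<integral>\<^sup>+u. ennreal (3 * E\<^sup>2 * (KU q p * A powr p)) * (ennpowr (ennreal (norm (g u))) p * w u) \<partial>circle)"
    proof (rule nn_integral_mono)
      fix u assume u: "u \<in> space circle"
      define x where "x = ennreal (KU q p * A powr p * E\<^sup>2) * (ennpowr (ennreal (norm (g u))) p * w u)"
      define K3 where "K3 = {k \<in> K. \<bar>shell u - k\<bar> \<le> 1}"
      have fin: "finite K" by (simp add: K_def)
      have "(\<Sum>k\<in>K. ennreal (KU q p * A powr p * E\<^sup>2) * (ennpowr (ennreal (norm (gl k u))) p * w u)) = (\<Sum>k\<in>K. if \<bar>shell u - k\<bar> \<le> 1 then x else 0)"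
        by (intro sum.cong) (auto simp: gl_def x_def)
      also have "\<dots> = (\<Sum>k\<in>K3. x)"
        unfolding K3_def using fin by (simp add: sum.If_cases Int_def)
      also have "\<dots> = of_nat (card K3) * x" by simp
      also have "\<dots> \<le> of_nat 3 * x"
      proof -
        have "K3 \<subseteq> {shell u - 1, shell u, shell u + 1}" by (auto simp: K3_def)
        then have "card K3 \<le> card {shell u - 1, shell u, shell u + 1}" by (intro card_mono) auto
        also have "\<dots> \<le> 3" by (simp add: card_insert_if)
        finally show ?thesis by (intro mult_right_mono) auto
      qed
      also have "\<dots> = ennreal (3 * E\<^sup>2 * (KU q p * A powr p)) * (ennpowr (ennreal (norm (g u))) p * w u)"
      proof -
        have e1: "ennreal (3 * (KU q p * A powr p * E\<^sup>2)) = ennreal 3 * ennreal (KU q p * A powr p * E\<^sup>2)"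
          using KU_pos[OF q] by (intro ennreal_mult) auto
        have e2: "3 * E\<^sup>2 * (KU q p * A powr p) = 3 * (KU q p * A powr p * E\<^sup>2)" by simp
        have "of_nat 3 * x = ennreal 3 * x" by simp
        then show ?thesis unfolding e2 e1 by (simp only: x_def mult.assoc)
      qed
      finally show "(\<Sum>k\<in>K. ennreal (KU q p * A powr p * E\<^sup>2) * (ennpowr (ennreal (norm (gl k u))) p * w u))
        \<le> ennreal (3 * E\<^sup>2 * (KU q p * A powr p)) * (ennpowr (ennreal (norm (g u))) p * w u)" .
    qed
    also have "\<dots> = ennreal (3 * E\<^sup>2 * (KU q p * A powr p)) * I"
      unfolding I_def by (rule nn_integral_cmult) measurable
    finally show ?thesis .
  qed
  finally have "(\<integral>\<^sup>+z. M z \<partial>circle) \<le> ennreal (2 powr p) * (ennreal (3 * E\<^sup>2 * (KU q p * A powr p)) * I + ennreal (2 powr p) * (ennreal (Kschur p) * I))"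
    by (simp add: mult_left_mono add_mono)
  also have "\<dots> \<le> ennreal (2 powr p) * (ennreal (3 * E\<^sup>2 * (KU q p * A powr p)) * I + ennreal (2 powr p) * (ennreal (Kschur p * A powr p) * I))"
    using Kschur_pos[OF p] A p
    by (intro mult_left_mono add_left_mono mult_right_mono ennreal_leI) (auto simp: ge_one_powr_ge_zero)
  also have "\<dots> = ennreal (2 powr p) * (ennreal (3 * E\<^sup>2 * (KU q p * A powr p)) + ennreal (2 powr p) * ennreal (Kschur p * A powr p)) * I"
    by (simp add: distrib_right mult.assoc)
  also have "ennreal (2 powr p) * (ennreal (3 * E\<^sup>2 * (KU q p * A powr p)) + ennreal (2 powr p) * ennreal (Kschur p * A powr p))
    = ennreal (2 powr p * (3 * E\<^sup>2 * (KU q p * A powr p) + 2 powr p * (Kschur p * A powr p)))"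
    using KU_pos[OF q] Kschur_pos[OF p] by (simp add: ennreal_mult ennreal_plus)
  also have "2 powr p * (3 * E\<^sup>2 * (KU q p * A powr p) + 2 powr p * (Kschur p * A powr p)) = KW q p * A powr p"
    by (simp add: KW_def E_def algebra_simps)
  finally have MI: "(\<integral>\<^sup>+z. M z \<partial>circle) \<le> ennreal (KW q p * A powr p) * I" .
  have wc: "ennreal (c * mscale b z powr (p - 2)) = ennreal c * w z" for z
    using c by (simp add: w_def s_def ennreal_mult)
  have "(\<integral>\<^sup>+z. ennpowr (TM g z) p * ennreal (c * mscale b z powr (p - 2)) \<partial>circle) \<le> (\<integral>\<^sup>+z. ennreal c * M z \<partial>circle)"
  proof (rule nn_integral_mono)
    fix z assume "z \<in> space circle"
    from mult_left_mono[OF TM_M[OF this], of "ennreal c"]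
    show "ennpowr (TM g z) p * ennreal (c * mscale b z powr (p - 2)) \<le> ennreal c * M z"
      by (simp add: wc mult_ac)
  qed
  also have "\<dots> = ennreal c * (\<integral>\<^sup>+z. M z \<partial>circle)" by (rule nn_integral_cmult) measurable
  also have "\<dots> \<le> ennreal c * (ennreal (KW q p * A powr p) * I)" by (intro mult_left_mono MI) simp
  also have "\<dots> = ennreal (KW q p * A powr p) * (ennreal c * I)" by (simp only: mult_ac)
  also have "ennreal c * I = (\<integral>\<^sup>+z. ennpowr (ennreal (norm (g z))) p * ennreal (c * mscale b z powr (p - 2)) \<partial>circle)"
    unfolding I_def wc by (subst nn_integral_cmult[symmetric]) (auto simp: mult_ac)
  finally show ?thesis .
qed

text \<open>The Jacobian power from the change of variables is, up to a constant, the weight of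
  \<open>TM_weighted\<close>. The lower bound 1 for the norm supplies the hypothesis
  \<open>1 \<le> A\<close> there.\<close>

lemma op_norm_mobius_le:
  assumes q: "1 < q" "q < p" and a: "\<And>n. 1 \<le> n \<Longrightarrow> norm (a n) < 1" and b: "norm b < 1"
  shows "op_norm p (MT_max (\<lambda>n. mobius (- b) (a n))) \<le> ennreal (2 * KW q p powr (1 / p)) * op_norm q (MT_max a)"
proof (cases "op_norm q (MT_max a)")
  case top
  have "KW q p > 0" using q by (intro KW_pos) auto
  then show ?thesis by (simp add: top ennreal_mult_top)
next
  case (real o')
  have p: "1 < p" "0 < p" using q by auto
  have mf: "multiplier_family (bmul a)" by (rule multiplier_family_bmul, erule a)
  interpret multiplier_family "bmul a" by fact
  have TM: "MT_max a = TM" by (rule MT_max_eq[OF mf])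
  have "1 \<le> op_norm q (MT_max a)" by (rule op_norm_MT_max_ge_1[OF _ q(1)]) (rule a)
  then have o1: "1 \<le> o'" using real by (simp flip: ennreal_1)
  \<comment> \<open>Doubling makes the inequality strict, as \<open>op_norm_lessD\<close> requires;
    this is the 2 in the final constant.\<close>
  define A where "A = 2 * o'"
  have A: "1 \<le> A" using o1 by (simp add: A_def)
  have less: "op_norm q (MT_max a) < ennreal A"
    using o1 by (simp add: real A_def ennreal_less_iff)
  have KWp: "KW q p > 0" using q by (intro KW_pos) auto
  have TM_bound: "(\<integral>\<^sup>+z. ennpowr (TM f z) q \<partial>circle) \<le> ennreal (A powr q) * (\<integral>\<^sup>+z. ennpowr (ennreal (norm (f z))) q \<partial>circle)"
    if f: "nice f" for f
  proof -
    have [measurable]: "f \<in> borel_measurable circle" using f by (rule nice_measurable)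
    obtain B where B: "\<And>z. z \<in> space circle \<Longrightarrow> norm (f z) \<le> B" using f by (auto simp: nice_def)
    have "(\<integral>\<^sup>+z. ennpowr (ennreal (norm (f z))) q \<partial>circle) \<le> (\<integral>\<^sup>+z. ennpowr (ennreal B) q \<partial>circle)"
      using B q by (intro nn_integral_mono ennpowr_mono ennreal_leI) auto
    also have "\<dots> < \<infinity>" by (simp add: emeasure_space_circle ennreal_mult_less_top)
    finally have "f \<in> Lp_space q" using q by (simp add: Lp_space_iff)
    from op_norm_lessD[OF _ less this] q A show ?thesis by (simp add: TM ennpowr_ennreal)
  qed
  have "op_norm p (MT_max (\<lambda>n. mobius (- b) (a n))) \<le> ennreal (KW q p powr (1 / p) * A)"
  proof (rule op_norm_leI[OF p(2)])
    fix f assume f: "f \<in> Lp_space p"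
    then have [measurable]: "f \<in> borel_measurable circle" using p by (simp add: Lp_space_iff)
    have fi: "integrable circle f" using f p by (intro integrable_of_powr[of f p]) (auto simp: Lp_space_iff)
    \<comment> \<open>This constant depends on \<open>b\<close>, but it occurs on both sides of the
      weighted inequality.\<close>
    define c where "c = (1 - (norm b)\<^sup>2) powr (1 - p / 2)"
    have wt: "ennreal (jac b z powr (1 - p / 2)) = ennreal (c * mscale b z powr (p - 2))" if "z \<in> space circle" for z
    proof -
      have s: "mscale b z > 0" using mscale_pos[OF b] that by (simp add: space_circle)
      have "jac b z powr (1 - p / 2) = c / ((mscale b z)\<^sup>2) powr (1 - p / 2)"
        using one_minus_norm_sq_pos[OF b] s by (simp add: jac_def c_def powr_divide)
      also have "((mscale b z)\<^sup>2) powr (1 - p / 2) = (mscale b z powr 2) powr (1 - p / 2)"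
        using s by simp
      also have "\<dots> = mscale b z powr (- (p - 2))" unfolding powr_powr by (simp add: algebra_simps)
      also have "c / mscale b z powr (- (p - 2)) = c * mscale b z powr (p - 2)"
        unfolding powr_minus by (simp add: divide_inverse)
      finally show ?thesis by simp
    qed
    have "(\<integral>\<^sup>+z. ennpowr (MT_max (\<lambda>n. mobius (-b) (a n)) f z) p \<partial>circle)
      \<le> (\<integral>\<^sup>+z. ennpowr (MT_max a (pull b f) z) p * ennreal (jac b z powr (1 - p / 2)) \<partial>circle)"
      by (rule nn_integral_MT_max_le[OF b _ less_imp_le[OF p(1)] f]) (rule a)
    also have "\<dots> = (\<integral>\<^sup>+z. ennpowr (TM (pull b f) z) p * ennreal (c * mscale b z powr (p - 2)) \<partial>circle)"
      unfolding TM by (intro nn_integral_cong) (simp only: wt)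
    also have "\<dots> \<le> ennreal (KW q p * A powr p) * (\<integral>\<^sup>+z. ennpowr (ennreal (norm (pull b f z))) p * ennreal (c * mscale b z powr (p - 2)) \<partial>circle)"
      using q by (intro TM_weighted[OF b _ _ A TM_bound] integrable_pull[OF b fi]) (auto simp: c_def)
    also have "(\<integral>\<^sup>+z. ennpowr (ennreal (norm (pull b f z))) p * ennreal (c * mscale b z powr (p - 2)) \<partial>circle)
      = (\<integral>\<^sup>+z. ennpowr (ennreal (norm (pull b f z))) p * ennreal (jac b z powr (1 - p / 2)) \<partial>circle)"
      by (intro nn_integral_cong) (simp only: wt)
    also have "\<dots> = (\<integral>\<^sup>+z. ennpowr (ennreal (norm (f z))) p \<partial>circle)"
      by (rule nn_integral_pull[OF b p(2), symmetric]) simp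
    also have "ennreal (KW q p * A powr p) = ennpowr (ennreal (KW q p powr (1 / p) * A)) p"
      using KWp A p by (simp add: ennpowr_ennreal powr_mult powr_powr)
    finally show "(\<integral>\<^sup>+z. ennpowr (MT_max (\<lambda>n. mobius (-b) (a n)) f z) p \<partial>circle)
      \<le> ennpowr (ennreal (KW q p powr (1 / p) * A)) p * (\<integral>\<^sup>+z. ennpowr (ennreal (norm (f z))) p \<partial>circle)" .
  qed
  also have "KW q p powr (1 / p) * A = 2 * KW q p powr (1 / p) * o'" by (simp add: A_def)
  also have "ennreal (2 * KW q p powr (1 / p) * o') = ennreal (2 * KW q p powr (1 / p)) * op_norm q (MT_max a)"
    unfolding real using o1 by (intro ennreal_mult) auto
  finally show ?thesis .
qed

theorem propositionA1:
  shows "(\<forall>(a :: nat \<Rightarrow> complex) (b :: complex).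
            (\<forall>n\<ge>1. norm (a n) < 1) \<longrightarrow> norm b < 1 \<longrightarrow>
            op_norm 2 (MT_max a) = op_norm 2 (MT_max (\<lambda>n. mobius (- b) (a n))))
       \<and> (\<exists>\<delta> :: real \<Rightarrow> real \<Rightarrow> real.
            (\<forall>q p. 1 < q \<longrightarrow> q < p \<longrightarrow> \<delta> q p > 0) \<and>
            (\<forall>q p. 1 < q \<longrightarrow> q < p \<longrightarrow>
               (\<forall>(a :: nat \<Rightarrow> complex) (b :: complex).
                  (\<forall>n\<ge>1. norm (a n) < 1) \<longrightarrow> norm b < 1 \<longrightarrow>
                  op_norm p (MT_max (\<lambda>n. mobius (- b) (a n)))
                    \<le> ennreal (\<delta> q p) * op_norm q (MT_max a))) \<and>
            (\<forall>M. \<exists>\<eta>>0. \<forall>q p. 1 < q \<longrightarrow> q < p \<longrightarrow> p - q < \<eta> \<longrightarrow> \<delta> q p > M))"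
proof (rule conjI)
  show "\<forall>(a :: nat \<Rightarrow> complex) b. (\<forall>n\<ge>1. norm (a n) < 1) \<longrightarrow> norm b < 1 \<longrightarrow>
    op_norm 2 (MT_max a) = op_norm 2 (MT_max (\<lambda>n. mobius (- b) (a n)))"
    using op_norm_2_mobius by blast
  \<comment> \<open>The summand \<open>1 / (p - q)\<close> makes the blow-up uniform in
    \<open>q\<close> and \<open>p\<close> by inspection; enlarging the constant preserves the
    inequality.\<close>
  define \<delta> where "\<delta> q p = 2 * KW q p powr (1 / p) + 1 / (p - q)" for q p :: real
  show "\<exists>\<delta> :: real \<Rightarrow> real \<Rightarrow> real.
    (\<forall>q p. 1 < q \<longrightarrow> q < p \<longrightarrow> \<delta> q p > 0) \<and>
    (\<forall>q p. 1 < q \<longrightarrow> q < p \<longrightarrow> (\<forall>(a :: nat \<Rightarrow> complex) b.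
      (\<forall>n\<ge>1. norm (a n) < 1) \<longrightarrow> norm b < 1 \<longrightarrow>
      op_norm p (MT_max (\<lambda>n. mobius (- b) (a n))) \<le> ennreal (\<delta> q p) * op_norm q (MT_max a))) \<and>
    (\<forall>M. \<exists>\<eta>>0. \<forall>q p. 1 < q \<longrightarrow> q < p \<longrightarrow> p - q < \<eta> \<longrightarrow> \<delta> q p > M)"
  proof (intro exI[of _ \<delta>] conjI allI impI)
    fix q p :: real assume "1 < q" "q < p"
    then show "\<delta> q p > 0" by (auto simp: \<delta>_def intro!: add_nonneg_pos)
  next
    fix q p :: real and a :: "nat \<Rightarrow> complex" and b :: complex
    assume q: "1 < q" "q < p" and a: "\<forall>n\<ge>1. norm (a n) < 1" and b: "norm b < 1"
    have "op_norm p (MT_max (\<lambda>n. mobius (- b) (a n))) \<le> ennreal (2 * KW q p powr (1 / p)) * op_norm q (MT_max a)"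
      using a by (intro op_norm_mobius_le[OF q _ b]) auto
    also have "\<dots> \<le> ennreal (\<delta> q p) * op_norm q (MT_max a)"
      using q by (intro mult_right_mono ennreal_leI) (auto simp: \<delta>_def)
    finally show "op_norm p (MT_max (\<lambda>n. mobius (- b) (a n))) \<le> ennreal (\<delta> q p) * op_norm q (MT_max a)" .
  next
    fix M :: real
    show "\<exists>\<eta>>0. \<forall>q p. 1 < q \<longrightarrow> q < p \<longrightarrow> p - q < \<eta> \<longrightarrow> \<delta> q p > M"
    proof (intro exI[of _ "1 / (\<bar>M\<bar> + 1)"] conjI allI impI)
      fix q p :: real assume "1 < q" and qp: "q < p" and close: "p - q < 1 / (\<bar>M\<bar> + 1)"
      have "M < \<bar>M\<bar> + 1" by simp
      also have "\<dots> < 1 / (p - q)" using qp close by (simp add: field_simps)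
      also have "\<dots> \<le> \<delta> q p" by (simp add: \<delta>_def)
      finally show "\<delta> q p > M" .
    qed simp
  qed
qed

end
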